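(* Let $p\in\mathbb C[\mathbb Z^2]=\mathbb C[x^{\pm1},y^{\pm1}]$ be a Laurent polynomial of effective rank two with unimodular support. If $\mu(p)\mid p^N$ in $\mathbb C[\mathbb Z^2]$ for some integer $N>0$, then, up to multiplication by a Laurent unit and an integral monomial change of coordinates, $$p=(\alpha_0+\alpha_1x+\alpha_2y)^m\qquad\text{or}\qquad p=(\alpha_0+\alpha_1x)^r(\beta_0+\beta_1y)^s,$$ with integers $m,r,s>0$ and all displayed coefficients $\alpha_i,\beta_i$ nonzero complex numbers. Conversely, every such polynomial satisfies $\mu(p)\mid p^3$.
   Context: For $a\in\mathbb Z^2$ let $\chi^a$ denote the monomial (character) with exponent $a$. Write a nonzero Laurent polynomial as $p=\sum_{a\in\mathcal A}c_a\chi^a$ with all $c_a\neq0$, so $\mathcal A=\operatorname{supp}(p)$; its Newton polytope is $\operatorname{Newt}(p)=\operatorname{conv}(\mathcal A)$. The effective difference lattice is $M_p=\operatorname{span}_{\mathbb R}(\mathcal A-\mathcal A)\cap\mathbb Z^2$ and the effective rank is $\operatorname{rank}M_p$; in effective rank two, $M_p=\mathbb Z^2$. Choose $m_0\in\mathcal A$, put $\widehat p=\chi^{-m_0}p$, $\Theta_1=x\partial_x$, $\Theta_2=y\partial_y$, and $$\delta(p)=\det\bigl(\Theta_i\Theta_j\log\widehat p\bigr)_{i,j=1,2},\qquad \mu(p)=\widehat p^{\,3}\,\delta(p),$$ where $\Theta_i\Theta_j\log\widehat p:=\Theta_i(\Theta_j\widehat p/\widehat p)$. Then $\mu(p)$ is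 a Laurent polynomial; another choice of $m_0$ changes it only by a Laurent unit. A Laurent unit is a nonzero scalar times a character. An integral monomial change of coordinates is the automorphism $\chi^a\mapsto\chi^{ga}$ with $g\in\mathrm{GL}_2(\mathbb Z)$. The support is unimodular if at every vertex $v$ of $\operatorname{Newt}(p)$ the differences $a-v$, where $a$ runs over the support points nearest to $v$ (other than $v$) on the edges incident to $v$, form a $\mathbb Z$-basis of $M_p$. *)

theory Defs
  imports
    "HOL-Analysis.Analysis"
    "HOL-Library.Poly_Mapping"
    "HOL-Computational_Algebra.Fraction_Field"
begin

section \<open>Laurent polynomials in two variables\<close>

text \<open>
  The ring \<open>\<complex>[x\<^sup>\<plusminus>, y\<^sup>\<plusminus>]\<close> is represented as \<open>\<complex>[y\<^sup>\<plusminus>][x\<^sup>\<plusminus>]\<close>, i.e. as the iterated group algebra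
  of the group of integers (with convolution as multiplication). The iterated form, as opposed to
  finitely supported functions on \<open>\<int>\<^sup>2\<close>, makes the library instance of class \<open>idom\<close> applicable,
  so that the field of fractions is available. Everything below goes through \<open>lmonom\<close>
  and \<open>lcoeff\<close>, which are indexed by exponent vectors in \<open>\<int>\<^sup>2\<close>.
\<close>

type_synonym lattice = "int ^ 2"
type_synonym laurent = "int \<Rightarrow>\<^sub>0 (int \<Rightarrow>\<^sub>0 complex)"

definition lmonom :: "complex \<Rightarrow> lattice \<Rightarrow> laurent" where
  "lmonom c a = Poly_Mapping.single (a $ 1) (Poly_Mapping.single (a $ 2) c)"

definition lcoeff :: "laurent \<Rightarrow> lattice \<Rightarrow> complex" where
  "lcoeff p a = Poly_Mapping.lookup (Poly_Mapping.lookup p (a $ 1)) (a $ 2)"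

definition lsupp :: "laurent \<Rightarrow> lattice set" where
  "lsupp p = {a. lcoeff p a \<noteq> 0}"

definition laurent_unit :: "laurent \<Rightarrow> bool" where
  "laurent_unit u \<longleftrightarrow> (\<exists>c a. c \<noteq> 0 \<and> u = lmonom c a)"

text \<open>The linear extension of \<open>\<chi>\<^sup>a \<mapsto> \<chi>\<^bsup>g a\<^esup>\<close>.\<close>

definition monomial_change :: "int ^ 2 ^ 2 \<Rightarrow> laurent \<Rightarrow> laurent" where
  "monomial_change g p = (\<Sum>a\<in>lsupp p. lmonom (lcoeff p a) (g *v a))"

text \<open>The Euler derivations \<open>\<Theta>\<^sub>1 = x \<partial>\<^sub>x\<close> and \<open>\<Theta>\<^sub>2 = y \<partial>\<^sub>y\<close>.\<close>

definition Theta :: "2 \<Rightarrow> laurent \<Rightarrow> laurent" where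
  "Theta i p = (\<Sum>a\<in>lsupp p. lmonom (of_int (a $ i) * lcoeff p a) a)"

lemma lcoeff_ext:
  assumes "\<And>a. lcoeff p a = lcoeff q a"
  shows "p = q"
proof (intro poly_mapping_eqI)
  fix k l :: int
  show "Poly_Mapping.lookup (Poly_Mapping.lookup p k) l = Poly_Mapping.lookup (Poly_Mapping.lookup q k) l"
    using assms[of "vector [k, l]"] by (simp add: lcoeff_def vector_2)
qed

lemma lcoeff_lmonom: "lcoeff (lmonom c a) b = (if a = b then c else 0)"
  by (auto simp: lcoeff_def lmonom_def lookup_single when_def vec_eq_iff forall_2)

lemma lcoeff_add: "lcoeff (p + q) a = lcoeff p a + lcoeff q a"
  by (simp add: lcoeff_def lookup_add)

lemma lcoeff_0 [simp]: "lcoeff 0 a = 0"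
  by (simp add: lcoeff_def)

lemma lcoeff_sum: "lcoeff (sum f A) a = (\<Sum>x\<in>A. lcoeff (f x) a)"
  by (induction A rule: infinite_finite_induct) (auto simp: lcoeff_add)

lemma finite_lsupp: "finite (lsupp p)"
proof -
  have "lsupp p \<subseteq> (\<lambda>(k, l). vector [k, l]) `
      (SIGMA k:Poly_Mapping.keys p. Poly_Mapping.keys (Poly_Mapping.lookup p k))"
  proof
    fix a assume "a \<in> lsupp p"
    hence nz: "Poly_Mapping.lookup (Poly_Mapping.lookup p (a $ 1)) (a $ 2) \<noteq> 0"
      by (simp add: lsupp_def lcoeff_def)
    have "a = vector [a $ 1, a $ 2]"
      by (simp add: vec_eq_iff forall_2 vector_2)
    moreover have "a $ 1 \<in> Poly_Mapping.keys p" "a $ 2 \<in> Poly_Mapping.keys (Poly_Mapping.lookup p (a $ 1))"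
      using nz by (auto simp: in_keys_iff)
    ultimately show "a \<in> (\<lambda>(k, l). vector [k, l]) `
        (SIGMA k:Poly_Mapping.keys p. Poly_Mapping.keys (Poly_Mapping.lookup p k))"
      by (intro image_eqI[of _ _ "(a $ 1, a $ 2)"]) auto
  qed
  thus ?thesis
    by (rule finite_subset) auto
qed

lemma laurent_expand: "p = (\<Sum>a\<in>lsupp p. lmonom (lcoeff p a) a)"
  by (rule lcoeff_ext) (simp add: lcoeff_sum lcoeff_lmonom finite_lsupp, simp add: lsupp_def)

lemma lcoeff_Theta: "lcoeff (Theta i p) a = of_int (a $ i) * lcoeff p a"
  by (simp add: Theta_def lcoeff_sum lcoeff_lmonom finite_lsupp) (simp add: lsupp_def)

lemma Theta_add: "Theta i (p + q) = Theta i p + Theta i q"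
  by (rule lcoeff_ext) (simp add: lcoeff_Theta lcoeff_add algebra_simps)

lemma Theta_0 [simp]: "Theta i 0 = 0"
  by (rule lcoeff_ext) (simp add: lcoeff_Theta)

lemma Theta_sum: "Theta i (sum f A) = (\<Sum>x\<in>A. Theta i (f x))"
  by (induction A rule: infinite_finite_induct) (auto simp: Theta_add)

lemma lmonom_mult: "lmonom c a * lmonom d b = lmonom (c * d) (a + b)"
  by (simp add: lmonom_def mult_single)

lemma lmonom_add: "lmonom c a + lmonom d a = lmonom (c + d) a"
  by (rule lcoeff_ext) (simp add: lcoeff_add lcoeff_lmonom)

lemma Theta_lmonom: "Theta i (lmonom c a) = lmonom (of_int (a $ i) * c) a"
  by (rule lcoeff_ext) (simp add: lcoeff_Theta lcoeff_lmonom)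

lemma Theta_mult: "Theta i (p * q) = Theta i p * q + p * Theta i q"
proof -
  let ?f = "\<lambda>p a. lmonom (lcoeff p a) a"
  have mon: "Theta i (?f p a * ?f q b) = Theta i (?f p a) * ?f q b + ?f p a * Theta i (?f q b)" for a b
    by (simp add: Theta_lmonom lmonom_mult lmonom_add algebra_simps)
  have "Theta i (p * q) = Theta i ((\<Sum>a\<in>lsupp p. ?f p a) * (\<Sum>b\<in>lsupp q. ?f q b))"
    using laurent_expand[of p] laurent_expand[of q] by simp
  also have "\<dots> = (\<Sum>a\<in>lsupp p. \<Sum>b\<in>lsupp q. Theta i (?f p a * ?f q b))"
    by (simp only: sum_product Theta_sum)
  also have "\<dots> = Theta i (\<Sum>a\<in>lsupp p. ?f p a) * (\<Sum>b\<in>lsupp q. ?f q b)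
      + (\<Sum>a\<in>lsupp p. ?f p a) * Theta i (\<Sum>b\<in>lsupp q. ?f q b)"
    by (simp only: mon sum.distrib sum_product Theta_sum)
  also have "\<dots> = Theta i p * q + p * Theta i q"
    using laurent_expand[of p] laurent_expand[of q] by simp
  finally show ?thesis .
qed

section \<open>The logarithmic Hessian\<close>

text \<open>The extension of \<open>\<Theta>\<^sub>i\<close> to rational functions by the quotient rule.\<close>

lift_definition Theta_fract :: "2 \<Rightarrow> laurent fract \<Rightarrow> laurent fract"
  is "\<lambda>i q. (Theta i (fst q) * snd q - fst q * Theta i (snd q), (snd q)\<^sup>2)"
proof -
  fix i :: 2 and q r :: "laurent \<times> laurent"
  assume "fractrel q r"
  then obtain a b c d where q: "q = (a, b)" and r: "r = (c, d)"
    and nz: "b \<noteq> 0" "d \<noteq> 0" and eq: "a * d = c * b"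
    by (cases q; cases r) (auto simp: fractrel_def)
  have eq': "Theta i a * d + a * Theta i d = Theta i c * b + c * Theta i b"
    using arg_cong[OF eq, of "Theta i"] by (simp add: Theta_mult)
  have "(Theta i a * b - a * Theta i b) * d\<^sup>2 - (Theta i c * d - c * Theta i d) * b\<^sup>2
      = b * d * ((Theta i a * d + a * Theta i d) - (Theta i c * b + c * Theta i b))
        - (a * d - c * b) * (b * Theta i d + d * Theta i b)"
    by (simp add: algebra_simps power2_eq_square)
  also have "\<dots> = 0"
    using eq eq' by simp
  finally show "fractrel (Theta i (fst q) * snd q - fst q * Theta i (snd q), (snd q)\<^sup>2)
      (Theta i (fst r) * snd r - fst r * Theta i (snd r), (snd r)\<^sup>2)"
    using nz by (simp add: q r fractrel_def)
qed

text \<open>The translate \<open>\<chi>\<^bsup>-m\<^esup> p\<close>, usually written \<open>p\<close> with a hat.\<close>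

definition phat :: "lattice \<Rightarrow> laurent \<Rightarrow> laurent" where
  "phat m p = lmonom 1 (- m) * p"

definition log_hess :: "lattice \<Rightarrow> laurent \<Rightarrow> laurent fract ^ 2 ^ 2" where
  "log_hess m p = (\<chi> i j. Theta_fract i (Fract (Theta j (phat m p)) 1 / Fract (phat m p) 1))"

definition ldelta :: "lattice \<Rightarrow> laurent \<Rightarrow> laurent fract" where
  "ldelta m p = det (log_hess m p)"

text \<open>
  The element of the fraction field defining \<open>\<mu>(p)\<close> is a Laurent polynomial
  (see \<open>Fract_lmu\<close>); \<open>lmu\<close> is that Laurent polynomial.
\<close>

definition lmu :: "lattice \<Rightarrow> laurent \<Rightarrow> laurent" where
  "lmu m p = (THE q. Fract q 1 = Fract (phat m p) 1 ^ 3 * ldelta m p)"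

lemma Theta_fract_Fract:
  "b \<noteq> 0 \<Longrightarrow> Theta_fract i (Fract a b) = Fract (Theta i a * b - a * Theta i b) (b\<^sup>2)"
  by transfer auto

lemma phat_nonzero: "p \<noteq> 0 \<Longrightarrow> phat m p \<noteq> 0"
proof -
  have "lmonom 1 (- m) \<noteq> 0"
    using lcoeff_lmonom[of 1 "- m" "- m"] by (metis lcoeff_0 zero_neq_one)
  thus "p \<noteq> 0 \<Longrightarrow> phat m p \<noteq> 0"
    by (simp add: phat_def)
qed

lemma lmu_explicit:
  fixes p :: laurent and m :: lattice
  assumes "p \<noteq> 0"
  defines "q \<equiv> phat m p"
  defines "T \<equiv> \<lambda>i. Theta i q" and "H \<equiv> \<lambda>i j. Theta i (Theta j q)"
  defines "r \<equiv> q * (H 1 1 * H 2 2 - H 1 2 * H 2 1)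
    - H 1 1 * (T 2)\<^sup>2 - H 2 2 * (T 1)\<^sup>2 + (H 1 2 + H 2 1) * T 1 * T 2"
  shows "Fract r 1 = Fract (phat m p) 1 ^ 3 * ldelta m p" and "lmu m p = r"
proof -
  have q: "q \<noteq> 0"
    unfolding q_def by (rule phat_nonzero) fact
  have entry: "log_hess m p $ i $ j = Fract (H i j * q - T j * T i) (q\<^sup>2)" for i j
    using q by (simp add: log_hess_def flip: q_def) (simp add: Theta_fract_Fract H_def T_def)
  show *: "Fract r 1 = Fract (phat m p) 1 ^ 3 * ldelta m p"
    unfolding ldelta_def det_2 entry q_def[symmetric] power3_eq_cube
    using q by (simp add: eq_fract r_def) (simp add: algebra_simps eval_nat_numeral)
  show "lmu m p = r"
    unfolding lmu_def *[symmetric] by (rule the_equality) (auto simp: eq_fract)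
qed

lemma Fract_lmu: "p \<noteq> 0 \<Longrightarrow> Fract (lmu m p) 1 = Fract (phat m p) 1 ^ 3 * ldelta m p"
  using lmu_explicit[of p m] by simp

section \<open>Newton polytope, effective rank, unimodular support\<close>

definition real_pt :: "lattice \<Rightarrow> real ^ 2" where
  "real_pt a = (\<chi> i. of_int (a $ i))"

definition Newt :: "laurent \<Rightarrow> (real ^ 2) set" where
  "Newt p = convex hull (real_pt ` lsupp p)"

definition diff_lattice :: "laurent \<Rightarrow> lattice set" where
  "diff_lattice p =
     {a. real_pt a \<in> span {real_pt b - real_pt c |b c. b \<in> lsupp p \<and> c \<in> lsupp p}}"

global_interpretation zlat: module "(*s) :: int \<Rightarrow> lattice \<Rightarrow> lattice"
  by unfold_locales (auto simp: vec_eq_iff algebra_simps)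

definition lattice_rank :: "lattice set \<Rightarrow> nat" where
  "lattice_rank M = Max {card B |B. B \<subseteq> M \<and> finite B \<and> zlat.independent B}"

definition effective_rank :: "laurent \<Rightarrow> nat" where
  "effective_rank p = lattice_rank (diff_lattice p)"

definition is_zbasis :: "lattice set \<Rightarrow> lattice set \<Rightarrow> bool" where
  "is_zbasis B M \<longleftrightarrow> zlat.independent B \<and> zlat.span B = M"

text \<open>The support points other than \<open>v\<close> on the edge \<open>e\<close> that are nearest to the vertex \<open>v\<close>.\<close>

definition nearest_on_edge :: "laurent \<Rightarrow> lattice \<Rightarrow> (real ^ 2) set \<Rightarrow> lattice set" where
  "nearest_on_edge p v e =
     {a \<in> lsupp p. a \<noteq> v \<and> real_pt a \<in> e \<and>
        (\<forall>b\<in>lsupp p. b \<noteq> v \<and> real_pt b \<in> e \<longrightarrow>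
           dist (real_pt v) (real_pt a) \<le> dist (real_pt v) (real_pt b))}"

text \<open>
  All vertices of the Newton polytope are support points, so it suffices to let \<open>v\<close> range over the
  support.
\<close>

definition unimodular_support :: "laurent \<Rightarrow> bool" where
  "unimodular_support p \<longleftrightarrow>
     (\<forall>v\<in>lsupp p. real_pt v extreme_point_of Newt p \<longrightarrow>
        is_zbasis {a - v |a. \<exists>e. e edge_of Newt p \<and> real_pt v \<in> e \<and> a \<in> nearest_on_edge p v e}
          (diff_lattice p))"

section \<open>Normal forms\<close>

definition simplex_form :: "laurent \<Rightarrow> bool" where
  "simplex_form p \<longleftrightarrow>
     (\<exists>\<alpha>0 \<alpha>1 \<alpha>2 m. \<alpha>0 \<noteq> 0 \<and> \<alpha>1 \<noteq> 0 \<and> \<alpha>2 \<noteq> 0 \<and> m > 0 \<and>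
        p = (lmonom \<alpha>0 0 + lmonom \<alpha>1 (axis 1 1) + lmonom \<alpha>2 (axis 2 1)) ^ m)"

definition product_form :: "laurent \<Rightarrow> bool" where
  "product_form p \<longleftrightarrow>
     (\<exists>\<alpha>0 \<alpha>1 \<beta>0 \<beta>1 r s. \<alpha>0 \<noteq> 0 \<and> \<alpha>1 \<noteq> 0 \<and> \<beta>0 \<noteq> 0 \<and> \<beta>1 \<noteq> 0 \<and> r > 0 \<and> s > 0 \<and>
        p = (lmonom \<alpha>0 0 + lmonom \<alpha>1 (axis 1 1)) ^ r * (lmonom \<beta>0 0 + lmonom \<beta>1 (axis 2 1)) ^ s)"

definition laurent_equiv :: "laurent \<Rightarrow> laurent \<Rightarrow> bool" where
  "laurent_equiv p q \<longleftrightarrow>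
     (\<exists>u g. laurent_unit u \<and> invertible g \<and> p = u * monomial_change g q)"

end

theory Submission
  imports Defs
    "HOL-Computational_Algebra.Polynomial_Factorial"
    "HOL-Computational_Algebra.Field_as_Ring"
    "HOL-Computational_Algebra.Fundamental_Theorem_Algebra"
begin

text \<open>
  The Laurent polynomial \<open>\<mu>(p)\<close> is a bordered Hessian determinant, cubic in \<open>p\<close>. At an edge of the Newton
  polygon with primitive inner normal \<open>w\<close>, unimodularity provides a support point at height 1 above the
  edge, and expanding by \<open>w\<close>-weights gives \<open>ord\<^sub>w \<mu>(p) = 3 ord\<^sub>w p + 1\<close>.

  Let \<open>x\<close> be a prime factor of \<open>p\<close> of multiplicity \<open>m\<close>. If the support of \<open>x\<close> is two-dimensional, then
  \<open>x\<close> does not divide \<open>\<mu>(x)\<close>, because otherwise the logarithmic Gauss map of the curve \<open>x = 0\<close> would be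
  constant; so \<open>x\<close> has multiplicity \<open>3m - 3\<close> in \<open>\<mu>(p)\<close>. If the support of \<open>x\<close> lies on a line, the
  multiplicity is \<open>3m - 2\<close>. Since all primes dividing \<open>\<mu>(p)\<close> divide \<open>p\<close>, it follows that \<open>p\<^sup>3 = \<mu>(p) Q\<close>,
  where \<open>Q\<close> is divisible by \<open>x\<^sup>3\<close> or \<open>x\<^sup>2\<close> respectively and \<open>ord\<^sub>w Q = -1\<close> for all edge normals \<open>w\<close>. The origin
  is thus the only lattice point that can be interior to the Newton polygon of \<open>Q\<close>. For non-collinear
  \<open>a, b, c\<close> in the support of a two-dimensional factor \<open>x\<close>, the point \<open>a + b + c + e\<close> with \<open>e\<close> in the
  support of \<open>Q / x\<^sup>3\<close> is interior, so \<open>x\<close> is a trinomial and \<open>Q / x\<^sup>3\<close> is a unit. In the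
  same way two non-parallel one-dimensional factors are binomials and exhaust \<open>Q\<close>.
\<close>

section \<open>Weights and Euler derivations\<close>

text \<open>All multiplicity counts rest on the additivity of second logarithmic derivatives:
  \<open>lhess w z f\<close> is f^2 times such a derivative, so on a product
  \<open>x ^ m * q\<close> the determinant becomes an expression in x whose lowest coefficient can
  be read off. If x has two-dimensional support, that coefficient is, up to factors prime to x, the
  determinant of x itself. If x is homogeneous for a weight w, it contains
  \<open>lhess w w q\<close> of the cofactor q, over which x has no control; this is the obstacle.
  It is overcome globally: every prime of the determinant divides p, so the width of the determinant
  in direction w can be counted prime by prime modulo 3. The order of Q along each edge is 3 ord p -
  (3 ord p + 1) = -1, the shape of an anticanonical polygon. The two normal forms are the cases of
  the projective plane, where Q is a unit times x^3, and of a product of two projective lines, where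
  Q is a unit times x^2 y^2.\<close>

definition pairing :: "lattice \<Rightarrow> lattice \<Rightarrow> int" where
  "pairing w a = w $ 1 * a $ 1 + w $ 2 * a $ 2"

definition cross :: "lattice \<Rightarrow> lattice \<Rightarrow> int" where
  "cross a b = a $ 1 * b $ 2 - a $ 2 * b $ 1"

lemma lattice_eq_iff: "(a :: lattice) = b \<longleftrightarrow> a $ 1 = b $ 1 \<and> a $ 2 = b $ 2"
  by (simp add: vec_eq_iff forall_2)

lemma pairing_simps [simp]:
  "pairing w (a + b) = pairing w a + pairing w b"
  "pairing w (a - b) = pairing w a - pairing w b"
  "pairing w (- a) = - pairing w a"
  "pairing w 0 = 0"
  "pairing (- w) a = - pairing w a"
  by (simp_all add: pairing_def algebra_simps)

lemma lcoeff_uminus: "lcoeff (- p) a = - lcoeff p a"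
  using lcoeff_add[of p "- p" a] by (simp add: eq_neg_iff_add_eq_0 add.commute)

lemma lcoeff_diff: "lcoeff (p - q) a = lcoeff p a - lcoeff q a"
  using lcoeff_add[of p "- q" a] by (simp add: lcoeff_uminus)

lemma lsupp_iff: "a \<in> lsupp p \<longleftrightarrow> lcoeff p a \<noteq> 0"
  by (simp add: lsupp_def)

lemma lsupp_0 [simp]: "lsupp 0 = {}"
  by (simp add: lsupp_def)

lemma lsupp_empty_iff [simp]: "lsupp p = {} \<longleftrightarrow> p = 0"
proof
  assume "lsupp p = {}"
  thus "p = 0" by (intro lcoeff_ext) (auto simp: lsupp_def)
qed simp

lemma lmonom_0 [simp]: "lmonom 0 a = 0"
  by (rule lcoeff_ext) (simp add: lcoeff_lmonom)

lemma lmonom_eq_0_iff [simp]: "lmonom c a = 0 \<longleftrightarrow> c = 0"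
  by (metis lcoeff_0 lcoeff_lmonom lmonom_0)

lemma lsupp_lmonom: "c \<noteq> 0 \<Longrightarrow> lsupp (lmonom c a) = {a}"
  by (auto simp: lsupp_def lcoeff_lmonom)

lemma lmonom_1: "lmonom 1 0 = 1"
  by (simp add: lmonom_def)

lemma lmonom_uminus: "- lmonom c a = lmonom (- c) a"
  by (rule lcoeff_ext) (simp add: lcoeff_uminus lcoeff_lmonom)

lemma of_nat_laurent: "of_nat n = lmonom (of_nat n) 0"
  by (induction n) (auto simp: lmonom_add simp flip: lmonom_1)

lemma lmonom_diff: "lmonom c a - lmonom d a = lmonom (c - d) a"
  by (rule lcoeff_ext) (simp add: lcoeff_diff lcoeff_lmonom)

lemma of_int_laurent: "of_int n = lmonom (of_int n) 0"
  by (cases n) (auto simp: of_nat_laurent lmonom_uminus lmonom_diff simp flip: lmonom_1)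

lemma lcoeff_lmonom_mult: "lcoeff (lmonom c m * p) a = c * lcoeff p (a - m)"
proof -
  have "lcoeff (lmonom c m * p) a = lcoeff (lmonom c m * (\<Sum>b\<in>lsupp p. lmonom (lcoeff p b) b)) a"
    using laurent_expand[of p] by simp
  also have "\<dots> = (\<Sum>b\<in>lsupp p. if b = a - m then c * lcoeff p b else 0)"
    by (auto simp: sum_distrib_left lmonom_mult lcoeff_sum lcoeff_lmonom algebra_simps intro!: sum.cong)
  also have "\<dots> = c * lcoeff p (a - m)"
    by (simp add: finite_lsupp) (simp add: lsupp_def)
  finally show ?thesis .
qed

lemma lsupp_lmonom_mult: "c \<noteq> 0 \<Longrightarrow> lsupp (lmonom c m * p) = (+) m ` lsupp p"
proof -
  assume "c \<noteq> 0"
  have "a \<in> (+) m ` lsupp p \<longleftrightarrow> a - m \<in> lsupp p" for a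
    by (auto simp: image_iff intro!: bexI[of _ "a - m"])
  thus ?thesis using \<open>c \<noteq> 0\<close> unfolding lsupp_iff set_eq_iff by (simp add: lcoeff_lmonom_mult)
qed

lemma lcoeff_of_int_mult: "lcoeff (of_int n * p) a = of_int n * lcoeff p a"
  by (simp add: of_int_laurent lcoeff_lmonom_mult)

lemma lsupp_mult: "lsupp (p * q) \<subseteq> {a + b |a b. a \<in> lsupp p \<and> b \<in> lsupp q}"
proof
  fix c assume "c \<in> lsupp (p * q)"
  hence "lcoeff ((\<Sum>a\<in>lsupp p. lmonom (lcoeff p a) a) * q) c \<noteq> 0"
    unfolding laurent_expand[of p, symmetric] by (simp add: lsupp_iff)
  hence "(\<Sum>a\<in>lsupp p. lcoeff p a * lcoeff q (c - a)) \<noteq> 0"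
    by (simp add: sum_distrib_right lcoeff_sum lcoeff_lmonom_mult)
  then obtain a where "a \<in> lsupp p" "lcoeff p a * lcoeff q (c - a) \<noteq> 0"
    by (meson sum.neutral)
  hence "a \<in> lsupp p \<and> c - a \<in> lsupp q \<and> c = a + (c - a)"
    by (simp add: lsupp_iff)
  thus "c \<in> {a + b |a b. a \<in> lsupp p \<and> b \<in> lsupp q}"
    by blast
qed

lemma lsupp_add: "lsupp (p + q) \<subseteq> lsupp p \<union> lsupp q"
  by (auto simp: lsupp_def lcoeff_add)

text \<open>On a monomial this derivation is multiplication by its weight
  (\<open>lcoeff_Eul\<close>), which links differentiation to the grading by w.\<close>

definition Eul :: "lattice \<Rightarrow> laurent \<Rightarrow> laurent" where
  "Eul w p = of_int (w $ 1) * Theta 1 p + of_int (w $ 2) * Theta 2 p"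

lemma lcoeff_Eul: "lcoeff (Eul w p) a = of_int (pairing w a) * lcoeff p a"
  by (simp add: Eul_def lcoeff_add lcoeff_of_int_mult lcoeff_Theta pairing_def) (simp add: algebra_simps)

lemma Eul_add: "Eul w (p + q) = Eul w p + Eul w q"
  by (rule lcoeff_ext) (simp add: lcoeff_Eul lcoeff_add algebra_simps)

lemma Eul_diff: "Eul w (p - q) = Eul w p - Eul w q"
  by (rule lcoeff_ext) (simp add: lcoeff_Eul lcoeff_diff algebra_simps)

lemma Eul_0 [simp]: "Eul w 0 = 0"
  by (rule lcoeff_ext) (simp add: lcoeff_Eul)

lemma Eul_sum: "Eul w (sum f A) = (\<Sum>x\<in>A. Eul w (f x))"
  by (induction A rule: infinite_finite_induct) (auto simp: Eul_add)

lemma Eul_mult: "Eul w (p * q) = Eul w p * q + p * Eul w q"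
  by (simp add: Eul_def Theta_mult algebra_simps)

lemma Eul_of_int_mult: "Eul w (of_int n * p) = of_int n * Eul w p"
  by (rule lcoeff_ext) (simp add: lcoeff_Eul lcoeff_of_int_mult)

lemma Eul_lmonom: "Eul w (lmonom c a) = lmonom (of_int (pairing w a) * c) a"
  by (rule lcoeff_ext) (simp add: lcoeff_Eul lcoeff_lmonom)

lemma Eul_1 [simp]: "Eul w 1 = 0"
  using Eul_lmonom[of w 1 0] by (simp add: lmonom_1)

lemma Eul_commute: "Eul w (Eul z p) = Eul z (Eul w p)"
  by (rule lcoeff_ext) (simp add: lcoeff_Eul)

lemma lsupp_Eul: "lsupp (Eul w p) \<subseteq> lsupp p"
  by (auto simp: lsupp_def lcoeff_Eul)

section \<open>Orders with respect to a weight\<close>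

definition hom_part :: "lattice \<Rightarrow> int \<Rightarrow> laurent \<Rightarrow> laurent" where
  "hom_part w h p = (\<Sum>a\<in>{a \<in> lsupp p. pairing w a = h}. lmonom (lcoeff p a) a)"

text \<open>A lower bound rather than an order: it also holds for 0, so sums and products are
  estimated without case distinctions.\<close>

definition weight_ge :: "lattice \<Rightarrow> int \<Rightarrow> laurent \<Rightarrow> bool" where
  "weight_ge w h p \<longleftrightarrow> (\<forall>a\<in>lsupp p. h \<le> pairing w a)"

definition homog :: "lattice \<Rightarrow> int \<Rightarrow> laurent \<Rightarrow> bool" where
  "homog w h p \<longleftrightarrow> (\<forall>a\<in>lsupp p. pairing w a = h)"

lemma lcoeff_hom_part: "lcoeff (hom_part w h p) a = (if pairing w a = h then lcoeff p a else 0)"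
  by (simp add: hom_part_def lcoeff_sum lcoeff_lmonom finite_lsupp) (auto simp: lsupp_def)

lemma hom_part_add: "hom_part w h (p + q) = hom_part w h p + hom_part w h q"
  by (rule lcoeff_ext) (simp add: lcoeff_hom_part lcoeff_add)

lemma hom_part_sum: "hom_part w h (sum f A) = (\<Sum>x\<in>A. hom_part w h (f x))"
  by (rule lcoeff_ext) (simp add: lcoeff_hom_part lcoeff_sum)

lemma lsupp_hom_part: "lsupp (hom_part w h p) = {a \<in> lsupp p. pairing w a = h}"
  by (auto simp: lsupp_def lcoeff_hom_part)

lemma homog_hom_part [simp]: "homog w h (hom_part w h p)"
  by (auto simp: homog_def lsupp_hom_part)

lemma hom_part_homog: "homog w k p \<Longrightarrow> hom_part w h p = (if h = k then p else 0)"
  by (rule lcoeff_ext) (auto simp: lcoeff_hom_part homog_def lsupp_def)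

lemma homog_0 [simp]: "homog w h 0"
  by (simp add: homog_def)

lemma homog_add: "homog w h p \<Longrightarrow> homog w h q \<Longrightarrow> homog w h (p + q)"
  using lsupp_add[of p q] unfolding homog_def by blast

lemma homog_mult: "homog w h p \<Longrightarrow> homog w k q \<Longrightarrow> homog w (h + k) (p * q)"
  unfolding homog_def by (auto dest!: subsetD[OF lsupp_mult])

lemma homog_Eul: "homog w h p \<Longrightarrow> Eul w p = of_int h * p"
  by (rule lcoeff_ext) (auto simp: lcoeff_Eul lcoeff_of_int_mult homog_def lsupp_def)

lemma weight_ge_0 [simp]: "weight_ge w h 0"
  by (simp add: weight_ge_def)

lemma weight_ge_mono: "weight_ge w h p \<Longrightarrow> k \<le> h \<Longrightarrow> weight_ge w k p"
  by (force simp: weight_ge_def)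

lemma weight_ge_homog: "homog w h p \<Longrightarrow> weight_ge w h p"
  by (simp add: weight_ge_def homog_def)

lemma weight_ge_add: "weight_ge w h p \<Longrightarrow> weight_ge w h q \<Longrightarrow> weight_ge w h (p + q)"
  using lsupp_add[of p q] unfolding weight_ge_def by blast

lemma lsupp_diff: "lsupp (p - q) \<subseteq> lsupp p \<union> lsupp q"
  by (auto simp: lsupp_iff lcoeff_diff)

lemma weight_ge_diff: "weight_ge w h p \<Longrightarrow> weight_ge w h q \<Longrightarrow> weight_ge w h (p - q)"
  using lsupp_diff[of p q] unfolding weight_ge_def by blast

lemma weight_ge_mult: "weight_ge w h p \<Longrightarrow> weight_ge w k q \<Longrightarrow> weight_ge w (h + k) (p * q)"
  unfolding weight_ge_def by (auto dest!: subsetD[OF lsupp_mult] intro!: add_mono)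

lemma weight_ge_Eul: "weight_ge w h p \<Longrightarrow> weight_ge w h (Eul z p)"
  using lsupp_Eul[of z p] unfolding weight_ge_def by blast

text \<open>Weights are integers, so removing the lowest part raises the bound by a full 1.\<close>

lemma weight_ge_rest: "weight_ge w h p \<Longrightarrow> weight_ge w (h + 1) (p - hom_part w h p)"
  by (auto simp: weight_ge_def lsupp_iff lcoeff_diff lcoeff_hom_part Ball_def order.order_iff_strict
    add1_zle_eq split: if_splits)

lemma hom_part_eq_0: "weight_ge w h p \<Longrightarrow> k < h \<Longrightarrow> hom_part w k p = 0"
  by (rule lcoeff_ext) (auto simp: weight_ge_def lsupp_def lcoeff_hom_part)

text \<open>For p = 0 the minimum of the empty set is unspecified, whence the nonvanishing
  assumptions in the multiplicative laws.\<close>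

definition ordw :: "lattice \<Rightarrow> laurent \<Rightarrow> int" where
  "ordw w p = Min (pairing w ` lsupp p)"

lemma weight_ge_ordw: "weight_ge w (ordw w p) p"
  by (simp add: weight_ge_def ordw_def finite_lsupp)

lemma ordw_attained: "p \<noteq> 0 \<Longrightarrow> \<exists>a\<in>lsupp p. pairing w a = ordw w p"
proof -
  assume "p \<noteq> 0"
  hence "ordw w p \<in> pairing w ` lsupp p"
    unfolding ordw_def by (intro Min_in) (auto simp: finite_lsupp)
  thus ?thesis by auto
qed

lemma ordw_le: "a \<in> lsupp p \<Longrightarrow> ordw w p \<le> pairing w a"
  by (simp add: ordw_def finite_lsupp)

lemma hom_part_ordw_nonzero: "p \<noteq> 0 \<Longrightarrow> hom_part w (ordw w p) p \<noteq> 0"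
  using ordw_attained[of p w] by (auto simp flip: lsupp_empty_iff simp: lsupp_hom_part)

lemma ordw_eqI: "weight_ge w h p \<Longrightarrow> hom_part w h p \<noteq> 0 \<Longrightarrow> ordw w p = h"
proof -
  assume h: "weight_ge w h p" "hom_part w h p \<noteq> 0"
  then obtain a where a: "a \<in> lsupp p" "pairing w a = h"
    by (auto simp flip: lsupp_empty_iff simp: lsupp_hom_part)
  thus ?thesis
    unfolding ordw_def using h(1) by (intro Min_eqI) (auto simp: finite_lsupp weight_ge_def)
qed

text \<open>Replacing both factors by their lowest parts changes the product only in weights above h
  + k.\<close>

lemma hom_part_mult:
  assumes "weight_ge w h p" "weight_ge w k q"
  shows "hom_part w (h + k) (p * q) = hom_part w h p * hom_part w k q"
proof -
  let ?f = "hom_part w h p" and ?g = "hom_part w k q"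
  define r where "r = ?f * (q - ?g) + (p - ?f) * q"
  have "p * q = ?f * ?g + r"
    by (simp add: r_def algebra_simps)
  moreover have "weight_ge w (h + k + 1) r"
    unfolding r_def
    using weight_ge_mult[OF weight_ge_homog[OF homog_hom_part] weight_ge_rest[OF assms(2)], of h p]
      weight_ge_mult[OF weight_ge_rest[OF assms(1)] assms(2)]
    by (intro weight_ge_add) (simp_all add: algebra_simps)
  moreover have "homog w (h + k) (?f * ?g)"
    by (intro homog_mult) auto
  ultimately show ?thesis
    by (simp add: hom_part_add hom_part_homog hom_part_eq_0)
qed

text \<open>In an integral domain the product of the two lowest parts cannot vanish.\<close>

lemma ordw_mult: "p \<noteq> 0 \<Longrightarrow> q \<noteq> 0 \<Longrightarrow> ordw w (p * q) = ordw w p + ordw w q"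
  using weight_ge_mult[OF weight_ge_ordw[of w p] weight_ge_ordw[of w q]]
  by (intro ordw_eqI) (simp_all add: hom_part_mult weight_ge_ordw hom_part_ordw_nonzero)

lemma ordw_1 [simp]: "ordw w 1 = 0"
  using lsupp_lmonom[of 1 0] by (simp add: ordw_def lmonom_1)

lemma ordw_lmonom: "c \<noteq> 0 \<Longrightarrow> ordw w (lmonom c a) = pairing w a"
  by (simp add: ordw_def lsupp_lmonom)

lemma ordw_power: "p \<noteq> 0 \<Longrightarrow> ordw w (p ^ n) = int n * ordw w p"
  by (induction n) (auto simp: ordw_mult algebra_simps)

text \<open>Let a be an exponent of the cofactor h and take the weight -a. The inclusion of supports
  gives ord g >= ord f, hence ord h >= 0, whereas a itself has weight -(a,a). So only a = 0 is
  possible.\<close>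

lemma dvd_supp_subset_imp_const:
  assumes "f dvd g" "lsupp g \<subseteq> lsupp f"
  shows "\<exists>c. g = lmonom c 0 * f"
proof (cases "g = 0")
  case True
  thus ?thesis by (intro exI[of _ 0]) simp
next
  case False
  obtain h where h: "g = f * h" using assms(1) by auto
  have nz: "f \<noteq> 0" "h \<noteq> 0" using False h by auto
  have "a = 0" if "a \<in> lsupp h" for a
  proof (rule ccontr)
    assume "a \<noteq> 0"
    have "ordw (- a) f \<le> ordw (- a) g"
      using ordw_attained[OF False, of "- a"] assms(2) by (metis ordw_le subsetD)
    hence "0 \<le> ordw (- a) h" using nz by (simp add: h ordw_mult)
    also have "\<dots> \<le> - pairing a a" using ordw_le[OF that, of "- a"] by simp
    finally have "a $ 1 * a $ 1 + a $ 2 * a $ 2 \<le> 0" by (simp add: pairing_def)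
    hence "a $ 1 = 0 \<and> a $ 2 = 0"
      by (simp add: sum_squares_le_zero_iff)
    hence "a = 0"
      by (simp add: lattice_eq_iff)
    thus False using \<open>a \<noteq> 0\<close> by simp
  qed
  hence "h = lmonom (lcoeff h 0) 0"
    by (intro lcoeff_ext) (auto simp: lcoeff_lmonom lsupp_iff)
  hence "g = lmonom (lcoeff h 0) 0 * f" using h by (simp add: mult.commute)
  thus ?thesis by blast
qed

section \<open>Prime factorization\<close>

definition lift_poly :: "('a :: comm_ring_1 \<Rightarrow> laurent) \<Rightarrow> laurent \<Rightarrow> 'a poly \<Rightarrow> laurent" where
  "lift_poly f x p = poly (map_poly f p) x"

context
  fixes f :: "'a :: comm_ring_1 \<Rightarrow> laurent" and x :: laurent
  assumes f_0: "f 0 = 0" and f_1: "f 1 = 1"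
    and f_add: "\<And>a b. f (a + b) = f a + f b" and f_mult: "\<And>a b. f (a * b) = f a * f b"
begin

lemma lift_poly_0: "lift_poly f x 0 = 0"
  by (simp add: lift_poly_def)

lemma lift_poly_pCons: "lift_poly f x (pCons a p) = f a + x * lift_poly f x p"
  by (simp add: lift_poly_def map_poly_pCons f_0)

lemma lift_poly_1: "lift_poly f x 1 = 1"
  unfolding one_pCons lift_poly_pCons lift_poly_0 by (simp add: f_1)

lemma lift_poly_add: "lift_poly f x (p + q) = lift_poly f x p + lift_poly f x q"
proof (induction p arbitrary: q)
  case 0
  show ?case by (simp add: lift_poly_0)
next
  case (pCons a p)
  obtain b r where "q = pCons b r" by (cases q)
  thus ?case using pCons.IH[of r] by (simp add: lift_poly_pCons f_add algebra_simps)
qed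

lemma lift_poly_smult: "lift_poly f x (smult a p) = f a * lift_poly f x p"
  by (induction p) (simp_all add: lift_poly_0 lift_poly_pCons f_mult algebra_simps)

lemma lift_poly_mult: "lift_poly f x (p * q) = lift_poly f x p * lift_poly f x q"
  by (induction p)
    (simp_all add: lift_poly_0 lift_poly_pCons lift_poly_add lift_poly_smult f_0 algebra_simps)

end

definition lift1 :: "complex poly \<Rightarrow> laurent" where
  "lift1 = lift_poly (\<lambda>c. lmonom c 0) (lmonom 1 (axis 2 1))"

text \<open>Identifies C[y][x], where prime factorizations are available, with the Laurent
  polynomials without negative exponents (\<open>lcoeff_lift2\<close>,
  \<open>lift2_inject\<close>).\<close>

definition lift2 :: "complex poly poly \<Rightarrow> laurent" where
  "lift2 = lift_poly lift1 (lmonom 1 (axis 1 1))"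

lemma axis_lattice [simp]:
  "axis 1 (k::int) $ (1::2) = k" "axis 1 (k::int) $ (2::2) = 0"
  "axis 2 (k::int) $ (1::2) = 0" "axis 2 (k::int) $ (2::2) = k"
  by (simp_all add: axis_def)

lemma lift1_pCons: "lift1 (pCons a p) = lmonom a 0 + lmonom 1 (axis 2 1) * lift1 p"
  unfolding lift1_def by (rule lift_poly_pCons) (auto simp: lmonom_1 lmonom_add lmonom_mult)

lemma lift1_0: "lift1 0 = 0" and lift1_1: "lift1 1 = 1"
  and lift1_add: "lift1 (p + q) = lift1 p + lift1 q"
  and lift1_mult: "lift1 (p * q) = lift1 p * lift1 q"
  unfolding lift1_def
  by (rule lift_poly_0 lift_poly_1 lift_poly_add lift_poly_mult;
    simp add: lmonom_1 lmonom_add lmonom_mult)+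

lemma lift2_pCons: "lift2 (pCons a p) = lift1 a + lmonom 1 (axis 1 1) * lift2 p"
  unfolding lift2_def
  by (rule lift_poly_pCons) (auto simp: lift1_0 lift1_1 lift1_add lift1_mult)

lemma lift2_0: "lift2 0 = 0" and lift2_1: "lift2 1 = 1"
  and lift2_add: "lift2 (p + q) = lift2 p + lift2 q"
  and lift2_mult: "lift2 (p * q) = lift2 p * lift2 q"
  unfolding lift2_def
  by (rule lift_poly_0 lift_poly_1 lift_poly_add lift_poly_mult;
    simp add: lift1_0 lift1_1 lift1_add lift1_mult)+

lemma lcoeff_lift1: "lcoeff (lift1 p) a = (if a $ 1 = 0 \<and> a $ 2 \<ge> 0 then coeff p (nat (a $ 2)) else 0)"
proof (induction p arbitrary: a)
  case 0
  show ?case by (simp add: lift1_0)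
next
  case (pCons b p)
  show ?case
    by (cases "a $ 2 = 0"; cases "a $ 2 > 0")
      (auto simp: lift1_pCons lcoeff_add lcoeff_lmonom lcoeff_lmonom_mult pCons.IH lattice_eq_iff
        coeff_pCons nat_diff_distrib split: nat.splits)
qed

lemma lcoeff_lift2: "lcoeff (lift2 p) a =
  (if a $ 1 \<ge> 0 \<and> a $ 2 \<ge> 0 then coeff (coeff p (nat (a $ 1))) (nat (a $ 2)) else 0)"
proof (induction p arbitrary: a)
  case 0
  show ?case by (simp add: lift2_0)
next
  case (pCons b p)
  show ?case
    by (cases "a $ 1 = 0"; cases "a $ 1 > 0")
      (auto simp: lift2_pCons lcoeff_add lcoeff_lift1 lcoeff_lmonom_mult pCons.IH lattice_eq_iff
        coeff_pCons nat_diff_distrib split: nat.splits)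
qed

lemma lift2_inject: "lift2 p = lift2 q \<longleftrightarrow> p = q"
proof
  assume eq: "lift2 p = lift2 q"
  have "coeff (coeff p i) j = coeff (coeff q i) j" for i j
    using arg_cong[OF eq, of "\<lambda>r. lcoeff r (vector [int i, int j])"]
    by (simp add: lcoeff_lift2 vector_2)
  thus "p = q" by (intro poly_eqI)
qed simp

lemma lmonom_in_range_lift2:
  assumes "a $ 1 \<ge> 0" "a $ 2 \<ge> 0"
  shows "lmonom c a \<in> range lift2"
proof -
  have "lmonom c a = lift2 (monom (monom c (nat (a $ 2))) (nat (a $ 1)))"
    by (rule lcoeff_ext)
      (use assms in \<open>auto simp: lcoeff_lmonom lcoeff_lift2 coeff_monom lattice_eq_iff nat_eq_iff\<close>)
  thus ?thesis by blast
qed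

lemma range_lift2_sum:
  assumes "finite A" "\<And>x. x \<in> A \<Longrightarrow> f x \<in> range lift2"
  shows "sum f A \<in> range lift2"
  using assms
proof (induction A rule: finite_induct)
  case empty
  show ?case using lift2_0 by (metis rangeI sum.empty)
next
  case (insert x A)
  then obtain p q where "f x = lift2 p" "sum f A = lift2 q" by blast
  thus ?case using insert.hyps lift2_add by (metis rangeI sum.insert)
qed

text \<open>A monomial clears all negative exponents; the sum of the absolute values of the
  exponents is a crude but sufficient choice. The shift has nonnegative entries, so that the
  monomial lies in the range of \<open>lift2\<close> too.\<close>

lemma lift2_surj:
  obtains a P where "a $ 1 \<ge> 0" "a $ 2 \<ge> 0" "lmonom 1 a * p = lift2 P"
proof -
  define a :: lattice where
    "a = vector [\<Sum>b\<in>lsupp p. \<bar>b $ 1\<bar>, \<Sum>b\<in>lsupp p. \<bar>b $ 2\<bar>]"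
  have le: "\<bar>b $ i\<bar> \<le> (\<Sum>b\<in>lsupp p. \<bar>b $ i\<bar>)" if "b \<in> lsupp p" for b i
    using that by (intro member_le_sum) (auto simp: finite_lsupp)
  have "lmonom 1 a * p = (\<Sum>b\<in>lsupp p. lmonom (lcoeff p b) (a + b))"
    by (subst laurent_expand[of p]) (simp add: sum_distrib_left lmonom_mult)
  also have "\<dots> \<in> range lift2"
  proof (intro range_lift2_sum finite_lsupp lmonom_in_range_lift2)
    fix b assume "b \<in> lsupp p"
    from le[OF this, of 1] le[OF this, of 2] show "(a + b) $ 1 \<ge> 0" "(a + b) $ 2 \<ge> 0"
      by (simp_all add: a_def vector_2)
  qed
  finally obtain P where "lmonom 1 a * p = lift2 P" by blast
  moreover have "a $ 1 \<ge> 0" "a $ 2 \<ge> 0"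
    by (simp_all add: a_def vector_2 sum_nonneg)
  ultimately show ?thesis using that by blast
qed

section \<open>Units and primes of the Laurent ring\<close>

lemma lmonom_dvd_1: "c \<noteq> 0 \<Longrightarrow> lmonom c a dvd 1"
  by (rule dvdI[of _ _ "lmonom (1 / c) (- a)"]) (simp add: lmonom_mult lmonom_1)

text \<open>For inverse elements p and q the orders are opposite, for w as well as for -w. This
  forces every exponent of p to have the weight opposite to that of any exponent of q, for all w, so
  p has a single exponent.\<close>

lemma unit_imp_lmonom:
  assumes "p dvd 1"
  shows "\<exists>c a. c \<noteq> 0 \<and> p = lmonom c a"
proof -
  obtain q where q: "p * q = 1" using assms by (metis dvdE)
  hence nz: "p \<noteq> 0" "q \<noteq> 0" by auto
  have opp: "ordw w q = - ordw w p" for w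
    using ordw_mult[OF nz, of w] by (simp add: q)
  have "a = b" if "a \<in> lsupp p" "b \<in> lsupp p" for a b
  proof -
    obtain c where c: "c \<in> lsupp q" using nz by (metis ex_in_conv lsupp_empty_iff)
    have "pairing w d = - pairing w c" if "d \<in> lsupp p" for w d
      using ordw_le[OF that, of w] ordw_le[OF that, of "- w"] ordw_le[OF c, of w]
        ordw_le[OF c, of "- w"] opp[of w] opp[of "- w"] by simp
    from this[OF that(1)] this[OF that(2)] have "pairing w a = pairing w b" for w
      by simp
    from this[of "axis 1 1"] this[of "axis 2 1"] show ?thesis
      by (simp add: pairing_def lattice_eq_iff)
  qed
  moreover obtain a where a: "a \<in> lsupp p" using nz by (metis ex_in_conv lsupp_empty_iff)
  ultimately have "p = lmonom (lcoeff p a) a"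
    by (intro lcoeff_ext) (auto simp: lcoeff_lmonom lsupp_iff)
  thus ?thesis using a by (auto simp: lsupp_iff)
qed

lemma laurent_unit_iff: "laurent_unit u \<longleftrightarrow> u dvd 1"
  using unit_imp_lmonom lmonom_dvd_1 by (auto simp: laurent_unit_def)

text \<open>Clearing denominators turns divisibility in the Laurent ring into divisibility in
  C[y][x] up to a monomial K, and P cannot divide K because K lifts to a unit while P does
  not.\<close>

lemma lift2_prime:
  assumes "prime_elem P" "\<not> lift2 P dvd 1"
  shows "prime_elem (lift2 P)"
proof (rule prime_elemI)
  show "lift2 P \<noteq> 0" using assms(1) lift2_inject[of P 0] by (auto simp: lift2_0)
  show "\<not> lift2 P dvd 1" by fact
  fix a b assume "lift2 P dvd a * b"
  then obtain z where z: "a * b = lift2 P * z" by blast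
  obtain i A where A: "lmonom 1 i * a = lift2 A" by (rule lift2_surj)
  obtain j B where B: "lmonom 1 j * b = lift2 B" by (rule lift2_surj)
  obtain k Z where Z: "k $ 1 \<ge> 0" "k $ 2 \<ge> 0" "lmonom 1 k * (lmonom 1 (i + j) * z) = lift2 Z"
    by (rule lift2_surj)
  obtain K where K: "lmonom 1 k = lift2 K"
    using lmonom_in_range_lift2[OF Z(1,2)] by blast
  have "lift2 (K * (A * B)) = lmonom 1 k * (lmonom 1 (i + j) * (a * b))"
    by (simp add: lift2_mult mult_ac flip: A B K) (simp add: lmonom_mult add_ac flip: mult.assoc)
  also have "\<dots> = lift2 (P * Z)"
    by (simp add: z lift2_mult mult_ac flip: Z(3))
  finally have "P dvd K * (A * B)" by (simp add: lift2_inject)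
  moreover have "\<not> P dvd K"
  proof
    assume "P dvd K"
    hence "lift2 P dvd lmonom 1 k" by (auto simp: K lift2_mult)
    thus False using assms(2) lmonom_dvd_1[of 1 k] dvd_trans by auto
  qed
  ultimately have AB: "P dvd A \<or> P dvd B"
    using assms(1) by (auto simp: prime_elem_dvd_mult_iff)
  have *: "lift2 P dvd c" if "P dvd C" "lmonom 1 l * c = lift2 C" for c C l
  proof -
    have "lift2 P dvd lmonom 1 l * c" using that by (auto simp: lift2_mult)
    hence "lift2 P dvd lmonom 1 (- l) * (lmonom 1 l * c)" by (rule dvd_mult)
    thus ?thesis by (simp add: lmonom_mult lmonom_1 flip: mult.assoc)
  qed
  show "lift2 P dvd a \<or> lift2 P dvd b" using AB *[OF _ A] *[OF _ B] by blast
qed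

lemma unit_cofactor: "c \<noteq> 0 \<Longrightarrow> lmonom c a * p = q \<Longrightarrow> p = lmonom (1 / c) (- a) * q"
  by (auto simp: lmonom_mult lmonom_1 simp flip: mult.assoc)

text \<open>The factorization is carried over from C[y][x]. Prime factors that become invertible,
  such as the two variables, are absorbed into the unit.\<close>

lemma laurent_factorization:
  fixes p :: laurent
  assumes "p \<noteq> 0"
  shows "\<exists>u A. u dvd 1 \<and> (\<forall>x\<in>#A. prime_elem x) \<and> p = u * prod_mset A"
proof -
  obtain a P where P: "lmonom 1 a * p = lift2 P" by (rule lift2_surj)
  have "P \<noteq> 0" using P assms by (auto simp: lift2_0)
  then obtain A where A: "\<And>x. x \<in># A \<Longrightarrow> prime_elem x" "normalize (prod_mset A) = normalize P"
    using prime_factorization_exists by metis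
  from associatedE1[OF A(2)[symmetric]] obtain u where u: "u dvd 1" "P = u * prod_mset A"
    by blast
  have unit: "lift2 u dvd 1" 
  proof -
    obtain v where "1 = u * v" using u(1) by blast
    thus ?thesis by (intro dvdI[of _ _ "lift2 v"]) (simp flip: lift2_mult lift2_1)
  qed
  have "\<exists>u B. u dvd 1 \<and> (\<forall>x\<in>#B. prime_elem x) \<and> lift2 (prod_mset A) = u * prod_mset B"
    using A(1)
  proof (induction A)
    case empty
    show ?case by (intro exI[of _ 1] exI[of _ "{#}"]) (simp add: lift2_1)
  next
    case (add x A)
    then obtain u B where B: "u dvd 1" "\<forall>x\<in>#B. prime_elem x" "lift2 (prod_mset A) = u * prod_mset B"
      by auto
    show ?case
    proof (cases "lift2 x dvd 1")
      case True
      thus ?thesis using B by (intro exI[of _ "lift2 x * u"] exI[of _ B])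
          (use mult_dvd_mono[OF True B(1)] in \<open>auto simp: lift2_mult mult_ac\<close>)
    next
      case False
      hence "prime_elem (lift2 x)" using lift2_prime add.prems by simp
      thus ?thesis using B
        by (intro exI[of _ u] exI[of _ "add_mset (lift2 x) B"]) (auto simp: lift2_mult mult_ac)
    qed
  qed
  then obtain v B where B: "v dvd 1" "\<forall>x\<in>#B. prime_elem x" "lift2 (prod_mset A) = v * prod_mset B"
    by blast
  have "p = lmonom 1 (- a) * (lift2 u * (v * prod_mset B))"
    using unit_cofactor[OF _ P] B(3) u(2) by (simp add: lift2_mult)
  hence "p = (lmonom 1 (- a) * lift2 u * v) * prod_mset B" by (simp add: mult_ac)
  moreover have "lmonom 1 (- a) * lift2 u * v dvd 1"
    using mult_dvd_mono[OF mult_dvd_mono[OF lmonom_dvd_1[of 1 "- a"] unit] B(1)] by simp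
  ultimately show ?thesis using B(2) by blast
qed

section \<open>Associated primes and multiplicities\<close>

lemma prime_dvd_prime_sym:
  fixes p q :: laurent
  assumes "prime_elem p" "prime_elem q" "p dvd q"
  shows "q dvd p"
proof -
  obtain y where y: "q = p * y" using assms(3) by blast
  have "q dvd p * y" by (simp add: y)
  hence "q dvd p \<or> q dvd y" using assms(2) by (simp add: prime_elem_dvd_multD)
  moreover have "\<not> q dvd y"
  proof
    assume "q dvd y"
    then obtain z where "y = q * z" by blast
    hence "q * 1 = q * (p * z)" using y by (simp add: mult_ac)
    hence "1 = p * z" using assms(2) by (metis mult_cancel_left prime_elem_not_zeroI)
    hence "p dvd 1" by (rule dvdI)
    thus False using assms(1) by (simp add: prime_elem_not_unit)
  qed
  ultimately show ?thesis by blast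
qed

lemma prime_power_coprime_dvd:
  fixes p :: laurent
  assumes "prime_elem p" "\<not> p dvd x" "p ^ k dvd x * y"
  shows "p ^ k dvd y"
  using assms(3)
proof (induction k arbitrary: y)
  case (Suc k)
  have "p dvd x * y" using Suc.prems by (meson dvd_power dvd_trans zero_less_Suc)
  then obtain z where z: "y = p * z" using assms(1,2) prime_elem_dvd_multD by blast
  have "p * p ^ k dvd p * (x * z)" using Suc.prems by (simp add: z mult_ac)
  hence "p ^ k dvd x * z" using assms(1) by (simp add: prime_elem_not_zeroI)
  from Suc.IH[OF this] show ?case by (simp add: z)
qed simp

text \<open>Members of A associated with x are units times x; the units are collected in v. The
  count of sizes makes the induction in \<open>laurent_prime_induct\<close> well-founded.\<close>

lemma prime_split:
  fixes p x u :: laurent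
  assumes "u dvd 1" "\<forall>x\<in>#A. prime_elem x" "prime_elem x"
  shows "\<exists>n v B. v dvd 1 \<and> (\<forall>x\<in>#B. prime_elem x) \<and> size A = n + size B \<and>
    u * prod_mset A = x ^ n * (v * prod_mset B) \<and> \<not> x dvd v * prod_mset B"
  using assms(2)
proof (induction A)
  case empty
  have "\<not> x dvd u" using assms(1,3) dvd_trans prime_elem_not_unit by blast
  thus ?case using assms(1) by (intro exI[of _ 0] exI[of _ u] exI[of _ "{#}"]) auto
next
  case (add y A)
  then obtain n v B where B: "v dvd 1" "\<forall>x\<in>#B. prime_elem x" "size A = n + size B"
    "u * prod_mset A = x ^ n * (v * prod_mset B)" "\<not> x dvd v * prod_mset B"
    by auto
  show ?case
  proof (cases "x dvd y")
    case True
    then obtain c where c: "y = x * c" by blast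
    have "y dvd x" using prime_dvd_prime_sym[OF assms(3) _ True] add.prems by simp
    then obtain e where "x = y * e" by blast
    hence "x * 1 = x * (c * e)" by (simp add: c mult_ac)
    hence "c dvd 1" using assms(3) by (metis dvdI mult_cancel_left prime_elem_not_zeroI)
    hence "c * v dvd 1" using mult_dvd_mono[of c 1 v 1] B(1) by simp
    moreover have "\<not> x dvd c"
      using \<open>c dvd 1\<close> assms(3) dvd_trans prime_elem_not_unit by blast
    hence "\<not> x dvd c * (v * prod_mset B)"
      using B(5) prime_elem_dvd_multD[OF assms(3)] by blast
    moreover have "u * prod_mset (add_mset y A) = x * c * (u * prod_mset A)"
      by (simp add: c mult_ac)
    hence "u * prod_mset (add_mset y A) = x ^ Suc n * (c * v * prod_mset B)"
      unfolding B(4) by (simp add: mult_ac)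
    ultimately show ?thesis using B(2,3)
      by (intro exI[of _ "Suc n"] exI[of _ "c * v"] exI[of _ B]) (auto simp: mult_ac)
  next
    case False
    hence "\<not> x dvd y * (v * prod_mset B)"
      using B(5) prime_elem_dvd_multD[OF assms(3)] by blast
    moreover have "u * prod_mset (add_mset y A) = y * (u * prod_mset A)"
      by (simp add: mult_ac)
    hence "u * prod_mset (add_mset y A) = x ^ n * (v * prod_mset (add_mset y B))"
      unfolding B(4) by (simp add: mult_ac)
    ultimately show ?thesis using B(1-3) add.prems
      by (intro exI[of _ n] exI[of _ v] exI[of _ "add_mset y B"]) (auto simp: mult_ac)
  qed
qed

lemma prime_multiplicity:
  fixes p x :: laurent
  assumes "p \<noteq> 0" "prime_elem x"
  obtains n q where "p = x ^ n * q" "\<not> x dvd q"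
proof -
  obtain u A where "u dvd 1" "\<forall>x\<in>#A. prime_elem x" "p = u * prod_mset A"
    using laurent_factorization[OF assms(1)] by blast
  thus ?thesis using prime_split[of u A x] assms(2) that by metis
qed

lemma prime_divisor:
  fixes p :: laurent
  assumes "p \<noteq> 0" "\<not> p dvd 1"
  obtains x where "prime_elem x" "x dvd p"
proof -
  obtain u A where A: "u dvd 1" "\<forall>x\<in>#A. prime_elem x" "p = u * prod_mset A"
    using laurent_factorization[OF assms(1)] by blast
  hence "A \<noteq> {#}" using assms(2) by auto
  then obtain x where x: "x \<in># A" by auto
  have "x dvd p" unfolding A(3) by (intro dvd_mult dvd_prod_mset x)
  thus ?thesis using that A(2) x by blast
qed

text \<open>Splitting off the full power of a prime at once leaves a cofactor prime to it, so
  properties of multiplicities pass through the induction.\<close>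

lemma laurent_prime_induct [consumes 1, case_names unit prime]:
  fixes p :: laurent
  assumes "p \<noteq> 0"
    and unit: "\<And>u. u dvd 1 \<Longrightarrow> P u"
    and prime: "\<And>x n q. prime_elem x \<Longrightarrow> \<not> x dvd q \<Longrightarrow> q \<noteq> 0 \<Longrightarrow> P q \<Longrightarrow> P (x ^ n * q)"
  shows "P p"
proof -
  have nz: "u * prod_mset A \<noteq> 0" if "u dvd 1" "\<forall>x\<in>#A. prime_elem x" for u :: laurent and A
  proof -
    have "prod_mset A \<noteq> 0" using that(2)
      by (induction A) (auto simp: prime_elem_not_zeroI)
    moreover have "u \<noteq> 0" using that(1) by auto
    ultimately show ?thesis by simp
  qed
  have "P (u * prod_mset A)" if "u dvd 1" "\<forall>x\<in>#A. prime_elem x" for u A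
    using that
  proof (induction "size A" arbitrary: u A rule: less_induct)
    case less
    show ?case
    proof (cases "A = {#}")
      case True
      thus ?thesis using unit less.prems by simp
    next
      case False
      then obtain x where x: "x \<in># A" by auto
      hence px: "prime_elem x" using less.prems by blast
      from prime_split[OF less.prems px] obtain n v B where B: "v dvd 1" "\<forall>x\<in>#B. prime_elem x"
        "size A = n + size B" "u * prod_mset A = x ^ n * (v * prod_mset B)" "\<not> x dvd v * prod_mset B"
        by blast
      have "x dvd u * prod_mset A" by (intro dvd_mult dvd_prod_mset x)
      hence "n \<noteq> 0" using B(4,5) by (cases n) auto
      hence "P (v * prod_mset B)" using less.hyps[OF _ B(1,2)] B(3) by simp
      thus ?thesis unfolding B(4) by (intro prime px B(5) nz B(1,2))
    qed
  qed
  thus ?thesis using laurent_factorization[OF assms(1)] by auto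
qed

lemma dvd_by_prime_powers:
  fixes a b :: laurent
  assumes "a \<noteq> 0" "\<And>x k. prime_elem x \<Longrightarrow> x ^ k dvd a \<Longrightarrow> x ^ k dvd b"
  shows "a dvd b"
  using assms
proof (induction a arbitrary: b rule: laurent_prime_induct)
  case (unit u)
  thus ?case by (metis dvd_trans one_dvd)
next
  case (prime x n q)
  have "x ^ n dvd b" using prime.prems prime.hyps(1) by auto
  then obtain c where c: "b = x ^ n * c" by blast
  have "q dvd c"
  proof (rule prime.IH)
    fix y k assume y: "prime_elem y" "y ^ k dvd q"
    show "y ^ k dvd c"
    proof (cases "y dvd x")
      case True
      hence "\<not> y dvd q"
        using prime.hyps(1,2) prime_dvd_prime_sym[OF y(1) prime.hyps(1)] dvd_trans by blast
      hence "k = 0" using y(2) by (metis dvd_power dvd_trans gr0I)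
      thus ?thesis by simp
    next
      case False
      hence "\<not> y dvd x ^ n" using y(1) prime_elem_dvd_power by blast
      moreover have "y ^ k dvd x ^ n * c"
        using prime.prems[OF y(1), of k] y(2) by (simp add: c)
      ultimately show ?thesis using prime_power_coprime_dvd y(1) by blast
    qed
  qed
  thus ?case by (simp add: c)
qed

text \<open>Maximal minus minimal weight of the support, since \<open>- ordw (- w) p\<close> is the
  maximum.\<close>

definition width :: "lattice \<Rightarrow> laurent \<Rightarrow> int" where
  "width w p = - ordw w p - ordw (- w) p"

lemma width_mult: "p \<noteq> 0 \<Longrightarrow> q \<noteq> 0 \<Longrightarrow> width w (p * q) = width w p + width w q"
  by (simp add: width_def ordw_mult)

lemma width_power: "p \<noteq> 0 \<Longrightarrow> width w (p ^ n) = int n * width w p"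
  by (simp add: width_def ordw_power algebra_simps)

lemma width_unit: "u dvd 1 \<Longrightarrow> width w u = 0"
  using unit_imp_lmonom[of u] by (auto simp: width_def ordw_lmonom)

text \<open>Widths are additive and vanish on units, so each prime power can be tested separately.
  Used with d = 3, and with d = 0 to obtain width 0.\<close>

lemma dvd_width:
  assumes "p \<noteq> 0"
    "\<And>x n q. prime_elem x \<Longrightarrow> p = x ^ n * q \<Longrightarrow> \<not> x dvd q \<Longrightarrow> d dvd int n * width w x"
  shows "d dvd width w p"
  using assms
proof (induction p rule: laurent_prime_induct)
  case (unit u)
  thus ?case by (simp add: width_unit)
next
  case (prime x n q)
  have nz: "x ^ n \<noteq> 0" using prime.hyps(1) by (simp add: prime_elem_not_zeroI)
  have "d dvd width w q"
  proof (rule prime.IH)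
    fix y m r assume y: "prime_elem y" "q = y ^ m * r" "\<not> y dvd r"
    show "d dvd int m * width w y"
    proof (cases "y dvd x")
      case True
      hence "\<not> y dvd q"
        using prime.hyps(1,2) prime_dvd_prime_sym[OF y(1) prime.hyps(1)] dvd_trans by blast
      hence "m = 0" using y(2) by (cases m) (auto simp: mult_ac)
      thus ?thesis by simp
    next
      case False
      hence "\<not> y dvd x ^ n" using y(1) prime_elem_dvd_power by blast
      hence "\<not> y dvd x ^ n * r" using y(1,3) prime_elem_dvd_multD by blast
      moreover have "x ^ n * q = y ^ m * (x ^ n * r)" by (simp add: y(2) mult_ac)
      ultimately show ?thesis using prime.prems y(1) by blast
    qed
  qed
  moreover have "d dvd int n * width w x" using prime.prems prime.hyps by blast
  ultimately show ?case
    using nz prime.hyps by (simp add: width_mult width_power prime_elem_not_zeroI)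
qed

section \<open>The logarithmic Hessian determinant\<close>

text \<open>This is f^2 times the second derivative of log f along w and z.\<close>

definition lhess :: "lattice \<Rightarrow> lattice \<Rightarrow> laurent \<Rightarrow> laurent" where
  "lhess w z f = f * Eul w (Eul z f) - Eul w f * Eul z f"

text \<open>The determinant of the Hessian of f along w and z, bordered by f and its first
  derivatives; it equals f^3 times the determinant of the Hessian of log f.\<close>

definition lhess_det :: "lattice \<Rightarrow> lattice \<Rightarrow> laurent \<Rightarrow> laurent" where
  "lhess_det w z f =
    f * (Eul w (Eul w f) * Eul z (Eul z f) - (Eul w (Eul z f))\<^sup>2)
      - Eul w (Eul w f) * (Eul z f)\<^sup>2 - Eul z (Eul z f) * (Eul w f)\<^sup>2
      + 2 * Eul w (Eul z f) * Eul w f * Eul z f"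

text \<open>Reduces statements on \<open>lhess_det\<close> to the entries \<open>lhess\<close> by
  cancelling f, without passing to fractions.\<close>

lemma lhess_det_eq: "f * lhess_det w z f = lhess w w f * lhess z z f - (lhess w z f)\<^sup>2"
  by (simp add: lhess_det_def lhess_def power2_eq_square algebra_simps)

text \<open>Additivity of second logarithmic derivatives with the denominators f^2 and g^2
  cleared.\<close>

lemma lhess_mult: "lhess w z (f * g) = f\<^sup>2 * lhess w z g + g\<^sup>2 * lhess w z f"
  by (simp add: lhess_def Eul_mult Eul_add power2_eq_square algebra_simps)

lemma lhess_power: "lhess w z (f ^ Suc n) = of_nat (Suc n) * f ^ (2 * n) * lhess w z f"
proof (induction n)
  case (Suc n)
  have "lhess w z (f ^ Suc (Suc n)) = f\<^sup>2 * lhess w z (f ^ Suc n) + (f ^ Suc n)\<^sup>2 * lhess w z f"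
    by (subst power_Suc) (rule lhess_mult)
  also have "\<dots> = of_nat (Suc n) * (f\<^sup>2 * f ^ (2 * n)) * lhess w z f + (f ^ Suc n)\<^sup>2 * lhess w z f"
    unfolding Suc.IH by (simp add: mult_ac)
  also have "f\<^sup>2 * f ^ (2 * n) = f ^ (2 * Suc n)" by (simp flip: power_add)
  also have "(f ^ Suc n)\<^sup>2 = f ^ (2 * Suc n)" by (simp only: power_even_eq)
  also have "of_nat (Suc n) * f ^ (2 * Suc n) * lhess w z f + f ^ (2 * Suc n) * lhess w z f
      = of_nat (Suc (Suc n)) * f ^ (2 * Suc n) * lhess w z f"
    by (simp only: of_nat_Suc ring_distribs mult_1_left) (simp add: add_ac)
  finally show ?case .
qed simp

text \<open>The polarization of the determinant of symmetric 2 by 2 matrices.\<close>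

definition lhess_mixed :: "lattice \<Rightarrow> lattice \<Rightarrow> laurent \<Rightarrow> laurent \<Rightarrow> laurent" where
  "lhess_mixed w z f g = lhess w w f * lhess z z g + lhess z z f * lhess w w g
    - 2 * lhess w z f * lhess w z g"

text \<open>The expansion of det(m X + Y) for the logarithmic Hessians X of f and Y of g, with
  denominators cleared. The bracket modulo f decides the multiplicity of f; writing the exponent as
  \<open>Suc n\<close> avoids subtraction in 3 (m - 1).\<close>

lemma lhess_det_power_mult:
  assumes "f \<noteq> 0" "g \<noteq> 0"
  shows "lhess_det w z (f ^ Suc n * g) = f ^ (3 * n) *
    ((of_nat (Suc n))\<^sup>2 * lhess_det w z f * g ^ 3 + of_nat (Suc n) * f * g * lhess_mixed w z f g
      + f ^ 3 * lhess_det w z g)"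
proof -
  define F m where "F = f ^ n" and "m = (of_nat (Suc n) :: laurent)"
  let ?p = "f ^ Suc n * g"
  have N: "lhess a b ?p = F\<^sup>2 * (f\<^sup>2 * lhess a b g + m * g\<^sup>2 * lhess a b f)" for a b
    unfolding lhess_mult lhess_power F_def m_def mult_2 power_add
    by (simp add: power2_eq_square algebra_simps)
  have "?p * lhess_det w z ?p = F ^ 4 * (m\<^sup>2 * g ^ 4 * (f * lhess_det w z f)
      + m * f\<^sup>2 * g\<^sup>2 * lhess_mixed w z f g + f ^ 4 * (g * lhess_det w z g))"
    unfolding lhess_det_eq N lhess_mixed_def by (simp add: eval_nat_numeral algebra_simps)
  also have "\<dots> = ?p * (F ^ 3 * (m\<^sup>2 * lhess_det w z f * g ^ 3 + m * f * g * lhess_mixed w z f g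
      + f ^ 3 * lhess_det w z g))"
    by (simp add: F_def[symmetric] eval_nat_numeral algebra_simps)
  finally show ?thesis
    using assms by (simp add: F_def m_def power_mult mult.commute)
qed

lemma lhess_lmonom: "lhess w z (lmonom c a) = 0"
  by (simp add: lhess_def Eul_lmonom lmonom_mult lmonom_diff)

text \<open>The logarithm of a monomial has vanishing second derivatives, so only the factor f^3 in
  front of the determinant changes.\<close>

lemma lhess_det_lmonom_mult: "lhess_det w z (lmonom c a * f) = lmonom c a ^ 3 * lhess_det w z f"
proof (cases "c = 0 \<or> f = 0")
  case True
  thus ?thesis by (auto simp: lhess_det_def power3_eq_cube)
next
  case False
  let ?u = "lmonom c a"
  have "?u * f * lhess_det w z (?u * f) = ?u * f * (?u ^ 3 * lhess_det w z f)"
  proof -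
    have "?u * f * lhess_det w z (?u * f) = ?u ^ 4 * (f * lhess_det w z f)"
      unfolding lhess_det_eq lhess_mult lhess_lmonom by (simp add: eval_nat_numeral algebra_simps)
    thus ?thesis by (simp add: eval_nat_numeral mult_ac)
  qed
  thus ?thesis using False by simp
qed

lemma Eul_Eul: "Eul w (Eul z f) = of_int (w $ 1 * z $ 1) * Eul (axis 1 1) (Eul (axis 1 1) f)
  + of_int (w $ 1 * z $ 2 + w $ 2 * z $ 1) * Eul (axis 1 1) (Eul (axis 2 1) f)
  + of_int (w $ 2 * z $ 2) * Eul (axis 2 1) (Eul (axis 2 1) f)"
  by (rule lcoeff_ext)
    (simp add: lcoeff_Eul lcoeff_add lcoeff_of_int_mult pairing_def algebra_simps)

text \<open>Congruence of the bordered matrix by the matrix with rows (a, b), (c, d), extended by 1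
  in the border; X, Y are the transformed first derivatives and P, Q, R the transformed second
  ones.\<close>

lemma bordered_det_congruence:
  fixes f a b c d x y p q r :: "'a :: comm_ring_1"
  defines "X \<equiv> a * x + b * y" and "Y \<equiv> c * x + d * y"
    and "P \<equiv> a * a * p + (a * b + b * a) * q + b * b * r"
    and "Q \<equiv> a * c * p + (a * d + b * c) * q + b * d * r"
    and "R \<equiv> c * c * p + (c * d + d * c) * q + d * d * r"
  shows "f * (P * R - Q\<^sup>2) - P * Y\<^sup>2 - R * X\<^sup>2 + 2 * Q * X * Y =
    (a * d - b * c)\<^sup>2 * (f * (p * r - q\<^sup>2) - p * y\<^sup>2 - r * x\<^sup>2 + 2 * q * x * y)"
  unfolding X_def Y_def P_def Q_def R_def power2_eq_square mult_2
  by (simp only: ring_distribs mult_ac add_ac diff_conv_add_uminus minus_add_distrib minus_mult_left[symmetric] minus_mult_right[symmetric] minus_minus) simp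

lemma lhess_det_basis:
  "lhess_det w z f = of_int ((cross w z)\<^sup>2) * lhess_det (axis 1 1) (axis 2 1) f"
proof -
  have E: "Eul v f = of_int (v $ 1) * Eul (axis 1 1) f + of_int (v $ 2) * Eul (axis 2 1) f" for v
    by (simp add: Eul_def)
  show ?thesis
    unfolding lhess_det_def Eul_Eul[of w w] Eul_Eul[of w z] Eul_Eul[of z z]
    unfolding cross_def of_int_power of_int_diff of_int_mult of_int_add
    unfolding E[of w] E[of z]
    by (rule bordered_det_congruence)
qed

lemma lmu_eq_lhess_det: "p \<noteq> 0 \<Longrightarrow> lmu m p = lhess_det (axis 1 1) (axis 2 1) (phat m p)"
proof -
  have T: "Theta 1 = Eul (axis 1 1)" "Theta 2 = Eul (axis 2 1)"
    by (auto simp: Eul_def fun_eq_iff)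
  show "p \<noteq> 0 \<Longrightarrow> lmu m p = lhess_det (axis 1 1) (axis 2 1) (phat m p)"
    by (simp add: lmu_explicit(2) T lhess_det_def Eul_commute[of "axis 2 1" "axis 1 1"]
        power2_eq_square algebra_simps)
qed

section \<open>Lowest weight parts of the logarithmic Hessian\<close>

lemma hom_part_Eul: "hom_part w h (Eul z p) = Eul z (hom_part w h p)"
  by (rule lcoeff_ext) (simp add: lcoeff_hom_part lcoeff_Eul)

lemma hom_part_diff: "hom_part w h (p - q) = hom_part w h p - hom_part w h q"
  by (rule lcoeff_ext) (simp add: lcoeff_hom_part lcoeff_diff)

lemma weight_ge_multI: "weight_ge w h p \<Longrightarrow> weight_ge w k q \<Longrightarrow> l \<le> h + k \<Longrightarrow> weight_ge w l (p * q)"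
  using weight_ge_mult weight_ge_mono by blast

lemma weight_ge_Suc: "weight_ge w (h + 1) p \<longleftrightarrow> weight_ge w h p \<and> hom_part w h p = 0"
proof safe
  assume "weight_ge w (h + 1) p"
  thus "weight_ge w h p" by (rule weight_ge_mono) simp
  show "hom_part w h p = 0" using \<open>weight_ge w (h + 1) p\<close> by (rule hom_part_eq_0) simp
next
  assume "weight_ge w h p" "hom_part w h p = 0"
  thus "weight_ge w (h + 1) p" using weight_ge_rest[of w h p] by simp
qed

lemma shift_weight_ge:
  assumes "weight_ge w h p"
  shows "weight_ge w (h + 1) (Eul w p - of_int h * p)"
proof -
  have "weight_ge w h (of_int h * p)"
    using assms by (auto simp: weight_ge_def lsupp_iff lcoeff_of_int_mult)
  moreover have "hom_part w h (Eul w p - of_int h * p) = 0"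
    by (rule lcoeff_ext) (simp add: lcoeff_hom_part lcoeff_diff lcoeff_Eul lcoeff_of_int_mult)
  ultimately show ?thesis
    using assms by (simp add: weight_ge_Suc weight_ge_diff weight_ge_Eul)
qed

text \<open>Subtracting h times the border row and column replaces \<open>Eul w\<close> by
  \<open>Eul w\<close> - h in the bordered determinant. This operator kills weight h, so every entry
  it touches rises to weight h + 1.\<close>

lemma lhess_det_lowest:
  assumes p: "weight_ge w h p"
  shows "weight_ge w (3 * h + 1) (lhess_det w z p)"
    and "hom_part w (3 * h + 1) (lhess_det w z p) =
      hom_part w (h + 1) p * lhess z z (hom_part w h p)"
proof -
  define k where "k = (of_int h :: laurent)"
  define A where "A = Eul w p - k * p"
  define C where "C = Eul w A - k * A"
  define E where "E = Eul w (Eul z p) - k * Eul z p"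
  \<comment> \<open>All terms of the transformed determinant that are quadratic in A and E; each has
    weight at least 3h + 2.\<close>
  define R where "R = 2 * A * Eul z p * E - p * E\<^sup>2 - A\<^sup>2 * Eul z (Eul z p)"
  have C': "C = Eul w (Eul w p) - 2 * k * Eul w p + k\<^sup>2 * p"
    by (simp add: C_def A_def k_def Eul_diff Eul_of_int_mult)
      (simp add: power2_eq_square algebra_simps)
  have A: "weight_ge w (h + 1) A"
    unfolding A_def k_def by (rule shift_weight_ge) fact
  have E: "weight_ge w (h + 1) E"
    unfolding E_def k_def by (intro shift_weight_ge weight_ge_Eul) fact
  have C: "weight_ge w (h + 1) C"
    using A unfolding C_def k_def
    by (intro weight_ge_diff weight_ge_Eul) (auto simp: weight_ge_def lsupp_iff lcoeff_of_int_mult)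
  have eq: "lhess_det w z p = C * lhess z z p + R"
    unfolding lhess_det_def lhess_def C' R_def E_def A_def
    by (simp add: power2_eq_square algebra_simps)
  have L: "weight_ge w (2 * h) (lhess z z p)"
    unfolding lhess_def
    by (intro weight_ge_diff weight_ge_multI[OF p weight_ge_Eul[OF weight_ge_Eul[OF p]]]
        weight_ge_multI[OF weight_ge_Eul[OF p] weight_ge_Eul[OF p]]) auto
  have R: "weight_ge w (3 * h + 1 + 1) R"
  proof -
    have "weight_ge w (3 * h + 1 + 1) (A * Eul z p * E)"
      by (rule weight_ge_multI[OF weight_ge_mult[OF A weight_ge_Eul[OF p]] E]) simp
    moreover have "weight_ge w (3 * h + 1 + 1) (p * (E * E))"
      by (rule weight_ge_multI[OF p weight_ge_mult[OF E E]]) simp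
    moreover have "weight_ge w (3 * h + 1 + 1) (A * A * Eul z (Eul z p))"
      by (rule weight_ge_multI[OF weight_ge_mult[OF A A] weight_ge_Eul[OF weight_ge_Eul[OF p]]]) simp
    moreover have "R = A * Eul z p * E + A * Eul z p * E - p * (E * E) - A * A * Eul z (Eul z p)"
      by (simp add: R_def power2_eq_square algebra_simps)
    ultimately show ?thesis by (simp only: weight_ge_diff weight_ge_add)
  qed
  show "weight_ge w (3 * h + 1) (lhess_det w z p)"
    unfolding eq by (intro weight_ge_add weight_ge_multI[OF C L] weight_ge_mono[OF R]) auto
  have "hom_part w (3 * h + 1) (lhess_det w z p) = hom_part w (h + 1 + 2 * h) (C * lhess z z p)"
    unfolding eq hom_part_add using hom_part_eq_0[OF R, of "3 * h + 1"] by simp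
  also have "\<dots> = hom_part w (h + 1) C * hom_part w (h + h) (lhess z z p)"
    using hom_part_mult[OF C L] by simp
  also have "hom_part w (h + h) (lhess z z p) = lhess z z (hom_part w h p)"
    unfolding lhess_def hom_part_diff
    by (simp only: hom_part_mult[OF p weight_ge_Eul[OF weight_ge_Eul[OF p]]]
        hom_part_mult[OF weight_ge_Eul[OF p] weight_ge_Eul[OF p]] hom_part_Eul)
  \<comment> \<open>On weight h + 1 the operator \<open>Eul w\<close> - h is the identity, hence so
    is its square.\<close>
  also have "hom_part w (h + 1) C = hom_part w (h + 1) p"
    by (rule lcoeff_ext)
      (simp add: C_def A_def k_def lcoeff_hom_part lcoeff_diff lcoeff_Eul lcoeff_of_int_mult,
       simp add: algebra_simps)
  finally show "hom_part w (3 * h + 1) (lhess_det w z p) =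
      hom_part w (h + 1) p * lhess z z (hom_part w h p)" .
qed

section \<open>Weight parts modulo a homogeneous element\<close>

lemma hom_part_homog_mult:
  assumes "homog w k d"
  shows "hom_part w h (d * g) = d * hom_part w (h - k) g"
proof -
  have "hom_part w h (d * (g - hom_part w (h - k) g)) = 0"
  proof (rule lcoeff_ext)
    fix a
    show "lcoeff (hom_part w h (d * (g - hom_part w (h - k) g))) a = lcoeff 0 a"
    proof (rule ccontr)
      assume "lcoeff (hom_part w h (d * (g - hom_part w (h - k) g))) a \<noteq> lcoeff 0 a"
      hence a: "pairing w a = h" "a \<in> lsupp (d * (g - hom_part w (h - k) g))"
        by (auto simp: lcoeff_hom_part lsupp_iff split: if_splits)
      from a(2) obtain b c where "a = b + c" "b \<in> lsupp d" "c \<in> lsupp (g - hom_part w (h - k) g)"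
        using lsupp_mult by blast
      thus False using a(1) assms
        by (auto simp: homog_def lsupp_iff lcoeff_diff lcoeff_hom_part)
    qed
  qed
  moreover have "homog w (k + (h - k)) (d * hom_part w (h - k) g)"
    using assms by (intro homog_mult) auto
  ultimately show ?thesis
    by (simp add: right_diff_distrib hom_part_diff hom_part_homog)
qed

lemma homog_dvd_hom_part: "homog w k d \<Longrightarrow> d dvd f \<Longrightarrow> d dvd hom_part w h f"
  by (auto simp: hom_part_homog_mult)

lemma homog_dvd_Eul: "homog w k d \<Longrightarrow> d dvd f \<Longrightarrow> d dvd Eul w f"
  by (auto simp: Eul_mult homog_Eul)

lemma hom_part_expand: "p = (\<Sum>h\<in>pairing w ` lsupp p. hom_part w h p)"
  by (rule lcoeff_ext)
    (auto simp: lcoeff_sum lcoeff_hom_part finite_lsupp lsupp_iff image_iff cong: if_cong)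

text \<open>A representative modulo d all of whose nonzero w-parts survive modulo d; its extreme
  weights serve as orders in the quotient ring, which is never formed.\<close>

lemma weight_reduce:
  assumes "homog w k d"
  obtains f' where "d dvd f - f'"
    "\<And>i. hom_part w i f' = (if d dvd hom_part w i f then 0 else hom_part w i f)"
proof -
  define I where "I = {i \<in> pairing w ` lsupp f. \<not> d dvd hom_part w i f}"
  define f' where "f' = (\<Sum>i\<in>I. hom_part w i f)"
  have fin: "finite I" "finite (pairing w ` lsupp f)" by (auto simp: I_def finite_lsupp)
  have "f - f' = (\<Sum>i\<in>pairing w ` lsupp f - I. hom_part w i f)"
    using hom_part_expand[of f w] fin by (simp add: f'_def I_def sum_diff)
  hence "d dvd f - f'" by (auto intro!: dvd_sum simp: I_def)
  moreover have "hom_part w i f' = (if d dvd hom_part w i f then 0 else hom_part w i f)" for i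
  proof -
    have "hom_part w i f' = (\<Sum>j\<in>I. if i = j then hom_part w j f else 0)"
      unfolding f'_def hom_part_sum by (intro sum.cong) (auto simp: hom_part_homog)
    also have "\<dots> = (if i \<in> I then hom_part w i f else 0)" using fin by simp
    also have "i \<in> I \<longleftrightarrow> \<not> d dvd hom_part w i f"
    proof -
      have "hom_part w i f = 0" if "i \<notin> pairing w ` lsupp f"
        using that by (intro lcoeff_ext) (auto simp: lcoeff_hom_part lsupp_iff image_iff)
      thus ?thesis by (cases "i \<in> pairing w ` lsupp f") (auto simp: I_def)
    qed
    finally show ?thesis by simp
  qed
  ultimately show ?thesis using that by blast
qed

lemma of_int_dvd_cancel:
  assumes "n \<noteq> 0" "d dvd of_int n * (x :: laurent)"
  shows "d dvd x"
proof -
  have "d dvd lmonom (1 / of_int n) 0 * (of_int n * x)" using assms(2) by (rule dvd_mult)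
  thus ?thesis
    using assms(1) by (simp add: of_int_laurent lmonom_mult lmonom_1 flip: mult.assoc)
qed

lemma dvd_diff_iff: "d dvd x - y \<Longrightarrow> d dvd x \<longleftrightarrow> d dvd (y :: laurent)"
  using dvd_add[of d "x - y" y] dvd_diff[of d x "x - y"] by auto

text \<open>Applied both to a prime \<open>d\<close> and to \<open>d = 0\<close>.\<close>

lemma dvd_lhess_imp:
  assumes prime: "\<And>x y :: laurent. d dvd x * y \<Longrightarrow> d dvd x \<or> d dvd y"
    and hom: "homog w k d" and dvd: "d dvd lhess w w f" and ij: "i \<noteq> j"
  shows "d dvd hom_part w i f \<or> d dvd hom_part w j f"
proof (rule ccontr)
  assume contr: "\<not> (d dvd hom_part w i f \<or> d dvd hom_part w j f)"
  obtain g where g: "d dvd f - g"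
    "\<And>i. hom_part w i g = (if d dvd hom_part w i f then 0 else hom_part w i f)"
    using weight_reduce[OF hom] by blast
  define a where "a = ordw w g"
  define g0 where "g0 = hom_part w a g"
  define b where "b = ordw w (g - g0)"
  have gnz: "g \<noteq> 0" using g(2)[of i] contr lcoeff_hom_part by (intro notI) (auto simp: hom_part_def)
  have part: "hom_part w l (g - g0) = (if l = a then 0 else hom_part w l g)" for l
    by (rule lcoeff_ext) (simp add: g0_def lcoeff_diff lcoeff_hom_part)
  have "g - g0 \<noteq> 0"
  proof
    assume "g - g0 = 0"
    hence "hom_part w l g = 0" if "l \<noteq> a" for l using part[of l] that by (simp add: hom_part_def)
    thus False using g(2)[of i] g(2)[of j] contr ij by (metis dvd_0_right)
  qed
  have ga: "weight_ge w a g" unfolding a_def by (rule weight_ge_ordw)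
  have gb: "weight_ge w b (g - g0)" unfolding b_def by (rule weight_ge_ordw)
  have g0: "homog w a g0" by (simp add: g0_def)
  have nz: "hom_part w b (g - g0) \<noteq> 0"
    unfolding b_def using \<open>g - g0 \<noteq> 0\<close> by (rule hom_part_ordw_nonzero)
  hence "b \<noteq> a" using part[of b] by auto
  have "weight_ge w (a + 1) (g - g0)" unfolding g0_def by (rule weight_ge_rest[OF ga])
  hence ab: "a < b" using nz hom_part_eq_0[of w "a + 1" "g - g0" b] by force
  \<comment> \<open>Using \<open>Eul w\<close> - a instead of \<open>Eul w\<close> leaves
    \<open>lhess w w g\<close> unchanged. Now A and C start in weight b, so in weight a + b only (b
    - a)^2 times the product of the two lowest parts of g remains.\<close>
  define A where "A = Eul w g - of_int a * g"
  define C where "C = Eul w A - of_int a * A"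
  have A': "A = Eul w (g - g0) - of_int a * (g - g0)"
    by (simp add: A_def Eul_diff homog_Eul[OF g0] algebra_simps)
  have scal: "weight_ge w l (of_int n * p)" if "weight_ge w l p" for l n p
    using that by (auto simp: weight_ge_def lsupp_iff lcoeff_of_int_mult)
  have wA: "weight_ge w b A" unfolding A' by (intro weight_ge_diff weight_ge_Eul scal gb)
  have wC: "weight_ge w b C" unfolding C_def by (intro weight_ge_diff weight_ge_Eul scal wA)
  have N: "lhess w w g = g * C - A * A"
    unfolding C_def A_def lhess_def
    by (simp add: Eul_diff Eul_of_int_mult) (simp add: algebra_simps)
  have C_part: "hom_part w b C = of_int ((b - a)\<^sup>2) * hom_part w b g"
    by (rule lcoeff_ext, simp add: C_def A_def lcoeff_hom_part lcoeff_diff lcoeff_Eul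
        lcoeff_of_int_mult del: of_int_power of_int_diff) (simp add: power2_eq_square algebra_simps)
  have "hom_part w (a + b) (lhess w w g) = g0 * hom_part w b C"
  proof -
    have "hom_part w (a + b) (A * A) = 0"
      by (rule hom_part_eq_0[OF weight_ge_mult[OF wA wA]]) (use ab in simp)
    thus ?thesis unfolding N hom_part_diff using hom_part_mult[OF ga wC] by (simp add: g0_def)
  qed
  hence low: "hom_part w (a + b) (lhess w w g) = of_int ((b - a)\<^sup>2) * (g0 * hom_part w b g)"
    by (simp add: C_part mult_ac)
  have "d dvd lhess w w g"
  proof -
    have "lhess w w f - lhess w w g = (f - g) * Eul w (Eul w f) + g * Eul w (Eul w (f - g))
        - (Eul w (f - g) * (Eul w f + Eul w g))"
      by (simp add: lhess_def Eul_diff algebra_simps)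
    also have "d dvd \<dots>"
      by (rule dvd_diff[OF dvd_add[OF dvd_mult2[OF g(1)]
          dvd_mult[OF homog_dvd_Eul[OF hom homog_dvd_Eul[OF hom g(1)]]]]
          dvd_mult2[OF homog_dvd_Eul[OF hom g(1)]]])
    finally show ?thesis using dvd_diff_iff dvd by blast
  qed
  hence "d dvd of_int ((b - a)\<^sup>2) * (g0 * hom_part w b g)"
    using homog_dvd_hom_part[OF hom, of "lhess w w g" "a + b"] unfolding low
    using \<open>d dvd lhess w w g\<close> by simp
  hence "d dvd g0 * hom_part w b g" by (rule of_int_dvd_cancel[rotated]) (use ab in simp)
  hence "d dvd hom_part w a g \<or> d dvd hom_part w b g" unfolding g0_def by (rule prime)
  moreover have "hom_part w a g \<noteq> 0" using hom_part_ordw_nonzero[OF gnz] unfolding a_def .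
  moreover have "hom_part w b g \<noteq> 0" using nz part[of b] \<open>b \<noteq> a\<close> by simp
  ultimately show False using g(2)[of a] g(2)[of b]
    by (cases "d dvd hom_part w a f"; cases "d dvd hom_part w b f") auto
qed

text \<open>Modulo the prime d the lowest and the highest surviving weights of a product are the
  sums of those of the factors. Those of f differ, hence those of f g do.\<close>

lemma two_weights_mult:
  assumes prime: "prime_elem d" and hom: "homog w k d"
    and f: "\<not> d dvd hom_part w i f" "\<not> d dvd hom_part w j f" "i \<noteq> j" and g: "\<not> d dvd g"
  shows "\<exists>i j. i \<noteq> j \<and> \<not> d dvd hom_part w i (f * g) \<and> \<not> d dvd hom_part w j (f * g)"
proof -
  obtain f' where f': "d dvd f - f'"
    "\<And>i. hom_part w i f' = (if d dvd hom_part w i f then 0 else hom_part w i f)"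
    using weight_reduce[OF hom] by blast
  obtain g' where g': "d dvd g - g'"
    "\<And>i. hom_part w i g' = (if d dvd hom_part w i g then 0 else hom_part w i g)"
    using weight_reduce[OF hom] by blast
  have nzf: "f' \<noteq> 0" using f'(2)[of i] f(1) by (auto simp: hom_part_def)
  have nzg: "g' \<noteq> 0" using g'(1) g by auto
  have not_dvd: "\<not> d dvd hom_part w h f'" if "hom_part w h f' \<noteq> 0" for h
    using that f'(2)[of h] by auto
  have not_dvd': "\<not> d dvd hom_part w h g'" if "hom_part w h g' \<noteq> 0" for h
    using that g'(2)[of h] by auto
  have neg: "hom_part (- w) h p = hom_part w (- h) p" for h p
    by (rule lcoeff_ext) (auto simp: lcoeff_hom_part)
  have key: "\<not> d dvd hom_part w (h + l) (f' * g')"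
    if "hom_part w (h + l) (f' * g') = hom_part w h f' * hom_part w l g'"
      "hom_part w h f' \<noteq> 0" "hom_part w l g' \<noteq> 0" for h l
    using that not_dvd not_dvd' prime_elem_dvd_multD[OF prime] by metis
  let ?a = "ordw w f'" and ?b = "ordw w g'" and ?a' = "- ordw (- w) f'" and ?b' = "- ordw (- w) g'"
  have low: "\<not> d dvd hom_part w (?a + ?b) (f' * g')"
    by (intro key hom_part_mult weight_ge_ordw hom_part_ordw_nonzero nzf nzg)
  have high: "\<not> d dvd hom_part w (?a' + ?b') (f' * g')"
  proof (intro key)
    show "hom_part w ?a' f' \<noteq> 0" "hom_part w ?b' g' \<noteq> 0"
      using hom_part_ordw_nonzero[of f' "- w"] hom_part_ordw_nonzero[of g' "- w"] nzf nzg
      by (simp_all add: neg)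
    show "hom_part w (?a' + ?b') (f' * g') = hom_part w ?a' f' * hom_part w ?b' g'"
      using hom_part_mult[OF weight_ge_ordw[of "- w" f'] weight_ge_ordw[of "- w" g']]
      by (simp add: neg)
  qed
  have le: "ordw w p \<le> h \<and> h \<le> - ordw (- w) p" if nz: "hom_part w h p \<noteq> 0" for h p
  proof -
    obtain a where "a \<in> lsupp p" "pairing w a = h"
      using nz by (auto simp flip: lsupp_empty_iff simp: lsupp_hom_part)
    thus ?thesis using ordw_le[of a p w] ordw_le[of a p "- w"] by simp
  qed
  have "hom_part w i f' \<noteq> 0" "hom_part w j f' \<noteq> 0" using f f'(2) by auto
  hence "?a < ?a'" using le[of i f'] le[of j f'] f(3) by linarith
  moreover have "?b \<le> ?b'" using le[OF hom_part_ordw_nonzero[OF nzg, of w]] by simp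
  ultimately have "?a + ?b \<noteq> ?a' + ?b'" by simp
  moreover have "d dvd hom_part w h (f * g) \<longleftrightarrow> d dvd hom_part w h (f' * g')" for h
  proof -
    have "f * g - f' * g' = (f - f') * g + f' * (g - g')" by (simp add: algebra_simps)
    also have "d dvd \<dots>" by (rule dvd_add[OF dvd_mult2[OF f'(1)] dvd_mult[OF g'(1)]])
    finally have "d dvd hom_part w h (f * g) - hom_part w h (f' * g')"
      using homog_dvd_hom_part[OF hom] by (simp flip: hom_part_diff)
    thus ?thesis by (rule dvd_diff_iff)
  qed
  ultimately show ?thesis using low high by blast
qed

section \<open>Two-dimensional supports\<close>

text \<open>Supports that are not collinear; \<open>effective_rank_2_planar\<close> derives this
  from effective rank two.\<close>

definition planar :: "laurent \<Rightarrow> bool" where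
  "planar p \<longleftrightarrow> (\<exists>a\<in>lsupp p. \<exists>b\<in>lsupp p. \<exists>c\<in>lsupp p. cross (b - a) (c - a) \<noteq> 0)"

text \<open>Cramer's rule for recovering w from its pairings with a and b.\<close>

lemma pairing_cross: "w $ 1 * cross a b = b $ 2 * pairing w a - a $ 2 * pairing w b"
  "w $ 2 * cross a b = a $ 1 * pairing w b - b $ 1 * pairing w a"
  by (simp_all add: cross_def pairing_def algebra_simps)

lemma planar_not_homog:
  assumes "planar p" "w \<noteq> 0"
  shows "\<not> homog w h p"
proof
  assume hom: "homog w h p"
  obtain a b c where abc: "a \<in> lsupp p" "b \<in> lsupp p" "c \<in> lsupp p" "cross (b - a) (c - a) \<noteq> 0"
    using assms(1) by (auto simp: planar_def)
  hence "pairing w (b - a) = 0" "pairing w (c - a) = 0" using hom by (auto simp: homog_def)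
  with pairing_cross[of w "b - a" "c - a"] have "w $ 1 = 0" "w $ 2 = 0" using abc(4) by auto
  thus False using assms(2) by (simp add: lattice_eq_iff)
qed

lemma ordw_le_neg: "p \<noteq> 0 \<Longrightarrow> ordw w p \<le> - ordw (- w) p"
proof -
  assume "p \<noteq> 0"
  then obtain a where "a \<in> lsupp p" by (metis ex_in_conv lsupp_empty_iff)
  thus ?thesis using ordw_le[of a p w] ordw_le[of a p "- w"] by simp
qed

lemma width_nonneg: "p \<noteq> 0 \<Longrightarrow> width w p \<ge> 0"
  using ordw_le_neg[of p w] by (simp add: width_def)

lemma width_0_iff: "p \<noteq> 0 \<Longrightarrow> width w p = 0 \<longleftrightarrow> (\<exists>h. homog w h p)"
proof safe
  assume p: "p \<noteq> 0" "width w p = 0"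
  have "pairing w a = ordw w p" if "a \<in> lsupp p" for a
    using ordw_le[OF that, of w] ordw_le[OF that, of "- w"] p(2) by (simp add: width_def)
  thus "\<exists>h. homog w h p" by (auto simp: homog_def)
next
  fix h assume p: "p \<noteq> 0" "homog w h p"
  have "ordw w p = h" "ordw (- w) p = - h"
    using ordw_attained[OF p(1), of w] ordw_attained[OF p(1), of "- w"] p(2) by (auto simp: homog_def)
  thus "width w p = 0" by (simp add: width_def)
qed

text \<open>The derivative has no new exponents, so divisibility would make it a constant multiple c
  p, and then every exponent of p would have weight c.\<close>

lemma not_dvd_Eul:
  assumes "p \<noteq> 0" "\<And>h. \<not> homog w h p"
  shows "\<not> p dvd Eul w p"
proof
  assume "p dvd Eul w p"
  then obtain c where c: "Eul w p = lmonom c 0 * p"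
    using dvd_supp_subset_imp_const lsupp_Eul by blast
  obtain a where a: "a \<in> lsupp p" using assms(1) by (metis ex_in_conv lsupp_empty_iff)
  have "of_int (pairing w b) = c" if "b \<in> lsupp p" for b
    using arg_cong[OF c, of "\<lambda>q. lcoeff q b"] that
    by (simp add: lcoeff_Eul lcoeff_lmonom_mult lsupp_iff)
  hence "pairing w b = pairing w a" if "b \<in> lsupp p" for b
    using a that by (metis of_int_eq_iff)
  thus False using assms(2)[of "pairing w a"] by (simp add: homog_def)
qed

section \<open>The logarithmic Gauss map of an irreducible curve\<close>

text \<open>The y-exponents lie in an interval of length d. These Laurent polynomials form a free
  module of rank d over C[x, 1/x], whose elements are characterized by
  \<open>homog (axis 2 1) 0\<close>.\<close>

definition yrange :: "int \<Rightarrow> nat \<Rightarrow> laurent \<Rightarrow> bool" where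
  "yrange s d p \<longleftrightarrow> (\<forall>a\<in>lsupp p. s \<le> pairing (axis 2 1) a \<and> pairing (axis 2 1) a < s + int d)"

lemma yrange_Suc:
  "yrange s (Suc d) p \<Longrightarrow> hom_part (axis 2 1) (s + int d) p = 0 \<Longrightarrow> yrange s d p"
proof -
  assume p: "yrange s (Suc d) p" and h: "hom_part (axis 2 1) (s + int d) p = 0"
  have "pairing (axis 2 1) a \<noteq> s + int d" if "a \<in> lsupp p" for a
    using arg_cong[OF h, of "\<lambda>q. lcoeff q a"] that by (auto simp: lcoeff_hom_part lsupp_iff)
  thus "yrange s d p" using p unfolding yrange_def by force
qed

lemma yrange_homog_mult: "homog (axis 2 1) k q \<Longrightarrow> yrange s d p \<Longrightarrow> yrange (k + s) d (q * p)"
  unfolding yrange_def homog_def by (auto dest!: subsetD[OF lsupp_mult])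

lemma yrange_diff: "yrange s d p \<Longrightarrow> yrange s d q \<Longrightarrow> yrange s d (p - q)"
  using lsupp_diff[of p q] unfolding yrange_def by blast

lemma yrange_mono: "yrange s d p \<Longrightarrow> t \<le> s \<Longrightarrow> s + int d \<le> t + int e \<Longrightarrow> yrange t e p"
  unfolding yrange_def by force

lemma yrange_exists:
  assumes "finite I"
  shows "\<exists>s d. \<forall>i\<in>I. yrange s d (F i)"
proof -
  define T where "T = insert 0 (\<Union>i\<in>I. (\<lambda>a. \<bar>pairing (axis 2 1) a\<bar>) ` lsupp (F i))"
  have fin: "finite T" using assms by (auto simp: T_def finite_lsupp)
  define K where "K = Max T"
  have K: "\<bar>pairing (axis 2 1) a\<bar> \<le> K" if "i \<in> I" "a \<in> lsupp (F i)" for i a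
    unfolding K_def using fin by (rule Max_ge) (use that in \<open>auto simp: T_def\<close>)
  have "0 \<le> K" unfolding K_def using fin by (rule Max_ge) (simp add: T_def)
  hence "yrange (- K) (nat (2 * K + 1)) (F i)" if "i \<in> I" for i
    unfolding yrange_def using K[OF that] by (auto simp: abs_le_iff) (force simp: abs_le_iff)+
  thus ?thesis by blast
qed

lemma homog_diff: "homog w h p \<Longrightarrow> homog w h q \<Longrightarrow> homog w h (p - q)"
  using lsupp_diff[of p q] unfolding homog_def by blast

lemma homog_uminus: "homog w h p \<Longrightarrow> homog w h (- p)"
  using homog_diff[of w h 0 p] by simp

lemma homog_sum: "(\<And>i. i \<in> A \<Longrightarrow> homog w h (f i)) \<Longrightarrow> homog w h (sum f A)"
  by (induction A rule: infinite_finite_induct) (auto intro: homog_add)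

lemma homog_lmonom: "pairing w a = h \<Longrightarrow> homog w h (lmonom c a)"
  by (cases "c = 0") (auto simp: homog_def lsupp_lmonom)

lemma homog_Eul_closed: "homog w h p \<Longrightarrow> homog w h (Eul z p)"
  using lsupp_Eul[of z p] unfolding homog_def by blast

text \<open>More than d elements of a free module of rank d over the domain C[x, 1/x] are dependent:
  Gaussian elimination without division.\<close>

lemma linear_dependence:
  assumes "finite I" "card I > d" "\<And>i. i \<in> I \<Longrightarrow> yrange s d (F i)"
  shows "\<exists>g. (\<forall>i\<in>I. homog (axis 2 1) 0 (g i)) \<and> (\<exists>i\<in>I. g i \<noteq> 0) \<and> (\<Sum>i\<in>I. g i * F i) = 0"
  using assms
proof (induction d arbitrary: I F)
  case 0
  have "F i = 0" if "i \<in> I" for i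
  proof -
    have "a \<notin> lsupp (F i)" for a using 0(3)[OF that] by (auto simp: yrange_def)
    hence "lsupp (F i) = {}" by blast
    thus ?thesis by simp
  qed
  moreover have "homog (axis 2 1) 0 1" using homog_lmonom[of "axis 2 1" 0 0 1] by (simp add: lmonom_1)
  moreover have "I \<noteq> {}" using 0(2) by auto
  ultimately show ?case
    by (intro exI[of _ "\<lambda>_. 1"]) auto
next
  case (Suc d)
  define t where "t = s + int d"
  \<comment> \<open>The top coefficient of \<open>F i\<close> in y, shifted to y-degree 0 so that it
    belongs to C[x, 1/x].\<close>
  define c where "c i = lmonom 1 (axis 2 (- t)) * hom_part (axis 2 1) t (F i)" for i
  have mon: "homog (axis 2 1) (- t) (lmonom 1 (axis 2 (- t)))"
    by (rule homog_lmonom) (simp add: pairing_def)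
  have c: "homog (axis 2 1) 0 (c i)" for i
    unfolding c_def using homog_mult[OF mon homog_hom_part, of t "F i"] by simp
  show ?case
  proof (cases "\<forall>i\<in>I. c i = 0")
    case True
    hence "hom_part (axis 2 1) (s + int d) (F i) = 0" if "i \<in> I" for i
      using that by (simp add: c_def t_def)
    hence "yrange s d (F i)" if "i \<in> I" for i
      using that yrange_Suc[OF Suc.prems(3)[OF that]] by simp
    thus ?thesis using Suc.IH[of I F] Suc.prems by simp
  next
    case False
    then obtain j where j: "j \<in> I" "c j \<noteq> 0" by blast
    \<comment> \<open>Elimination with pivot j cancels the top coefficients and lowers the rank by
      one.\<close>
    define G where "G i = c j * F i - c i * F j" for i
    have "yrange s d (G i)" if "i \<in> I - {j}" for i
    proof (rule yrange_Suc)
      have "yrange (0 + s) (Suc d) (c l * F k)" if "k \<in> I" for k l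
        using that c Suc.prems(3) by (intro yrange_homog_mult) auto
      thus "yrange s (Suc d) (G i)"
        unfolding G_def using that j(1) by (intro yrange_diff) auto
      show "hom_part (axis 2 1) (s + int d) (G i) = 0"
        unfolding G_def hom_part_diff hom_part_homog_mult[OF c]
        by (simp add: c_def t_def)
    qed
    moreover have "d < card (I - {j})" using Suc.prems(1,2) j(1) by simp
    ultimately obtain g where g: "\<forall>i\<in>I - {j}. homog (axis 2 1) 0 (g i)"
      "\<exists>i\<in>I - {j}. g i \<noteq> 0" "(\<Sum>i\<in>I - {j}. g i * G i) = 0"
      using Suc.IH[of "I - {j}" G] Suc.prems(1) by auto
    define g' where "g' i = (if i = j then - (\<Sum>i\<in>I - {j}. g i * c i) else g i * c j)" for i
    have "(\<Sum>i\<in>I. g' i * F i) = g' j * F j + (\<Sum>i\<in>I - {j}. g' i * F i)"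
      using Suc.prems(1) j(1) by (rule sum.remove)
    also have "(\<Sum>i\<in>I - {j}. g' i * F i) = (\<Sum>i\<in>I - {j}. g i * c j * F i)"
      by (intro sum.cong) (auto simp: g'_def)
    also have "g' j * F j = - (\<Sum>i\<in>I - {j}. g i * c i * F j)"
      by (simp add: g'_def sum_distrib_right)
    also have "\<dots> + (\<Sum>i\<in>I - {j}. g i * c j * F i) = (\<Sum>i\<in>I - {j}. g i * G i)"
      by (simp add: G_def right_diff_distrib sum_subtractf mult_ac)
    finally have "(\<Sum>i\<in>I. g' i * F i) = 0" using g(3) by simp
    moreover have "homog (axis 2 1) 0 (g' i)" if "i \<in> I" for i
    proof -
      have "homog (axis 2 1) (0 + 0) (g k * c l)" if "k \<in> I - {j}" for k l
        using that g(1) c by (intro homog_mult) auto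
      thus ?thesis using that by (auto simp: g'_def intro!: homog_uminus homog_sum)
    qed
    moreover have "\<exists>i\<in>I. g' i \<noteq> 0" using g(2) j by (auto simp: g'_def)
    ultimately show ?thesis by blast
  qed
qed

text \<open>Modulo p, of degree d in y, any d + 1 elements are dependent over C[x, 1/x].
  Pseudo-division by p shortens the y-range until \<open>linear_dependence\<close> applies.\<close>

lemma dependence_mod:
  assumes "p \<noteq> 0" "yrange s0 (Suc d) p" "hom_part (axis 2 1) (s0 + int d) p \<noteq> 0"
    and "finite I" "card I > d" "\<And>i. i \<in> I \<Longrightarrow> yrange s e (F i)"
  shows "\<exists>g. (\<forall>i\<in>I. homog (axis 2 1) 0 (g i)) \<and> (\<exists>i\<in>I. g i \<noteq> 0) \<and> p dvd (\<Sum>i\<in>I. g i * F i)"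
  using assms(6)
proof (induction e arbitrary: F)
  case 0
  have "yrange s d (F i)" if "i \<in> I" for i
    using 0[OF that] by (rule yrange_mono) auto
  from linear_dependence[OF assms(4,5) this] show ?case by force
next
  case (Suc e)
  show ?case
  proof (cases "Suc e \<le> d")
    case True
    have "yrange s d (F i)" if "i \<in> I" for i
      using Suc.prems[OF that] by (rule yrange_mono) (use True in auto)
    from linear_dependence[OF assms(4,5) this] show ?thesis by force
  next
    case False
    define T where "T = s0 + int d"
    define u where "u = lmonom 1 (axis 2 (- T))"
    define L where "L = u * hom_part (axis 2 1) T p"
    define H where "H i = hom_part (axis 2 1) (s + int e) (F i)" for i
    \<comment> \<open>Multiplication by the leading coefficient L of p makes the top coefficient of
      \<open>F i\<close> cancellable by a multiple of p.\<close>
    define G where "G i = L * F i - (H i * u) * p" for i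
    have u: "homog (axis 2 1) (- T) u" unfolding u_def by (rule homog_lmonom) (simp add: pairing_def)
    have L: "homog (axis 2 1) 0 L" "L \<noteq> 0"
      using homog_mult[OF u homog_hom_part, of T p] assms(3) by (auto simp: L_def u_def T_def)
    have Hu: "homog (axis 2 1) (s + int e - T) (H i * u)" for i
      unfolding H_def using homog_mult[OF homog_hom_part u] by simp
    have "yrange s e (G i)" if "i \<in> I" for i
    proof (rule yrange_Suc)
      have "yrange (s + int e - T + s0) (Suc d) (H i * u * p)"
        by (rule yrange_homog_mult[OF Hu assms(2)])
      hence "yrange s (Suc e) (H i * u * p)"
        by (rule yrange_mono) (use False in \<open>auto simp: T_def\<close>)
      moreover have "yrange (0 + s) (Suc e) (L * F i)"
        by (intro yrange_homog_mult L Suc.prems that)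
      ultimately show "yrange s (Suc e) (G i)" unfolding G_def by (intro yrange_diff) auto
      show "hom_part (axis 2 1) (s + int e) (G i) = 0"
        unfolding G_def hom_part_diff hom_part_homog_mult[OF Hu] hom_part_homog_mult[OF L(1)]
        by (simp add: H_def L_def mult_ac)
    qed
    from Suc.IH[of G, OF this] obtain g where g: "\<forall>i\<in>I. homog (axis 2 1) 0 (g i)" "\<exists>i\<in>I. g i \<noteq> 0"
      "p dvd (\<Sum>i\<in>I. g i * G i)" by blast
    have "(\<Sum>i\<in>I. (g i * L) * F i) = (\<Sum>i\<in>I. g i * G i) + p * (\<Sum>i\<in>I. g i * H i * u)"
      by (simp add: G_def algebra_simps sum_subtractf sum_distrib_left)
    hence "p dvd (\<Sum>i\<in>I. (g i * L) * F i)" using g(3) by simp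
    moreover have "\<forall>i\<in>I. homog (axis 2 1) 0 (g i * L)" using g(1) homog_mult[OF _ L(1), of 0] by auto
    moreover have "\<exists>i\<in>I. g i * L \<noteq> 0" using g(2) L(2) by auto
    ultimately show ?thesis by (intro exI[of _ "\<lambda>i. g i * L"]) blast
  qed
qed

text \<open>The constant c is chosen so that k = g - c h loses the lowest exponent a of h. The
  Wronskian of k and h still vanishes, and its lowest term forces k to begin in the same exponent a
  unless k = 0.\<close>

lemma proportional_of_wronskian_0:
  assumes hom: "homog (axis 2 1) 0 g" "homog (axis 2 1) 0 h" and "h \<noteq> 0"
    and eq: "h * Eul (axis 1 1) g = g * Eul (axis 1 1) h"
  shows "\<exists>c. g = lmonom c 0 * h"
proof -
  let ?x = "axis 1 1 :: lattice"
  define m where "m = ordw ?x h"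
  obtain a where a: "a \<in> lsupp h" "pairing ?x a = m"
    using ordw_attained[OF \<open>h \<noteq> 0\<close>] m_def by blast
  define c where "c = lcoeff g a / lcoeff h a"
  define k where "k = g - lmonom c 0 * h"
  have ka: "lcoeff k a = 0"
    using a(1) by (simp add: k_def lcoeff_diff lcoeff_lmonom_mult c_def lsupp_iff)
  have keq: "h * Eul ?x k = k * Eul ?x h"
    using eq by (simp add: k_def Eul_diff Eul_mult Eul_lmonom algebra_simps)
  have khom: "homog (axis 2 1) 0 k"
    unfolding k_def using hom homog_mult[OF homog_lmonom hom(2), of 0 0 c]
    by (intro homog_diff) auto
  have "k = 0"
  proof (rule ccontr)
    assume "k \<noteq> 0"
    define l where "l = ordw ?x k"
    obtain b where b: "b \<in> lsupp k" "pairing ?x b = l"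
      using ordw_attained[OF \<open>k \<noteq> 0\<close>] l_def by blast
    have h: "weight_ge ?x m h" and k: "weight_ge ?x l k"
      unfolding m_def l_def by (rule weight_ge_ordw)+
    let ?h = "hom_part ?x m h" and ?k = "hom_part ?x l k"
    have nz: "?h \<noteq> 0" "?k \<noteq> 0"
      unfolding m_def l_def
      by (rule hom_part_ordw_nonzero[OF \<open>h \<noteq> 0\<close>], rule hom_part_ordw_nonzero[OF \<open>k \<noteq> 0\<close>])
    have e1: "hom_part ?x (m + l) (h * Eul ?x k) = ?h * (of_int l * ?k)"
      using hom_part_mult[OF h weight_ge_Eul[OF k]] by (simp add: hom_part_Eul homog_Eul)
    have e2: "hom_part ?x (m + l) (k * Eul ?x h) = ?k * (of_int m * ?h)"
      using hom_part_mult[OF k weight_ge_Eul[OF h]]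
      by (simp add: hom_part_Eul homog_Eul add.commute)
    have "?h * (of_int l * ?k) = ?k * (of_int m * ?h)"
      using e1 unfolding keq e2 by (rule sym)
    hence "of_int (l - m) * (?h * ?k) = 0" by (simp add: algebra_simps)
    hence "0 dvd of_int (l - m) * (?h * ?k)" by simp
    hence "l = m" using of_int_dvd_cancel[of "l - m" 0 "?h * ?k"] nz by auto
    hence "b = a" using a b khom hom(2) by (simp add: homog_def pairing_def lattice_eq_iff)
    thus False using ka b(1) by (simp add: lsupp_iff)
  qed
  thus ?thesis by (auto simp: k_def)
qed

lemma axis_neq_0 [simp]: "(axis 1 1 :: lattice) \<noteq> 0" "(axis 2 1 :: lattice) \<noteq> 0"
  by (simp_all add: lattice_eq_iff)

lemma yrange_width:
  assumes "p \<noteq> 0"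
  obtains s d where "yrange s (Suc d) p" "hom_part (axis 2 1) (s + int d) p \<noteq> 0"
proof -
  let ?y = "axis 2 1 :: lattice"
  define s where "s = ordw ?y p"
  define t where "t = - ordw (- ?y) p"
  have st: "s \<le> t" unfolding s_def t_def by (rule ordw_le_neg[OF assms])
  have "yrange s (Suc (nat (t - s))) p"
    unfolding yrange_def
  proof
    fix a assume "a \<in> lsupp p"
    from ordw_le[OF this, of ?y] ordw_le[OF this, of "- ?y"] st
    show "s \<le> pairing ?y a \<and> pairing ?y a < s + int (Suc (nat (t - s)))"
      by (simp add: s_def[symmetric] t_def)
  qed
  moreover have "hom_part ?y (s + int (nat (t - s))) p \<noteq> 0"
  proof -
    obtain a where a: "a \<in> lsupp p" "pairing (- ?y) a = ordw (- ?y) p"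
      using ordw_attained[OF assms] by blast
    hence "a \<in> lsupp (hom_part ?y t p)" by (simp add: lsupp_hom_part t_def)
    thus ?thesis using st by auto
  qed
  ultimately show ?thesis using that by blast
qed

text \<open>The hypothesis says that D annihilates A/B modulo p. Hence A^i B^j = (A/B)^i B^(i+j) has
  the logarithmic derivative (i+j) D B / B modulo p.\<close>

lemma power_Leibniz:
  fixes D :: "laurent \<Rightarrow> laurent"
  assumes Leib: "\<And>f g. D (f * g) = D f * g + f * D g" and D1: "D 1 = 0"
    and dvd: "p dvd B * D A - A * D B"
  shows "p dvd B * D (A ^ i * B ^ j) - of_nat (i + j) * (A ^ i * B ^ j) * D B"
proof -
  have B: "B * D (B ^ j) = of_nat j * B ^ j * D B" for j
    by (induction j) (simp_all add: D1 Leib algebra_simps)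
  show ?thesis
  proof (induction i)
    case 0
    show ?case by (simp add: B algebra_simps)
  next
    case (Suc i)
    have "B * D (A ^ Suc i * B ^ j) - of_nat (Suc i + j) * (A ^ Suc i * B ^ j) * D B =
        (B * D A - A * D B) * (A ^ i * B ^ j)
        + A * (B * D (A ^ i * B ^ j) - of_nat (i + j) * (A ^ i * B ^ j) * D B)"
      using Leib[of A "A ^ i * B ^ j"] by (simp add: mult.assoc) (simp add: algebra_simps)
    thus ?case using dvd Suc.IH by simp
  qed
qed

text \<open>
  The ratio \<open>\<Theta>\<^sub>1p / \<Theta>\<^sub>2p\<close> is algebraic over \<open>\<complex>(x)\<close> in the function field of the curve \<open>p = 0\<close>.
  If \<open>p\<close> divides its Hessian determinant, a derivation tangent to the curve annihilates the ratio, so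
  differentiating a minimal relation shows that the ratio is algebraic over \<open>\<complex>\<close>, hence constant;
  this confines the support of \<open>p\<close> to a line.
\<close>

lemma planar_prime_not_dvd_lhess_det:
  assumes prime: "prime_elem p" and planar: "planar p"
  shows "\<not> p dvd lhess_det (axis 1 1) (axis 2 1) p"
proof
  let ?x = "axis 1 1 :: lattice" and ?y = "axis 2 1 :: lattice"
  assume dvd: "p dvd lhess_det ?x ?y p"
  have nz: "p \<noteq> 0" using prime by (simp add: prime_elem_not_zeroI)
  define A where "A = Eul ?x p"
  define B where "B = Eul ?y p"
  \<comment> \<open>The Hamiltonian derivation of p: it annihilates p and therefore acts modulo
    p.\<close>
  define D where "D f = B * Eul ?x f - A * Eul ?y f" for f
  have Leib: "D (f * g) = D f * g + f * D g" for f g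
    by (simp add: D_def Eul_mult algebra_simps)
  have D1: "D 1 = 0" by (simp add: D_def)
  have Dp: "D p = 0" by (simp add: D_def A_def B_def)
  have D_sum: "D (sum f I) = (\<Sum>i\<in>I. D (f i))" for f and I :: "nat set"
    by (simp add: D_def Eul_sum sum_distrib_left sum_subtractf)
  have D_dvd: "p dvd D r" if "p dvd r" for r
    using that by (auto simp: Leib Dp)
  have B: "\<not> p dvd B"
    unfolding B_def using nz planar planar_not_homog by (intro not_dvd_Eul) auto
  \<comment> \<open>A multiple of p has positive width in y, unlike a nonzero element of
    C[x, 1/x].\<close>
  have x_only: "\<not> p dvd g" if "homog ?y 0 g" "g \<noteq> 0" for g
  proof
    assume "p dvd g"
    then obtain h where h: "g = p * h" by blast
    have "width ?y p \<noteq> 0" using width_0_iff[OF nz, of ?y] planar_not_homog[OF planar] by simp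
    hence "width ?y p > 0" using width_nonneg[OF nz, of ?y] by simp
    moreover have "width ?y h \<ge> 0" using that h by (intro width_nonneg) auto
    ultimately have "width ?y g > 0" using that nz by (simp add: h width_mult)
    thus False using width_0_iff[OF that(2), of ?y] that(1) by force
  qed
  \<comment> \<open>Here the assumed divisibility enters: modulo p this Wronskian is minus the
    Hessian determinant, so D annihilates A/B.\<close>
  have wronskian: "p dvd B * D A - A * D B"
  proof -
    have "B * D A - A * D B = p * (Eul ?x A * Eul ?y B - (Eul ?x B)\<^sup>2) - lhess_det ?x ?y p"
      by (simp add: lhess_det_def D_def A_def B_def Eul_commute[of ?y ?x] power2_eq_square
          algebra_simps)
    thus ?thesis using dvd by simp
  qed

  \<comment> \<open>A polynomial relation of degree n for A/B over C[x, 1/x], homogenized to avoid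
    the denominator B.\<close>
  define rel where "rel n g \<longleftrightarrow> (\<forall>i\<in>{..n}. homog ?y 0 (g i)) \<and> (\<exists>i\<in>{..n}. g i \<noteq> 0) \<and>
    p dvd (\<Sum>i\<le>n. g i * (A ^ i * B ^ (n - i)))" for n and g :: "nat \<Rightarrow> laurent"
  have "\<exists>n g. rel n g"
  proof -
    obtain s0 d where d: "yrange s0 (Suc d) p" "hom_part ?y (s0 + int d) p \<noteq> 0"
      using yrange_width[OF nz] by blast
    obtain s e where "\<forall>i\<in>{..d}. yrange s e (A ^ i * B ^ (d - i))"
      using yrange_exists[of "{..d}" "\<lambda>i. A ^ i * B ^ (d - i)"] by auto
    thus ?thesis using dependence_mod[OF nz d, of "{..d}" s e "\<lambda>i. A ^ i * B ^ (d - i)"]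
      unfolding rel_def by auto
  qed
  then obtain n g where rel: "rel n g" and minimal: "\<And>m h. m < n \<Longrightarrow> \<not> rel m h"
    using exists_least_iff[of "\<lambda>n. \<exists>g. rel n g"] by auto
  have hom: "homog ?y 0 (g i)" if "i \<le> n" for i using rel that by (simp add: rel_def)
  define R where "R = (\<Sum>i\<le>n. g i * (A ^ i * B ^ (n - i)))"
  have R: "p dvd R" using rel by (simp add: rel_def R_def)
  have "n \<noteq> 0"
  proof
    assume "n = 0"
    thus False using rel x_only[of "g 0"] by (simp add: rel_def)
  qed
  then obtain m where m: "n = Suc m" by (cases n) auto
  have split: "(\<Sum>i\<le>n. h i * (A ^ i * B ^ (n - i))) =
      B * (\<Sum>i\<le>m. h i * (A ^ i * B ^ (m - i)))" if "h n = 0" for h :: "nat \<Rightarrow> laurent"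
  proof -
    have "(\<Sum>i\<le>n. h i * (A ^ i * B ^ (n - i))) = (\<Sum>i\<le>m. h i * (A ^ i * B ^ (n - i)))"
      using that by (simp add: m)
    also have "\<dots> = (\<Sum>i\<le>m. B * (h i * (A ^ i * B ^ (m - i))))"
      by (intro sum.cong) (auto simp: m Suc_diff_le mult_ac)
    finally show ?thesis by (simp add: sum_distrib_left)
  qed
  \<comment> \<open>Without its leading term a relation is B times one of smaller degree, so
    minimality of n makes all its coefficients vanish.\<close>
  have shorter: "h i = 0" if "\<forall>i\<le>n. homog ?y 0 (h i)" "h n = 0"
    "p dvd (\<Sum>i\<le>n. h i * (A ^ i * B ^ (n - i)))" "i \<le> n" for h i
  proof (rule ccontr)
    assume "h i \<noteq> 0"
    hence "i \<le> m" using that by (metis le_SucE m)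
    moreover have "p dvd (\<Sum>i\<le>m. h i * (A ^ i * B ^ (m - i)))"
      using that(3) B prime_elem_dvd_multD[OF prime] unfolding split[of h, OF that(2)] by blast
    ultimately have "rel m h" unfolding rel_def using that(1) \<open>h i \<noteq> 0\<close> by (auto simp: m)
    thus False using minimal[of m] by (simp add: m)
  qed
  have gn: "g n \<noteq> 0"
  proof
    assume "g n = 0"
    hence "\<forall>i\<le>n. g i = 0" using shorter[of g] hom R unfolding R_def by blast
    thus False using rel by (simp add: rel_def)
  qed

  \<comment> \<open>Applying D to the relation differentiates only its coefficients, because D
    annihilates A/B modulo p, and \<open>D (g i)\<close> is B times
    \<open>Eul ?x (g i)\<close>.\<close>
  have "p dvd (\<Sum>i\<le>n. Eul ?x (g i) * (A ^ i * B ^ (n - i)))" (is "p dvd ?R'")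
  proof -
    define F where "F i = A ^ i * B ^ (n - i)" for i
    have Dg: "D (g i) = B * Eul ?x (g i)" if "i \<le> n" for i
      using homog_Eul[OF hom[OF that]] by (simp add: D_def)
    have "B * D R - of_nat n * D B * R = (\<Sum>i\<le>n. B * (D (g i) * F i
        + g i * D (F i)) - of_nat n * D B * (g i * F i))"
      by (simp add: R_def F_def D_sum Leib sum_distrib_left sum_subtractf)
    also have "\<dots> = (\<Sum>i\<le>n. B * (B * (Eul ?x (g i) * F i))
        + g i * (B * D (F i) - of_nat (i + (n - i)) * F i * D B))"
      by (intro sum.cong refl) (simp add: Dg algebra_simps)
    also have "\<dots> = B * (B * ?R')
        + (\<Sum>i\<le>n. g i * (B * D (F i) - of_nat (i + (n - i)) * F i * D B))"
      by (simp add: sum.distrib sum_distrib_left F_def)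
    finally have "B * (B * ?R') = (B * D R - of_nat n * D B * R)
        - (\<Sum>i\<le>n. g i * (B * D (F i) - of_nat (i + (n - i)) * F i * D B))"
      by (simp only: add_diff_cancel_right')
    moreover have "p dvd B * D R - of_nat n * D B * R"
      using D_dvd[OF R] R by (intro dvd_diff dvd_mult)
    moreover have "p dvd (\<Sum>i\<le>n. g i * (B * D (F i) - of_nat (i + (n - i)) * F i * D B))"
      unfolding F_def by (intro dvd_sum dvd_mult power_Leibniz Leib D1 wronskian)
    ultimately have "p dvd B * (B * ?R')" by (simp only: dvd_diff)
    thus ?thesis using B prime_elem_dvd_multD[OF prime] by blast
  qed
  \<comment> \<open>Eliminating the leading coefficient leaves the Wronskians of \<open>g i\<close>
    and \<open>g n\<close> as coefficients, which \<open>shorter\<close> sends to 0.\<close>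
  hence R': "p dvd (\<Sum>i\<le>n. (g n * Eul ?x (g i) - g i * Eul ?x (g n)) * (A ^ i * B ^ (n - i)))"
  proof -
    have "(\<Sum>i\<le>n. (g n * Eul ?x (g i) - g i * Eul ?x (g n)) * (A ^ i * B ^ (n - i))) =
        g n * ?R' - Eul ?x (g n) * R"
      by (simp add: R_def sum_subtractf sum_distrib_left algebra_simps)
    thus ?thesis using \<open>p dvd ?R'\<close> R by simp
  qed
  have wr: "g n * Eul ?x (g i) = g i * Eul ?x (g n)" if "i \<le> n" for i
  proof -
    have "homog ?y 0 (g n * Eul ?x (g i) - g i * Eul ?x (g n))" if "i \<le> n" for i
      using homog_mult[OF hom[OF order.refl] homog_Eul_closed[OF hom[OF that]], of ?x]
        homog_mult[OF hom[OF that] homog_Eul_closed[OF hom[OF order.refl]], of ?x]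
      by (intro homog_diff) auto
    thus ?thesis using shorter[OF _ _ R' that] by simp
  qed
  have "\<exists>c. g i = lmonom c 0 * g n" if "i \<le> n" for i
    using proportional_of_wronskian_0[OF hom[OF that] hom[OF order.refl] gn wr[OF that]] .
  then obtain c where c: "\<And>i. i \<le> n \<Longrightarrow> g i = lmonom (c i) 0 * g n" by metis
  \<comment> \<open>After removal of \<open>g n\<close> the relation has complex coefficients. A
    root z of Q splits off A - z B, and minimality prevents p from dividing the cofactor T.\<close>
  define Q where "Q = (\<Sum>i\<le>n. monom (c i) i)"
  have coeff_Q: "coeff Q i = (if i \<le> n then c i else 0)" for i
    by (simp add: Q_def coeff_sum)
  have "c n \<noteq> 0" using c[of n] gn by auto
  hence deg_Q: "degree Q = n"
    by (intro antisym degree_le le_degree) (auto simp: coeff_Q)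
  have "\<not> constant (poly Q)" using deg_Q \<open>n \<noteq> 0\<close> by (simp add: constant_degree)
  then obtain z where "poly Q z = 0" using fundamental_theorem_of_algebra by blast
  then obtain q where q: "Q = [:- z, 1:] * q" unfolding poly_eq_0_iff_dvd by blast
  have "q \<noteq> 0" using q deg_Q \<open>n \<noteq> 0\<close> by auto
  hence deg_q: "degree q = m" using deg_Q by (simp add: q degree_mult_eq m del: mult_pCons_left)
  define T where "T = (\<Sum>i\<le>m. lmonom (coeff q i) 0 * (A ^ i * B ^ (m - i)))"
  have factor: "(\<Sum>i\<le>n. lmonom (c i) 0 * (A ^ i * B ^ (n - i))) = (A - lmonom z 0 * B) * T"
  proof -
    have "lmonom (c i) 0 = lmonom (coeff (pCons 0 q) i) 0 - lmonom z 0 * lmonom (coeff q i) 0"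
      if "i \<le> n" for i
      using coeff_Q[of i] that by (simp add: q lmonom_diff lmonom_mult)
    hence "(\<Sum>i\<le>n. lmonom (c i) 0 * (A ^ i * B ^ (n - i))) =
        (\<Sum>i\<le>n. (lmonom (coeff (pCons 0 q) i) 0 - lmonom z 0 * lmonom (coeff q i) 0)
          * (A ^ i * B ^ (n - i)))"
      by (intro sum.cong) auto
    also have "\<dots> =
        (\<Sum>i\<le>n. lmonom (coeff (pCons 0 q) i) 0 * (A ^ i * B ^ (n - i)))
        - lmonom z 0 * (\<Sum>i\<le>n. lmonom (coeff q i) 0 * (A ^ i * B ^ (n - i)))"
      by (simp add: sum_subtractf sum_distrib_left algebra_simps)
    also have "(\<Sum>i\<le>n. lmonom (coeff q i) 0 * (A ^ i * B ^ (n - i))) = B * T"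
      unfolding T_def by (rule split) (simp add: coeff_eq_0 deg_q m)
    also have "(\<Sum>i\<le>n. lmonom (coeff (pCons 0 q) i) 0 * (A ^ i * B ^ (n - i))) = A * T"
      unfolding m sum.atMost_Suc_shift T_def by (simp add: sum_distrib_left mult_ac)
    finally show ?thesis by (simp add: algebra_simps)
  qed
  have "p dvd g n * ((A - lmonom z 0 * B) * T)"
  proof -
    have "R = g n * (\<Sum>i\<le>n. lmonom (c i) 0 * (A ^ i * B ^ (n - i)))"
      unfolding R_def sum_distrib_left
    proof (intro sum.cong refl)
      fix i assume "i \<in> {..n}"
      thus "g i * (A ^ i * B ^ (n - i)) = g n * (lmonom (c i) 0 * (A ^ i * B ^ (n - i)))"
        using c[of i] by (simp add: mult_ac)
    qed
    thus ?thesis using R factor by simp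
  qed
  moreover have "\<not> p dvd T"
  proof
    assume "p dvd T"
    hence "rel m (\<lambda>i. lmonom (coeff q i) 0)"
      using \<open>q \<noteq> 0\<close> deg_q by (auto simp: rel_def T_def homog_lmonom intro!: bexI[of _ m])
    thus False using minimal[of m] by (simp add: m)
  qed
  ultimately have "p dvd A - lmonom z 0 * B"
    using x_only[OF hom gn] prime_elem_dvd_multD[OF prime] by blast
  moreover have "lsupp (A - lmonom z 0 * B) \<subseteq> lsupp p"
    by (auto simp: lsupp_iff lcoeff_diff lcoeff_lmonom_mult A_def B_def lcoeff_Eul)
  ultimately obtain k where k: "A - lmonom z 0 * B = lmonom k 0 * p"
    using dvd_supp_subset_imp_const by blast
  \<comment> \<open>Comparing coefficients in A - z B = k p puts all exponents on one complex affine
    line.\<close>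
  have line: "of_int (a $ 1) = z * of_int (a $ 2) + k" if "a \<in> lsupp p" for a
  proof -
    have "of_int (a $ 1) * lcoeff p a - z * (of_int (a $ 2) * lcoeff p a) = k * lcoeff p a"
      using arg_cong[OF k, of "\<lambda>r. lcoeff r a"]
      by (simp add: lcoeff_diff lcoeff_lmonom_mult A_def B_def lcoeff_Eul pairing_def)
    hence "(of_int (a $ 1) - (z * of_int (a $ 2) + k)) * lcoeff p a = 0" by algebra
    moreover have "lcoeff p a \<noteq> 0" using that by (simp add: lsupp_iff)
    ultimately show ?thesis by simp
  qed
  obtain a b e where abe: "a \<in> lsupp p" "b \<in> lsupp p" "e \<in> lsupp p" "cross (b - a) (e - a) \<noteq> 0"
    using planar by (auto simp: planar_def)
  have "of_int (cross (b - a) (e - a)) = (0 :: complex)"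
    by (simp add: cross_def line[OF abe(1)] line[OF abe(2)] line[OF abe(3)] algebra_simps)
  thus False using abe(4) by simp
qed

section \<open>Edges of the Newton polygon\<close>

lemma pairing_scale [simp]:
  "pairing (k *s w) a = k * pairing w a" "pairing w (k *s a) = k * pairing w a"
  by (simp_all add: pairing_def algebra_simps)

lemma pairing_add_left: "pairing (v + w) a = pairing v a + pairing w a"
  by (simp add: pairing_def algebra_simps)

text \<open>Primitivity is witnessed by a z with \<open>cross w' z = 1\<close>, obtained from
  Bezout; z then also supplies the second derivation in determinant computations.\<close>

lemma primitive_multiple:
  assumes "(w :: lattice) \<noteq> 0"
  obtains g w' z where "g > 0" "w = g *s w'" "cross w' z = 1"
proof -
  define g where "g = gcd (w $ 1) (w $ 2)"
  have g: "g > 0" using assms by (auto simp: g_def lattice_eq_iff)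
  define w' :: lattice where "w' = vector [w $ 1 div g, w $ 2 div g]"
  have w: "w = g *s w'"
    by (simp add: lattice_eq_iff w'_def vector_2 g_def)
  obtain s t where "s * w $ 1 + t * w $ 2 = g" using bezout_int[of "w $ 1" "w $ 2"] g_def by blast
  hence "g * (s * w' $ 1 + t * w' $ 2) = g * 1" by (simp add: w algebra_simps)
  hence "s * w' $ 1 + t * w' $ 2 = 1" unfolding mult_cancel_left using g by auto
  hence "cross w' (vector [- t, s]) = 1" by (simp add: cross_def vector_2 algebra_simps)
  thus ?thesis using that g w by blast
qed

text \<open>The weight is the primitive normal of a line containing the support; with at most one
  exponent any primitive weight will do.\<close>

lemma not_planar_homog:
  assumes "\<not> planar p"
  obtains w z h where "cross w z = 1" "homog w h p"
proof (cases "\<exists>a\<in>lsupp p. \<exists>b\<in>lsupp p. a \<noteq> b")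
  case True
  then obtain a b where ab: "a \<in> lsupp p" "b \<in> lsupp p" "a \<noteq> b" by blast
  define v :: lattice where "v = vector [- (b - a) $ 2, (b - a) $ 1]"
  have v: "pairing v d = cross (b - a) d" for d
    by (simp add: v_def pairing_def cross_def vector_2 algebra_simps)
  have "v \<noteq> 0" using ab(3) by (auto simp: v_def lattice_eq_iff vector_2)
  then obtain g w z where w: "g > 0" "v = g *s w" "cross w z = 1" by (rule primitive_multiple)
  have "pairing w c = pairing w a" if "c \<in> lsupp p" for c
  proof -
    have "cross (b - a) (c - a) = 0" using assms ab that by (auto simp: planar_def)
    hence "g * pairing w (c - a) = 0" using v[of "c - a"] w(2) by simp
    thus ?thesis using w(1) by simp
  qed
  thus ?thesis using that[OF w(3), of "pairing w a"] by (simp add: homog_def)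
next
  case False
  have c: "cross (axis 1 1) (axis 2 1) = 1" by (simp add: cross_def)
  show ?thesis
  proof (cases "p = 0")
    case True
    thus ?thesis using that[OF c, of 0] by simp
  next
    case nz: False
    then obtain a where "a \<in> lsupp p" by (metis ex_in_conv lsupp_empty_iff)
    hence "homog (axis 1 1) (pairing (axis 1 1) a) p" using False by (auto simp: homog_def)
    thus ?thesis using that[OF c] by blast
  qed
qed

text \<open>Edge normals positively span the plane. Start with the weight -u, negative on u, and
  turn it by adding a multiple of some z orthogonal to u until its minimum is attained at a second
  support point; the sign on u does not change.\<close>

lemma exists_edge_normal:
  assumes "planar p" "u \<noteq> 0"
  shows "\<exists>w z a b. cross w z = 1 \<and> a \<in> lsupp p \<and> b \<in> lsupp p \<and> a \<noteq> b \<and>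
    pairing w a = ordw w p \<and> pairing w b = ordw w p \<and> pairing w u < 0"
proof -
  have nz: "p \<noteq> 0" using assms(1) by (auto simp: planar_def)
  define w0 :: lattice where "w0 = - u"
  have w0u: "pairing w0 u < 0"
    using assms(2) sum_squares_gt_zero_iff[of "u $ 1" "u $ 2"]
    by (auto simp: w0_def pairing_def lattice_eq_iff)
  obtain v where v: "v \<in> lsupp p" "pairing w0 v = ordw w0 p" using ordw_attained[OF nz] by blast
  define z0 :: lattice where "z0 = vector [- u $ 2, u $ 1]"
  have "z0 \<noteq> 0" using assms(2) by (auto simp: z0_def lattice_eq_iff vector_2)
  hence "\<not> homog z0 (pairing z0 v) p" using planar_not_homog assms(1) by blast
  then obtain c where c: "c \<in> lsupp p" "pairing z0 (c - v) \<noteq> 0" by (auto simp: homog_def)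
  \<comment> \<open>The sign is chosen so that turning towards z lowers the weight of some c
    relative to v.\<close>
  define z where "z = (if pairing z0 (c - v) < 0 then z0 else - z0)"
  have zc: "pairing z (c - v) < 0" using c by (auto simp: z_def)
  have zu: "pairing z u = 0" by (simp add: z_def z0_def pairing_def vector_2)
  \<comment> \<open>The points whose weight relative to v drops. The minimizer of the ratio below is
    the first of them to reach the level of v.\<close>
  define T where "T = {b \<in> lsupp p. pairing z (b - v) < 0}"
  define \<alpha> \<beta> where "\<alpha> b = pairing w0 (b - v)" and "\<beta> b = - pairing z (b - v)" for b
  have "finite T" "T \<noteq> {}" using c(1) zc by (auto simp: T_def finite_lsupp)
  from ex_is_arg_min_if_finite[OF this, of "\<lambda>b. real_of_int (\<alpha> b) / real_of_int (\<beta> b)"]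
  obtain b where b: "b \<in> T"
    "\<And>c. c \<in> T \<Longrightarrow> real_of_int (\<alpha> b) / real_of_int (\<beta> b) \<le> real_of_int (\<alpha> c) / real_of_int (\<beta> c)"
    by (auto simp: is_arg_min_linorder)
  have \<alpha>: "\<alpha> c \<ge> 0" if "c \<in> lsupp p" for c
    using ordw_le[OF that, of w0] v(2) by (simp add: \<alpha>_def)
  have \<beta>: "\<beta> c > 0" if "c \<in> T" for c using that by (simp add: \<beta>_def T_def)
  \<comment> \<open>The weight \<open>w0\<close> + (\<open>\<alpha> b\<close> /
    \<open>\<beta> b\<close>) z with its denominator cleared; it takes equal values at b and
    v.\<close>
  define w where "w = \<beta> b *s w0 + \<alpha> b *s z"
  have wc: "pairing w (c - v) = \<beta> b * \<alpha> c - \<alpha> b * \<beta> c" for c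
  proof -
    have "pairing w d = \<beta> b * pairing w0 d + \<alpha> b * pairing z d" for d
      by (simp add: w_def pairing_add_left)
    thus ?thesis unfolding \<alpha>_def[of c] \<beta>_def[of c] by (simp only: mult_minus_right diff_minus_eq_add)
  qed
  have w_ge: "pairing w (c - v) \<ge> 0" if "c \<in> lsupp p" for c
  proof (cases "c \<in> T")
    case True
    have "real_of_int (\<alpha> b) * real_of_int (\<beta> c) \<le> real_of_int (\<alpha> c) * real_of_int (\<beta> b)"
      using b(2)[OF True] \<beta>[OF True] \<beta>[OF b(1)] by (simp add: divide_simps mult.commute)
    hence "\<alpha> b * \<beta> c \<le> \<alpha> c * \<beta> b" by (simp flip: of_int_mult)
    thus ?thesis unfolding wc by (simp add: mult.commute)
  next
    case False
    hence "\<beta> c \<le> 0" using that by (simp add: T_def \<beta>_def)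
    moreover have "\<alpha> b \<ge> 0" using \<alpha> b(1) by (simp add: T_def)
    ultimately have "\<alpha> b * \<beta> c \<le> 0" by (simp add: mult_nonneg_nonpos)
    moreover have "\<beta> b * \<alpha> c \<ge> 0" using \<alpha>[OF that] \<beta>[OF b(1)] by simp
    ultimately show ?thesis unfolding wc by linarith
  qed
  have wu: "pairing w u < 0"
    using w0u \<beta>[OF b(1)] zu by (simp add: w_def pairing_add_left mult_pos_neg)
  hence "w \<noteq> 0" by (auto simp: pairing_def)
  then obtain g w' z' where w': "g > 0" "w = g *s w'" "cross w' z' = 1" by (rule primitive_multiple)
  have ge: "pairing w' c \<ge> pairing w' v" if "c \<in> lsupp p" for c
    using w_ge[OF that] w'(1) by (simp add: w'(2) zero_le_mult_iff flip: right_diff_distrib)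
  have "pairing w (b - v) = 0" unfolding wc by simp
  hence "pairing w' b = pairing w' v" using w'(1) by (simp add: w'(2) flip: right_diff_distrib)
  moreover have "ordw w' p = pairing w' v"
    unfolding ordw_def using v(1) ge by (intro Min_eqI) (auto simp: finite_lsupp)
  moreover have "b \<noteq> v" using b(1) by (auto simp: T_def)
  moreover have "pairing w' u < 0" using wu w'(1) by (simp add: w'(2) mult_less_0_iff)
  moreover have "b \<in> lsupp p" using b(1) by (simp add: T_def)
  ultimately show ?thesis using w'(3) v(1) by metis
qed

section \<open>Independence in the lattice and effective rank\<close>

lemma zlat_independent_pair:
  assumes "zlat.independent B" "a \<in> B" "b \<in> B" "a \<noteq> b"
  shows "cross a b \<noteq> 0"
proof
  assume 0: "cross a b = 0"
  have rel: "s = 0 \<and> t = 0" if "s *s a + t *s b = 0" for s t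
  proof -
    have sum: "(\<Sum>v\<in>{a, b}. (if v = a then s else t) *s v) = 0" using that assms(4) by simp
    from zlat.independentD[OF assms(1) _ _ sum, of a] zlat.independentD[OF assms(1) _ _ sum, of b]
    show ?thesis using assms(2-4) by auto
  qed
  have "b $ 2 = 0 \<and> a $ 2 = 0" "b $ 1 = 0 \<and> a $ 1 = 0"
    using rel[of "b $ 2" "- a $ 2"] rel[of "b $ 1" "- a $ 1"] 0
    by (simp_all add: lattice_eq_iff cross_def algebra_simps)
  thus False using assms(4) by (simp add: lattice_eq_iff)
qed

lemma zlat_independent_triple:
  assumes "zlat.independent B" "a \<in> B" "b \<in> B" "c \<in> B" "a \<noteq> b"
  shows "c = a \<or> c = b"
proof (rule ccontr)
  assume c: "\<not> (c = a \<or> c = b)"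
  hence ne: "a \<noteq> c" "b \<noteq> c" by auto
  \<comment> \<open>The coefficients of the universal linear relation between three plane
    vectors.\<close>
  let ?u = "\<lambda>v. if v = a then cross b c else if v = b then cross c a else cross a b"
  have "(\<Sum>v\<in>{a, b, c}. ?u v *s v) = cross b c *s a + (cross c a *s b + cross a b *s c)"
    using c ne assms(5) by simp
  also have "\<dots> = 0" by (simp add: lattice_eq_iff cross_def algebra_simps)
  finally have "?u c = 0"
    using assms(2-4) by (intro zlat.independentD[OF assms(1), of "{a, b, c}"]) auto
  thus False using c zlat_independent_pair[OF assms(1-3,5)] by simp
qed

lemma inner_real_pt: "real_pt w \<bullet> real_pt a = of_int (pairing w a)"
  by (simp add: inner_vec_def real_pt_def pairing_def UNIV_2)

text \<open>For collinear support the difference lattice lies in the kernel of a nonzero weight w.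
  Two independent vectors there would give w = 0 by Cramer's rule, so independent sets have at most
  one element.\<close>

lemma effective_rank_2_planar:
  assumes "effective_rank p = 2"
  shows "planar p"
proof (rule ccontr)
  assume "\<not> planar p"
  then obtain w z h where w: "cross w z = 1" "homog w h p" by (rule not_planar_homog)
  have "span {real_pt b - real_pt c |b c. b \<in> lsupp p \<and> c \<in> lsupp p} \<subseteq> {x. real_pt w \<bullet> x = 0}"
    using w(2)
    by (intro span_minimal subspace_hyperplane) (auto simp: inner_diff_right inner_real_pt homog_def)
  hence perp: "pairing w a = 0" if "a \<in> diff_lattice p" for a
    using that inner_real_pt[of w a] by (auto simp: diff_lattice_def)
  define C where "C = {card B |B. B \<subseteq> diff_lattice p \<and> finite B \<and> zlat.independent B}"
  have card: "card B \<le> 1" if "B \<subseteq> diff_lattice p" "finite B" "zlat.independent B" for B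
  proof -
    have "a = b" if ab: "a \<in> B" "b \<in> B" for a b
    proof (rule ccontr)
      assume "a \<noteq> b"
      hence "cross a b \<noteq> 0" using zlat_independent_pair \<open>zlat.independent B\<close> ab by blast
      moreover have "pairing w a = 0" "pairing w b = 0" using perp \<open>B \<subseteq> _\<close> ab by auto
      ultimately have "w = 0" using pairing_cross[of w a b] by (simp add: lattice_eq_iff)
      thus False using w(1) by (simp add: cross_def)
    qed
    thus ?thesis by (simp add: card_le_Suc0_iff_eq[OF \<open>finite B\<close>])
  qed
  have "C \<subseteq> {..1}" using card by (auto simp: C_def)
  hence "finite C" by (rule finite_subset) simp
  moreover have "zlat.independent {}" by (rule zlat.independent_empty)
  hence "card ({} :: lattice set) \<in> C" unfolding C_def by blast
  hence "C \<noteq> {}" by blast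
  ultimately have "Max C \<in> C" by (rule Max_in)
  hence "Max C \<le> 1" using \<open>C \<subseteq> {..1}\<close> by auto
  thus False using assms by (simp add: effective_rank_def lattice_rank_def C_def)
qed

lemma real_pt_inject: "real_pt a = real_pt b \<longleftrightarrow> a = b"
  by (simp add: real_pt_def vec_eq_iff)

lemma planar_diff_lattice:
  assumes "planar p"
  shows "diff_lattice p = UNIV"
proof -
  obtain a b c where abc: "a \<in> lsupp p" "b \<in> lsupp p" "c \<in> lsupp p" "cross (b - a) (c - a) \<noteq> 0"
    using assms by (auto simp: planar_def)
  let ?S = "{real_pt b - real_pt c |b c. b \<in> lsupp p \<and> c \<in> lsupp p}"
  define D where "D = real_of_int (cross (b - a) (c - a))"
  have D: "D \<noteq> 0" using abc(4) by (simp add: D_def)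
  have "real_pt x \<in> span ?S" for x
  proof -
    have "real_pt b - real_pt a \<in> span ?S" "real_pt c - real_pt a \<in> span ?S"
      using abc by (auto intro!: span_base)
    hence "(of_int (cross x (c - a)) / D) *\<^sub>R (real_pt b - real_pt a)
        + (of_int (cross (b - a) x) / D) *\<^sub>R (real_pt c - real_pt a) \<in> span ?S" (is "?X \<in> _")
      by (intro span_add span_scale)
    moreover have "?X = real_pt x"
    proof -
      have "D *\<^sub>R ?X =
          of_int (cross x (c - a)) *\<^sub>R (real_pt b - real_pt a)
          + of_int (cross (b - a) x) *\<^sub>R (real_pt c - real_pt a)"
        using D by (simp add: scaleR_add_right)
      also have "\<dots> = D *\<^sub>R real_pt x"
        unfolding D_def vec_eq_iff forall_2
        by (simp add: real_pt_def cross_def algebra_simps)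
      finally show ?thesis using D by simp
    qed
    ultimately show ?thesis by simp
  qed
  thus ?thesis by (auto simp: diff_lattice_def)
qed

section \<open>Vertices, edges and unimodularity\<close>

lemma extreme_point_in_supp:
  assumes "v extreme_point_of Newt p"
  obtains a where "a \<in> lsupp p" "v = real_pt a"
  using extreme_point_of_convex_hull[of v "real_pt ` lsupp p"] assms that by (auto simp: Newt_def)

lemma Newt_compact: "compact (Newt p)" and Newt_convex: "convex (Newt p)"
  by (auto simp: Newt_def finite_lsupp finite_imp_compact_convex_hull)

lemma real_pt_in_Newt: "a \<in> lsupp p \<Longrightarrow> real_pt a \<in> Newt p"
  unfolding Newt_def by (intro hull_inc) auto

lemma unimodular_vertex:
  assumes "planar p" "unimodular_support p"
  obtains v B where "v \<in> lsupp p" "is_zbasis B UNIV" "\<And>b. b \<in> B \<Longrightarrow> v + b \<in> lsupp p"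
proof -
  have "Newt p \<noteq> {}" using assms(1) real_pt_in_Newt by (auto simp: planar_def)
  then obtain x where x: "x extreme_point_of Newt p"
    using extreme_point_exists_convex Newt_compact Newt_convex by blast
  then obtain v where v: "v \<in> lsupp p" "x = real_pt v" by (rule extreme_point_in_supp)
  let ?B = "{a - v |a. \<exists>e. e edge_of Newt p \<and> real_pt v \<in> e \<and> a \<in> nearest_on_edge p v e}"
  have "is_zbasis ?B UNIV"
    using assms x v by (auto simp: unimodular_support_def planar_diff_lattice)
  moreover have "v + b \<in> lsupp p" if "b \<in> ?B" for b
    using that by (auto simp: nearest_on_edge_def)
  ultimately show ?thesis using that v(1) by blast
qed

text \<open>At an endpoint v of the edge the lattice basis contains a vector \<open>e1\<close> along
  the edge, of weight 0. It has at most one further element of nonzero weight, and since w takes the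
  value 1 on the lattice, that weight must be 1.\<close>

lemma unimodular_next_level:
  assumes pl: "planar p" and uni: "unimodular_support p" and wz: "cross w z = 1"
    and ab: "a \<in> lsupp p" "b \<in> lsupp p" "a \<noteq> b" "pairing w a = ordw w p" "pairing w b = ordw w p"
  shows "\<exists>c\<in>lsupp p. pairing w c = ordw w p + 1"
proof -
  define h where "h = ordw w p"
  define F where "F = Newt p \<inter> {x. real_pt w \<bullet> x = of_int h}"
  have ge: "real_pt w \<bullet> x \<ge> of_int h" if "x \<in> Newt p" for x
  proof -
    have "Newt p \<subseteq> {x. real_pt w \<bullet> x \<ge> of_int h}"
      unfolding Newt_def
      by (intro hull_minimal convex_halfspace_ge) (auto simp: inner_real_pt h_def ordw_le)
    thus ?thesis using that by auto
  qed
  have face: "F face_of Newt p"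
    unfolding F_def by (intro face_of_Int_supporting_hyperplane_ge Newt_convex ge)
  have F_iff: "real_pt c \<in> F \<longleftrightarrow> pairing w c = h" if "c \<in> lsupp p" for c
    using real_pt_in_Newt[OF that] by (simp add: F_def inner_real_pt)
  have abF: "real_pt a \<in> F" "real_pt b \<in> F" using ab F_iff by (auto simp: h_def)
  have w0: "w \<noteq> 0" using wz by (auto simp: cross_def)
  have "aff_dim {real_pt a, real_pt b} \<le> aff_dim F"
    using abF by (intro aff_dim_subset) auto
  moreover have "aff_dim F \<le> aff_dim {x. real_pt w \<bullet> x = of_int h}"
    unfolding F_def by (intro aff_dim_subset) auto
  moreover have "real_pt w \<noteq> 0" using w0 real_pt_inject[of w 0] by (simp add: real_pt_def vec_eq_iff)
  ultimately have dim: "aff_dim F = 1"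
    using ab(3) by (simp add: real_pt_inject aff_dim_hyperplane)
  hence edge: "F edge_of Newt p" using face by (simp add: edge_of_def)
  have "compact F" using face_of_imp_compact[OF Newt_convex Newt_compact face] .
  moreover have "convex F" using face by (rule face_of_imp_convex)
  ultimately obtain x where x: "x extreme_point_of F"
    using extreme_point_exists_convex[of F] abF by blast
  hence xN: "x extreme_point_of Newt p" and xF: "x \<in> F"
    using extreme_point_of_face[OF face] by auto
  from xN obtain v where v: "v \<in> lsupp p" "x = real_pt v" by (rule extreme_point_in_supp)
  hence vh: "pairing w v = h" using F_iff xF by simp
  define B where "B = {a - v |a. \<exists>e. e edge_of Newt p \<and> real_pt v \<in> e \<and> a \<in> nearest_on_edge p v e}"
  have basis: "zlat.independent B" "zlat.span B = UNIV"
    using uni xN v pl by (auto simp: unimodular_support_def planar_diff_lattice is_zbasis_def B_def)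
  have B_supp: "v + b \<in> lsupp p" if "b \<in> B" for b
    using that by (auto simp: B_def nearest_on_edge_def)
  have B_ge: "pairing w b \<ge> 0" if "b \<in> B" for b
    using ordw_le[OF B_supp[OF that], of w] vh by (simp add: h_def)
  obtain e1 where e1: "e1 \<in> B" "e1 \<noteq> 0" "pairing w e1 = 0"
  proof -
    define S where "S = {c \<in> lsupp p. c \<noteq> v \<and> real_pt c \<in> F}"
    have "finite S" by (simp add: S_def finite_lsupp)
    moreover have "S \<noteq> {}" using ab abF by (auto simp: S_def)
    ultimately obtain c where c: "c \<in> S"
      "\<And>d. d \<in> S \<Longrightarrow> dist (real_pt v) (real_pt c) \<le> dist (real_pt v) (real_pt d)"
      using ex_is_arg_min_if_finite[of S "\<lambda>c. dist (real_pt v) (real_pt c)"]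
      by (auto simp: is_arg_min_linorder)
    hence "c \<in> nearest_on_edge p v F" by (auto simp: nearest_on_edge_def S_def)
    hence "c - v \<in> B" using edge xF v(2) by (auto simp: B_def)
    moreover have "c - v \<noteq> 0" "pairing w (c - v) = 0"
      using c(1) F_iff vh by (auto simp: S_def)
    ultimately show ?thesis using that by blast
  qed
  have unique: "b = c" if "b \<in> B" "c \<in> B" "pairing w b \<noteq> 0" "pairing w c \<noteq> 0" for b c
    using zlat_independent_triple[OF basis(1), of b e1 c] that e1 by auto
  obtain y where y: "pairing w y = 1"
  proof -
    have "pairing w (vector [z $ 2, - z $ 1]) = 1"
      using wz by (simp add: pairing_def cross_def vector_2 algebra_simps)
    thus ?thesis using that by blast
  qed
  have sub: "zlat.subspace {x. k dvd pairing w x}" for k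
    by (rule zlat.subspaceI) auto
  \<comment> \<open>With k = 0 this yields a basis vector of nonzero weight, and with k that weight
    it shows that the weight divides 1.\<close>
  have span: "k dvd 1" if "\<And>b. b \<in> B \<Longrightarrow> k dvd pairing w b" for k
  proof -
    have "zlat.span B \<subseteq> {x. k dvd pairing w x}"
      using that by (intro zlat.span_minimal sub) auto
    hence "y \<in> {x. k dvd pairing w x}" using basis(2) by blast
    thus ?thesis using y by simp
  qed
  have "\<exists>b\<in>B. pairing w b \<noteq> 0" using span[of 0] by auto
  then obtain b where b: "b \<in> B" "pairing w b \<noteq> 0" by blast
  have "pairing w b dvd pairing w c" if "c \<in> B" for c
    using unique[OF b(1) that b(2)] by (cases "pairing w c = 0") auto
  hence "pairing w b dvd 1" by (rule span)
  hence "pairing w b = 1" using B_ge[OF b(1)] by simp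
  hence "pairing w (v + b) = ordw w p + 1" using vh by (simp add: h_def)
  thus ?thesis using B_supp[OF b(1)] by blast
qed

text \<open>The differences at a vertex already generate the whole lattice, so a and b do, and the
  determinant of generators is invertible.\<close>

lemma unimodular_det:
  assumes "planar p" "unimodular_support p"
    and supp: "\<And>c d. c \<in> lsupp p \<Longrightarrow> d \<in> lsupp p \<Longrightarrow> \<exists>m n. c - d = m *s a + n *s b"
  shows "\<bar>cross a b\<bar> = 1"
proof -
  obtain v B where vB: "v \<in> lsupp p" "is_zbasis B UNIV" "\<And>b. b \<in> B \<Longrightarrow> v + b \<in> lsupp p"
    using unimodular_vertex[OF assms(1,2)] by blast
  have "zlat.subspace {x. \<exists>m n. x = m *s a + n *s b}"
  proof (rule zlat.subspaceI)
    have "0 = 0 *s a + 0 *s b" by simp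
    thus "0 \<in> {x. \<exists>m n. x = m *s a + n *s b}" by blast
    fix x y assume "x \<in> {x. \<exists>m n. x = m *s a + n *s b}" "y \<in> {x. \<exists>m n. x = m *s a + n *s b}"
    then obtain m n m' n' where "x = m *s a + n *s b" "y = m' *s a + n' *s b" by blast
    hence "x + y = (m + m') *s a + (n + n') *s b" by (simp add: lattice_eq_iff algebra_simps)
    thus "x + y \<in> {x. \<exists>m n. x = m *s a + n *s b}" by blast
  next
    fix c x assume "x \<in> {x. \<exists>m n. x = m *s a + n *s b}"
    then obtain m n where "x = m *s a + n *s b" by blast
    hence "c *s x = (c * m) *s a + (c * n) *s b" by (simp add: lattice_eq_iff algebra_simps)
    thus "c *s x \<in> {x. \<exists>m n. x = m *s a + n *s b}" by blast
  qed
  moreover have "B \<subseteq> {x. \<exists>m n. x = m *s a + n *s b}"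
    using supp[OF vB(3) vB(1)] by auto
  ultimately have all: "\<exists>m n. x = m *s a + n *s b" for x
    using zlat.span_minimal vB(2) unfolding is_zbasis_def by blast
  obtain m n where 1: "axis 1 1 = m *s a + n *s b" using all by blast
  obtain m' n' where 2: "axis 2 1 = m' *s a + n' *s b" using all by blast
  have "1 = cross (axis 1 1) (axis 2 1)" by (simp add: cross_def)
  also have "\<dots> = (m * n' - n * m') * cross a b"
    unfolding 1 2 by (simp add: cross_def algebra_simps)
  finally have "cross a b dvd 1" by (metis dvd_triv_right)
  thus ?thesis by simp
qed

section \<open>Multiplicities of the prime factors in the Hessian determinant\<close>

text \<open>The witness z makes w primitive; two distinct minimizers say that the face selected by w
  is not a vertex.\<close>

definition edge_normal :: "laurent \<Rightarrow> lattice \<Rightarrow> bool" where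
  "edge_normal p w \<longleftrightarrow> (\<exists>z. cross w z = 1) \<and>
    (\<exists>a\<in>lsupp p. \<exists>b\<in>lsupp p. a \<noteq> b \<and> pairing w a = ordw w p \<and> pairing w b = ordw w p)"

text \<open>The form in which unimodularity enters the orders of the Hessian determinant; unlike the
  condition on Newton polygons it is immediately stable under translation.\<close>

definition edge_regular :: "laurent \<Rightarrow> bool" where
  "edge_regular p \<longleftrightarrow> (\<forall>w. edge_normal p w \<longrightarrow> (\<exists>c\<in>lsupp p. pairing w c = ordw w p + 1))"

abbreviation (input) hessian :: "laurent \<Rightarrow> laurent" where
  "hessian \<equiv> lhess_det (axis 1 1) (axis 2 1)"

lemma lhess_det_unimodular: "cross w z = 1 \<Longrightarrow> lhess_det w z p = hessian p"
  by (subst lhess_det_basis) simp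

lemma pairings_0: "cross w z \<noteq> 0 \<Longrightarrow> pairing w d = 0 \<Longrightarrow> pairing z d = 0 \<Longrightarrow> d = 0"
proof -
  assume *: "cross w z \<noteq> 0" "pairing w d = 0" "pairing z d = 0"
  have "d $ 1 * cross w z = z $ 2 * pairing w d - w $ 2 * pairing z d"
    "d $ 2 * cross w z = w $ 1 * pairing z d - z $ 1 * pairing w d"
    by (simp_all add: cross_def pairing_def algebra_simps)
  thus "d = 0" using * by (simp add: lattice_eq_iff)
qed

lemma cross_pairing_0: "cross a b \<noteq> 0 \<Longrightarrow> pairing w a = 0 \<Longrightarrow> pairing w b = 0 \<Longrightarrow> w = 0"
  using pairing_cross[of w a b] by (simp add: lattice_eq_iff)

text \<open>The candidate for the lowest part is a product of two nonzero factors: the part of p at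
  height 1 above the edge, and \<open>lhess z z\<close> of the edge part. The latter is nonzero by
  \<open>dvd_lhess_imp\<close> with d = 0, because distinct points of the edge have distinct
  z-weights.\<close>

lemma ordw_hessian:
  assumes "edge_normal p w" "edge_regular p"
  shows "hessian p \<noteq> 0 \<and> ordw w (hessian p) = 3 * ordw w p + 1"
proof -
  define h where "h = ordw w p"
  obtain z a b where ab: "cross w z = 1" "a \<in> lsupp p" "b \<in> lsupp p" "a \<noteq> b"
    "pairing w a = h" "pairing w b = h"
    using assms(1) by (auto simp: edge_normal_def h_def)
  obtain c where c: "c \<in> lsupp p" "pairing w c = h + 1"
    using assms by (auto simp: edge_regular_def h_def)
  have p: "weight_ge w h p" unfolding h_def by (rule weight_ge_ordw)
  let ?P = "hom_part w h p"
  have zab: "pairing z a \<noteq> pairing z b"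
  proof
    assume "pairing z a = pairing z b"
    hence "a - b = 0" using ab by (intro pairings_0[of w z]) auto
    thus False using ab(4) by simp
  qed
  have "lhess z z ?P \<noteq> 0"
  proof
    assume "lhess z z ?P = 0"
    hence "0 dvd hom_part z (pairing z a) ?P \<or> 0 dvd hom_part z (pairing z b) ?P"
      using zab by (intro dvd_lhess_imp[where k = 0]) auto
    moreover have "a \<in> lsupp (hom_part z (pairing z a) ?P)" "b \<in> lsupp (hom_part z (pairing z b) ?P)"
      using ab by (auto simp: lsupp_hom_part)
    ultimately show False by auto
  qed
  moreover have "c \<in> lsupp (hom_part w (h + 1) p)" using c by (simp add: lsupp_hom_part)
  hence "hom_part w (h + 1) p \<noteq> 0" by auto
  ultimately have nz: "hom_part w (3 * h + 1) (lhess_det w z p) \<noteq> 0"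
    unfolding lhess_det_lowest(2)[OF p] by simp
  have "ordw w (lhess_det w z p) = 3 * h + 1"
    using lhess_det_lowest(1)[OF p] nz by (rule ordw_eqI)
  moreover have "lhess_det w z p \<noteq> 0" using nz by (auto simp: hom_part_def)
  ultimately show ?thesis by (simp add: lhess_det_unimodular[OF ab(1)] h_def)
qed

lemma prime_power_unique:
  fixes x :: laurent
  assumes "prime_elem x" "x ^ a * r = x ^ b * s" "\<not> x dvd r" "\<not> x dvd s"
  shows "a = b"
proof -
  have *: "\<not> a < b" if "x ^ a * r = x ^ b * s" "\<not> x dvd r" for a b r s
  proof
    assume "a < b"
    hence "x ^ b = x ^ a * (x * x ^ (b - a - 1))"
      by (metis Suc_diff_Suc le_add_diff_inverse less_imp_le power_Suc power_add diff_Suc_1 Suc_diff_1 zero_less_diff)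
    hence "x ^ a * r = x ^ a * (x * (x ^ (b - a - 1) * s))" using that(1) by (simp add: mult_ac)
    hence "r = x * (x ^ (b - a - 1) * s)" using assms(1) by (simp add: prime_elem_not_zeroI)
    thus False using that(2) by simp
  qed
  show ?thesis using *[OF assms(2,3)] *[OF assms(2)[symmetric] assms(4)] by simp
qed

lemma of_nat_Suc_dvd_cancel: "d dvd of_nat (Suc n) * (x :: laurent) \<Longrightarrow> d dvd x"
  using of_int_dvd_cancel[of "int (Suc n)" d x] by simp

text \<open>Modulo x the cofactor reduces to a nonzero integer times the Hessian determinant of x
  times q^3.\<close>

lemma planar_prime_multiplicity:
  assumes x: "prime_elem x" "planar x" and q: "\<not> x dvd q"
  shows "\<exists>r. hessian (x ^ Suc n * q) = x ^ (3 * n) * r \<and> \<not> x dvd r"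
proof -
  define m where "m = (of_nat (Suc n) :: laurent)"
  define r where "r = m\<^sup>2 * hessian x * q ^ 3 + m * x * q * lhess_mixed (axis 1 1) (axis 2 1) x q
      + x ^ 3 * hessian q"
  have nz: "x \<noteq> 0" "q \<noteq> 0" using x q by (auto simp: prime_elem_not_zeroI)
  have "hessian (x ^ Suc n * q) = x ^ (3 * n) * r"
    unfolding r_def m_def by (rule lhess_det_power_mult[OF nz])
  moreover have "\<not> x dvd r"
  proof
    assume "x dvd r"
    moreover have "r = m * (m * (hessian x * q ^ 3)) + x * (m * q * lhess_mixed (axis 1 1) (axis 2 1) x q
      + x\<^sup>2 * hessian q)"
      by (simp add: r_def power2_eq_square power3_eq_cube algebra_simps)
    ultimately have "x dvd m * (m * (hessian x * q ^ 3))"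
      by (metis dvd_add_left_iff dvd_triv_left)
    hence "x dvd hessian x * q ^ 3" unfolding m_def by (blast dest: of_nat_Suc_dvd_cancel)
    hence "x dvd hessian x \<or> x dvd q"
      using x(1) prime_elem_dvd_multD prime_elem_dvd_power by blast
    thus False using planar_prime_not_dvd_lhess_det[OF x] q by blast
  qed
  ultimately show ?thesis by blast
qed

lemma homog_pair_unit:
  assumes "x \<noteq> 0" "cross w z \<noteq> 0" "homog w h x" "homog z k x"
  shows "x dvd 1"
proof -
  obtain a where a: "a \<in> lsupp x" using assms(1) by (metis ex_in_conv lsupp_empty_iff)
  have "b = a" if "b \<in> lsupp x" for b
  proof -
    have "b - a = 0" using assms(3,4) a that
      by (intro pairings_0[OF assms(2)]) (auto simp: homog_def)
    thus ?thesis by simp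
  qed
  hence "x = lmonom (lcoeff x a) a"
    by (intro lcoeff_ext) (auto simp: lcoeff_lmonom lsupp_iff)
  thus ?thesis using a lmonom_dvd_1[of "lcoeff x a" a] by (simp add: lsupp_iff)
qed

text \<open>A homogeneous factor divides every w-part of p. The lowest part is thus not a monomial
  and contains two exponents.\<close>

lemma homog_factor_edge_normal:
  assumes x: "\<not> x dvd 1" "homog w h x" "x dvd p" "p \<noteq> 0" "cross w z = 1"
  shows "edge_normal p w"
proof -
  let ?f = "hom_part w (ordw w p) p"
  have "x dvd ?f" using homog_dvd_hom_part[OF x(2,3)] .
  hence "\<not> ?f dvd 1" using x(1) dvd_trans by blast
  have "?f \<noteq> 0" using x(4) by (rule hom_part_ordw_nonzero)
  then obtain a where a: "a \<in> lsupp ?f" by (metis ex_in_conv lsupp_empty_iff)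
  have "\<exists>b\<in>lsupp ?f. b \<noteq> a"
  proof (rule ccontr)
    assume "\<not> ?thesis"
    hence "?f = lmonom (lcoeff ?f a) a"
      by (intro lcoeff_ext) (auto simp: lcoeff_lmonom lsupp_iff)
    hence "?f dvd 1" using a lmonom_dvd_1[of "lcoeff ?f a" a] by (simp add: lsupp_iff)
    thus False using \<open>\<not> ?f dvd 1\<close> by blast
  qed
  thus ?thesis using a x(5) unfolding edge_normal_def lsupp_hom_part by blast
qed

text \<open>The line carrying the support of y is not a level line of w, so each nonzero w-part of y
  is a monomial and hence not divisible by x. Positive width provides two of them.\<close>

lemma nonplanar_two_weights:
  assumes y: "prime_elem y" "\<not> planar y" and x: "\<not> x dvd (1 :: laurent)"
    and wy: "width w y \<noteq> 0"
  shows "\<exists>i j. i \<noteq> j \<and> \<not> x dvd hom_part w i y \<and> \<not> x dvd hom_part w j y"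
proof -
  have nz: "y \<noteq> 0" using y(1) by (simp add: prime_elem_not_zeroI)
  obtain v z k where v: "cross v z = 1" "homog v k y" using not_planar_homog[OF y(2)] by blast
  have "cross w v \<noteq> 0"
  proof
    assume 0: "cross w v = 0"
    obtain a where a: "a \<in> lsupp y" using nz by (metis ex_in_conv lsupp_empty_iff)
    have "pairing w b = pairing w a" if b: "b \<in> lsupp y" for b
    proof -
      let ?d = "b - a"
      have d: "pairing v ?d = 0" using v(2) a b by (simp add: homog_def)
      have "v $ 1 * pairing w ?d = w $ 1 * pairing v ?d - cross w v * ?d $ 2"
        "v $ 2 * pairing w ?d = w $ 2 * pairing v ?d + cross w v * ?d $ 1"
        by (simp_all add: cross_def pairing_def algebra_simps)
      hence "v $ 1 * pairing w ?d = 0" "v $ 2 * pairing w ?d = 0" using d 0 by simp_all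
      moreover have "v $ 1 \<noteq> 0 \<or> v $ 2 \<noteq> 0" using v(1) by (auto simp: cross_def)
      ultimately have "pairing w ?d = 0" by auto
      thus ?thesis by simp
    qed
    thus False using wy width_0_iff[OF nz] by (auto simp: homog_def)
  qed
  have not_dvd: "\<not> x dvd hom_part w i y" if "hom_part w i y \<noteq> 0" for i
  proof -
    have "homog v k (hom_part w i y)" using v(2) by (auto simp: homog_def lsupp_hom_part)
    hence "hom_part w i y dvd 1"
      using that \<open>cross w v \<noteq> 0\<close> by (intro homog_pair_unit[of _ w v i k]) auto
    thus ?thesis using x dvd_trans by blast
  qed
  let ?i = "ordw w y" and ?j = "- ordw (- w) y"
  have "hom_part w ?i y \<noteq> 0" using nz by (rule hom_part_ordw_nonzero)
  moreover have "hom_part w ?j y \<noteq> 0"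
  proof -
    obtain a where "a \<in> lsupp y" "pairing (- w) a = ordw (- w) y"
      using ordw_attained[OF nz] by blast
    hence "a \<in> lsupp (hom_part w ?j y)" by (simp add: lsupp_hom_part)
    thus ?thesis by auto
  qed
  moreover have "?i \<noteq> ?j" using wy by (simp add: width_def)
  ultimately show ?thesis using not_dvd by blast
qed

text \<open>
  If \<open>x\<close> divided \<open>lhess w w q\<close>, then modulo \<open>x\<close> only one \<open>w\<close>-homogeneous part of \<open>q\<close> would survive, so
  every prime factor of \<open>p\<close> of positive \<open>w\<close>-width would be planar and the \<open>w\<close>-width of the Hessian
  determinant would be divisible by 3; but that width is \<open>3 * width w p - 2\<close>.
\<close>

lemma homog_prime_not_dvd_lhess:
  assumes p: "planar p" "edge_regular p" and N: "hessian p dvd p ^ N"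
    and x: "prime_elem x" "homog w h x" "cross w z = 1" and pq: "p = x ^ Suc n * q" "\<not> x dvd q"
  shows "\<not> x dvd lhess w w q"
proof
  assume dvd: "x dvd lhess w w q"
  have nz: "p \<noteq> 0" "x \<noteq> 0" using p(1) x(1) by (auto simp: planar_def prime_elem_not_zeroI)
  have xu: "\<not> x dvd 1" using x(1) by (simp add: prime_elem_not_unit)
  have xp: "x dvd p" by (simp add: pq(1))
  have "edge_normal p w" by (rule homog_factor_edge_normal[OF xu x(2) xp nz(1) x(3)])
  hence o1: "hessian p \<noteq> 0" "ordw w (hessian p) = 3 * ordw w p + 1"
    using ordw_hessian p(2) by blast+
  \<comment> \<open>The opposite side of the polygon is an edge as well; the two contributions of 1
    produce the -2 in the width.\<close>
  have "homog (- w) (- h) x" "cross (- w) (- z) = 1"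
    using x(2,3) by (auto simp: homog_def cross_def)
  hence "edge_normal p (- w)" using homog_factor_edge_normal[OF xu _ xp nz(1)] by blast
  hence "ordw (- w) (hessian p) = 3 * ordw (- w) p + 1"
    using ordw_hessian p(2) by blast
  hence width: "width w (hessian p) = 3 * width w p - 2" using o1 by (simp add: width_def)
  have "3 dvd width w (hessian p)"
  proof (rule dvd_width[OF o1(1)])
    fix y k r assume y: "prime_elem y" "hessian p = y ^ k * r" "\<not> y dvd r"
    show "3 dvd int k * width w y"
    proof (cases "k = 0 \<or> width w y = 0")
      case False
      have "y dvd hessian p" using False by (simp add: y(2))
      hence yp: "y dvd p" using N y(1) dvd_trans prime_elem_dvd_power by blast
      have ynz: "y \<noteq> 0" using y(1) by (simp add: prime_elem_not_zeroI)
      have "\<not> y dvd x"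
      proof
        assume "y dvd x"
        then obtain c where c: "x = y * c" by blast
        hence "width w x = width w y + width w c" "c \<noteq> 0" using nz by (auto simp: width_mult)
        moreover have "width w x = 0" using width_0_iff[OF nz(2)] x(2) by blast
        ultimately show False using False width_nonneg[of y w] width_nonneg[of c w] ynz by simp
      qed
      hence "\<not> y dvd x ^ Suc n" using y(1) prime_elem_dvd_power by blast
      hence "y dvd q" using yp pq(1) prime_elem_dvd_multD[OF y(1)] by blast
      then obtain q2 where q2: "q = y * q2" by blast
      have "planar y"
      proof (rule ccontr)
        assume "\<not> planar y"
        then obtain i j where "i \<noteq> j" "\<not> x dvd hom_part w i y" "\<not> x dvd hom_part w j y"
          using nonplanar_two_weights[OF y(1) _ xu, of w] False by blast
        moreover have "\<not> x dvd q2" using pq(2) q2 by auto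
        ultimately obtain i j where "i \<noteq> j" "\<not> x dvd hom_part w i q" "\<not> x dvd hom_part w j q"
          using two_weights_mult[OF x(1,2), of i y j q2] q2 by blast
        thus False using dvd_lhess_imp[OF _ x(2) dvd] prime_elem_dvd_multD[OF x(1)] by blast
      qed
      obtain l s where ls: "p = y ^ l * s" "\<not> y dvd s" using prime_multiplicity[OF nz(1) y(1)] by blast
      hence "l \<noteq> 0" using yp by (cases l) auto
      then obtain l' where l': "l = Suc l'" by (cases l) auto
      obtain r' where "hessian p = y ^ (3 * l') * r'" "\<not> y dvd r'"
        using planar_prime_multiplicity[OF y(1) \<open>planar y\<close> ls(2)] unfolding ls(1) l' by blast
      hence "k = 3 * l'" using y prime_power_unique by metis
      thus ?thesis by simp
    qed auto
  qed
  thus False unfolding width by presburger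
qed

text \<open>For homogeneous x the entries \<open>lhess w w x\<close> and \<open>lhess w z x\<close>
  vanish. So the determinant of x vanishes too, which costs one more factor x, and the mixed term
  keeps only \<open>lhess z z x * lhess w w q\<close>.\<close>

lemma nonplanar_prime_multiplicity:
  assumes p: "planar p" "edge_regular p" and N: "hessian p dvd p ^ N"
    and x: "prime_elem x" "\<not> planar x" and pq: "p = x ^ Suc n * q" "\<not> x dvd q"
  shows "\<exists>r. hessian p = x ^ (3 * n + 1) * r \<and> \<not> x dvd r"
proof -
  obtain w z h where w: "cross w z = 1" "homog w h x" using not_planar_homog[OF x(2)] by blast
  have nz: "x \<noteq> 0" "q \<noteq> 0" using x pq by (auto simp: prime_elem_not_zeroI)
  define m where "m = (of_nat (Suc n) :: laurent)"
  define r where "r = m * (q * (lhess z z x * lhess w w q)) + x * (x * lhess_det w z q)"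
  have E: "Eul w x = of_int h * x" using w(2) by (rule homog_Eul)
  have Ezz: "Eul w (Eul z x) = of_int h * Eul z x"
    using homog_Eul[OF homog_Eul_closed[OF w(2)]] .
  have L: "lhess w w x = 0" "lhess w z x = 0"
    by (simp_all add: lhess_def E Ezz Eul_of_int_mult)
  have "x * lhess_det w z x = 0" unfolding lhess_det_eq by (simp add: L)
  hence D: "lhess_det w z x = 0" using nz by simp
  have "hessian p = lhess_det w z p" using lhess_det_unimodular[OF w(1)] by simp
  also have "\<dots> = x ^ (3 * n) * (x * r)"
    unfolding pq(1) lhess_det_power_mult[OF nz] lhess_mixed_def L D r_def m_def
    by (simp add: power3_eq_cube algebra_simps)
  finally have "hessian p = x ^ (3 * n + 1) * r" by (simp add: mult_ac)
  moreover have "\<not> x dvd r"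
  proof
    assume "x dvd r"
    hence "x dvd m * (q * (lhess z z x * lhess w w q))"
      unfolding r_def by (metis dvd_add_left_iff dvd_triv_left)
    hence "x dvd q * (lhess z z x * lhess w w q)" unfolding m_def by (rule of_nat_Suc_dvd_cancel)
    hence "x dvd lhess z z x"
      using pq(2) homog_prime_not_dvd_lhess[OF p N x(1) w(2,1) pq] prime_elem_dvd_multD[OF x(1)]
      by blast
    \<comment> \<open>Modulo x, \<open>lhess z z x\<close> is minus the square of
      \<open>Eul z x\<close>; divisibility would make x homogeneous for z as well, that is, a
      unit.\<close>
    hence "x dvd x * Eul z (Eul z x) - lhess z z x" by simp
    hence "x dvd Eul z x * Eul z x" by (simp add: lhess_def)
    hence "x dvd Eul z x" using prime_elem_dvd_multD[OF x(1)] by blast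
    then obtain k where "homog z k x" using not_dvd_Eul[OF nz(1)] by blast
    hence "x dvd 1" using homog_pair_unit[of x w z h k] nz(1) w by simp
    thus False using x(1) by (simp add: prime_elem_not_unit)
  qed
  ultimately show ?thesis by blast
qed

text \<open>The prime x has exponent 3n + 3 in p^3 and 3n or 3n + 1 in the determinant, which leaves
  3 or 2 for Q.\<close>

lemma hessian_quotient:
  assumes p: "planar p" "edge_regular p" and N: "hessian p dvd p ^ N"
  obtains Q where "p ^ 3 = hessian p * Q"
    "\<And>x. prime_elem x \<Longrightarrow> x dvd p \<Longrightarrow> x\<^sup>2 dvd Q"
    "\<And>x. prime_elem x \<Longrightarrow> x dvd p \<Longrightarrow> planar x \<Longrightarrow> x ^ 3 dvd Q"
proof -
  have nz: "p \<noteq> 0" using p(1) by (auto simp: planar_def)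
  have mult: "\<exists>n q j r. p = x ^ Suc n * q \<and> \<not> x dvd q \<and> hessian p = x ^ j * r \<and> \<not> x dvd r \<and>
      j = (if planar x then 3 * n else 3 * n + 1)"
    if x: "prime_elem x" "x dvd p" for x
  proof -
    obtain l q where l: "p = x ^ l * q" "\<not> x dvd q" using prime_multiplicity[OF nz x(1)] by blast
    hence "l \<noteq> 0" using x(2) by (cases l) auto
    then obtain n where n: "l = Suc n" by (cases l) auto
    show ?thesis
    proof (cases "planar x")
      case True
      thus ?thesis using planar_prime_multiplicity[OF x(1) True l(2), of n] l unfolding n by auto
    next
      case False
      thus ?thesis
        using nonplanar_prime_multiplicity[OF p N x(1) False l(1)[unfolded n] l(2)] l unfolding n
        by auto
    qed
  qed
  have "hessian p \<noteq> 0" using N nz by auto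
  hence "hessian p dvd p ^ 3"
  proof (rule dvd_by_prime_powers)
    fix x k assume x: "prime_elem x" "x ^ k dvd hessian p"
    show "x ^ k dvd p ^ 3"
    proof (cases "k = 0")
      case False
      hence "x dvd p ^ N" using x(2) N by (meson dvd_power dvd_trans gr0I)
      hence "x dvd p" using x(1) prime_elem_dvd_power by blast
      then obtain n q j r where m: "p = x ^ Suc n * q" "hessian p = x ^ j * r" "\<not> x dvd r"
        "j = (if planar x then 3 * n else 3 * n + 1)"
        using mult x(1) by metis
      have "x ^ k dvd r * x ^ j" using x(2) m(2) by (simp add: mult.commute)
      hence "x ^ k dvd x ^ j" using prime_power_coprime_dvd x(1) m(3) by blast
      also have "x ^ j dvd x ^ (3 * Suc n)" using m(4) by (intro le_imp_power_dvd) auto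
      also have "x ^ (3 * Suc n) dvd p ^ 3"
        unfolding m(1) power_mult_distrib power_mult[symmetric] by (simp add: mult.commute)
      finally show ?thesis .
    qed simp
  qed
  then obtain Q where Q: "p ^ 3 = hessian p * Q" by blast
  have key: "x ^ i dvd Q" if x: "prime_elem x" "x dvd p" and i: "i \<le> (if planar x then 3 else 2)" for x i
  proof -
    obtain n q j r where m: "p = x ^ Suc n * q" "hessian p = x ^ j * r" "\<not> x dvd r"
        "j = (if planar x then 3 * n else 3 * n + 1)"
      using mult x by metis
    have "x ^ (j + i) dvd x ^ (3 * Suc n)" using m(4) i by (intro le_imp_power_dvd) (auto split: if_splits)
    also have "x ^ (3 * Suc n) dvd p ^ 3"
      unfolding m(1) power_mult_distrib power_mult[symmetric] by (simp add: mult.commute)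
    finally have "x ^ j * x ^ i dvd x ^ j * (r * Q)"
      unfolding Q m(2) power_add by (simp add: mult.assoc)
    moreover have "x ^ j \<noteq> 0" using x(1) by (simp add: prime_elem_not_zeroI)
    ultimately have "x ^ i dvd r * Q" by (simp only: dvd_mult_cancel_left) simp
    thus ?thesis using prime_power_coprime_dvd x(1) m(3) by blast
  qed
  show ?thesis using that[OF Q] key[of _ 2] key[of _ 3] by auto
qed

section \<open>Classification\<close>

lemma lmonom_if_unique_supp:
  assumes "t \<noteq> 0" "\<And>c. c \<in> lsupp t \<Longrightarrow> c = e"
  shows "t dvd 1"
proof -
  obtain a where a: "a \<in> lsupp t" using assms(1) by (metis ex_in_conv lsupp_empty_iff)
  hence "e = a" using assms(2) by simp
  hence "t = lmonom (lcoeff t a) a"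
    using assms(2) by (intro lcoeff_ext) (auto simp: lcoeff_lmonom lsupp_iff)
  thus ?thesis using a lmonom_dvd_1[of "lcoeff t a" a] by (simp add: lsupp_iff)
qed

lemma prime_two_supp:
  assumes "prime_elem x"
  obtains a b where "a \<in> lsupp x" "b \<in> lsupp x" "a \<noteq> b"
proof -
  have "x \<noteq> 0" "\<not> x dvd 1" using assms by (auto simp: prime_elem_not_zeroI prime_elem_not_unit)
  moreover obtain a where "a \<in> lsupp x" using \<open>x \<noteq> 0\<close> by (metis ex_in_conv lsupp_empty_iff)
  ultimately show ?thesis using lmonom_if_unique_supp[of x a] that by blast
qed

lemma prime_not_dvd_unit: "prime_elem (x :: laurent) \<Longrightarrow> u dvd 1 \<Longrightarrow> \<not> x dvd u"
  using dvd_trans prime_elem_not_unit by blast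

lemma classification:
  assumes p: "planar p" "edge_regular p" and N: "hessian p dvd p ^ N"
  shows "(\<exists>u x n a b c. u dvd 1 \<and> p = u * x ^ n \<and> n > 0 \<and> lsupp x = {a, b, c} \<and>
           cross (b - a) (c - a) \<noteq> 0) \<or>
    (\<exists>u x y m n a b c d. u dvd 1 \<and> p = u * x ^ m * y ^ n \<and> m > 0 \<and> n > 0 \<and>
       lsupp x = {a, b} \<and> lsupp y = {c, d} \<and> cross (b - a) (d - c) \<noteq> 0)"
proof -
  have nz: "p \<noteq> 0" using p(1) by (auto simp: planar_def)
  obtain Q where Q: "p ^ 3 = hessian p * Q"
    "\<And>x. prime_elem x \<Longrightarrow> x dvd p \<Longrightarrow> x\<^sup>2 dvd Q"
    "\<And>x. prime_elem x \<Longrightarrow> x dvd p \<Longrightarrow> planar x \<Longrightarrow> x ^ 3 dvd Q"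
    using hessian_quotient[OF p N] by blast
  have Qnz: "Q \<noteq> 0" using Q(1) nz by auto
  have ordQ: "ordw w Q = - 1" if "edge_normal p w" for w
  proof -
    have "hessian p \<noteq> 0" "ordw w (hessian p) = 3 * ordw w p + 1"
      using ordw_hessian[OF that p(2)] by auto
    moreover have "ordw w (p ^ 3) = ordw w (hessian p) + ordw w Q"
      unfolding Q(1) using \<open>hessian p \<noteq> 0\<close> Qnz by (rule ordw_mult)
    ultimately show ?thesis using nz by (simp add: ordw_power)
  qed
  \<comment> \<open>By integrality, weights above -1 are nonnegative, while a nonzero u is negative
    on some edge normal.\<close>
  have interior: "u = 0" if "\<And>w. edge_normal p w \<Longrightarrow> pairing w u > - 1" for u
  proof (rule ccontr)
    assume "u \<noteq> 0"
    then obtain w z a b where w: "cross w z = 1" "a \<in> lsupp p" "b \<in> lsupp p" "a \<noteq> b"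
      "pairing w a = ordw w p" "pairing w b = ordw w p" "pairing w u < 0"
      using exists_edge_normal[OF p(1)] by blast
    hence "edge_normal p w" unfolding edge_normal_def by blast
    thus False using that[of w] w(7) by simp
  qed
  have en_nz: "w \<noteq> 0" if "edge_normal p w" for w using that by (auto simp: edge_normal_def cross_def)
  have Q_dvd: "x dvd Q" if "prime_elem x" "x dvd p" for x
    using Q(2)[OF that] dvd_trans[of x "x\<^sup>2" Q] by (simp add: power2_eq_square)
  show ?thesis
  proof (cases "\<exists>x. prime_elem x \<and> x dvd p \<and> planar x")
    case True
    then obtain x where x: "prime_elem x" "x dvd p" "planar x" by blast
    have xnz: "x \<noteq> 0" using x(1) by (simp add: prime_elem_not_zeroI)
    obtain t where t: "Q = x ^ 3 * t" using Q(3)[OF x] by blast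
    have tnz: "t \<noteq> 0" using t Qnz by auto
    \<comment> \<open>Minimal weights would add up to -1. Three non-collinear points cannot all be
      minimal, so the sum is strictly larger.\<close>
    have sum0: "a + b + c + e = 0"
      if "a \<in> lsupp x" "b \<in> lsupp x" "c \<in> lsupp x" "e \<in> lsupp t" "cross (b - a) (c - a) \<noteq> 0"
      for a b c e
    proof (rule interior)
      fix w assume w: "edge_normal p w"
      have "3 * ordw w x + ordw w t = - 1"
        using ordQ[OF w] xnz tnz by (simp add: t ordw_mult ordw_power)
      moreover have "\<not> (pairing w a = ordw w x \<and> pairing w b = ordw w x \<and> pairing w c = ordw w x)"
        using cross_pairing_0[OF that(5), of w] en_nz[OF w] by auto
      ultimately show "pairing w (a + b + c + e) > - 1"
        using ordw_le[OF that(1), of w] ordw_le[OF that(2), of w] ordw_le[OF that(3), of w]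
          ordw_le[OF that(4), of w] by simp linarith
    qed
    obtain a b c where abc: "a \<in> lsupp x" "b \<in> lsupp x" "c \<in> lsupp x" "cross (b - a) (c - a) \<noteq> 0"
      using x(3) by (auto simp: planar_def)
    obtain e where e: "e \<in> lsupp t" using tnz by (metis ex_in_conv lsupp_empty_iff)
    have "e' = - (a + b + c)" if "e' \<in> lsupp t" for e'
      using sum0[OF abc(1-3) that abc(4)] by (simp add: lattice_eq_iff)
    hence tu: "t dvd 1" by (rule lmonom_if_unique_supp[OF tnz])
    have supp: "lsupp x = {a, b, c}"
    proof (intro equalityI subsetI)
      fix d assume d: "d \<in> lsupp x"
      \<comment> \<open>If d can replace b or c in the non-collinear triple, the unchanged sum makes
        it equal to the point replaced. Otherwise d - a is parallel to two independent vectors, and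
        d = a.\<close>
      consider "cross (b - a) (d - a) \<noteq> 0" | "cross (d - a) (c - a) \<noteq> 0"
        | "cross (b - a) (d - a) = 0" "cross (d - a) (c - a) = 0" by blast
      thus "d \<in> {a, b, c}"
      proof cases
        case 1
        from sum0[OF abc(1,2) d e 1] sum0[OF abc(1-3) e abc(4)] have "d = c"
          by (simp add: lattice_eq_iff)
        thus ?thesis by simp
      next
        case 2
        from sum0[OF abc(1) d abc(3) e 2] sum0[OF abc(1-3) e abc(4)] have "d = b"
          by (simp add: lattice_eq_iff)
        thus ?thesis by simp
      next
        case 3
        define v where "v = d - a"
        have "v $ 1 * cross (b - a) (c - a) = 0" "v $ 2 * cross (b - a) (c - a) = 0"
        proof -
          have "v $ i * cross (b - a) (c - a) =
              (c - a) $ i * cross (b - a) v + (b - a) $ i * cross v (c - a)" for i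
            using exhaust_2[of i] by (auto simp: cross_def algebra_simps)
          thus "v $ 1 * cross (b - a) (c - a) = 0" "v $ 2 * cross (b - a) (c - a) = 0"
            using 3 by (simp_all add: v_def)
        qed
        hence "v = 0" using abc(4) by (simp add: lattice_eq_iff)
        thus ?thesis by (simp add: v_def)
      qed
    qed (use abc in auto)
    obtain n q where n: "p = x ^ n * q" "\<not> x dvd q" using prime_multiplicity[OF nz x(1)] by blast
    have qu: "q dvd 1"
    proof (rule ccontr)
      assume "\<not> q dvd 1"
      moreover have "q \<noteq> 0" using n nz by auto
      ultimately obtain y where y: "prime_elem y" "y dvd q" using prime_divisor by blast
      hence "y dvd x ^ 3 * t" using Q_dvd[of y] n(1) t by auto
      hence "y dvd x" using y(1) prime_not_dvd_unit[OF y(1) tu] prime_elem_dvd_multD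
        prime_elem_dvd_power by blast
      hence "x dvd y" by (rule prime_dvd_prime_sym[OF y(1) x(1)])
      thus False using n(2) y(2) dvd_trans by blast
    qed
    have "n > 0" using n x(2) by (cases n) auto
    moreover have "p = q * x ^ n" using n(1) by (simp add: mult.commute)
    ultimately have "q dvd 1 \<and> p = q * x ^ n \<and> n > 0 \<and> lsupp x = {a, b, c} \<and>
        cross (b - a) (c - a) \<noteq> 0" using qu supp abc(4) by simp
    thus ?thesis by (intro disjI1 exI)
  next
    case False
    have "\<exists>x. prime_elem x \<and> x dvd p"
    proof -
      have "\<not> p dvd 1"
      proof
        assume "p dvd 1"
        then obtain c a where "p = lmonom c a" using unit_imp_lmonom by blast
        hence "lsupp p \<subseteq> {a}" by (cases "c = 0") (auto simp: lsupp_lmonom)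
        moreover obtain d e f where "d \<in> lsupp p" "e \<in> lsupp p" "f \<in> lsupp p"
          "cross (e - d) (f - d) \<noteq> 0" using p(1) unfolding planar_def by blast
        ultimately have "cross (a - a) (a - a) \<noteq> 0" by blast
        thus False by (simp add: cross_def)
      qed
      thus ?thesis using prime_divisor[OF nz] by blast
    qed
    then obtain x where x: "prime_elem x" "x dvd p" by blast
    then obtain w1 z1 h1 where w1: "cross w1 z1 = 1" "homog w1 h1 x"
      using False not_planar_homog by blast
    have w1nz: "w1 \<noteq> 0" using w1 by (auto simp: cross_def)
    \<comment> \<open>If all prime factors had width 0 in direction \<open>w1\<close>, so would p,
      contrary to its two-dimensional support.\<close>
    have "\<exists>y. prime_elem y \<and> y dvd p \<and> width w1 y \<noteq> 0"
    proof (rule ccontr)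
      assume *: "\<not> ?thesis"
      have "0 dvd width w1 p"
      proof (rule dvd_width[OF nz])
        fix y n q assume "prime_elem y" "p = y ^ n * q"
        thus "0 dvd int n * width w1 y" using * by (cases n) auto
      qed
      hence "\<exists>h. homog w1 h p" using width_0_iff[OF nz] by simp
      thus False using planar_not_homog[OF p(1) w1nz] by blast
    qed
    then obtain y where y: "prime_elem y" "y dvd p" "width w1 y \<noteq> 0" by blast
    then obtain w2 z2 h2 where w2: "cross w2 z2 = 1" "homog w2 h2 y"
      using False not_planar_homog by blast
    have xynz: "x \<noteq> 0" "y \<noteq> 0" using x y by (auto simp: prime_elem_not_zeroI)
    have wx: "width w1 x = 0" using width_0_iff[OF xynz(1)] w1(2) by blast
    have yx: "\<not> y dvd x"
    proof
      assume "y dvd x"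
      then obtain c where c: "x = y * c" by blast
      hence "width w1 x = width w1 y + width w1 c" "c \<noteq> 0" using xynz by (auto simp: width_mult)
      thus False using wx y(3) width_nonneg[of y w1] width_nonneg[of c w1] xynz by simp
    qed
    hence xy: "\<not> x dvd y" using prime_dvd_prime_sym[OF x(1) y(1)] by blast
    \<comment> \<open>Parallel supports would make y homogeneous for \<open>w1\<close>,
      contradicting its positive width.\<close>
    have indep: "cross (b - a) (d - c) \<noteq> 0"
      if ab: "a \<in> lsupp x" "b \<in> lsupp x" "a \<noteq> b" and cd: "c \<in> lsupp y" "d \<in> lsupp y" "c \<noteq> d"
      for a b c d
    proof
      assume 0: "cross (b - a) (d - c) = 0"
      have wab: "pairing w1 (b - a) = 0" and wcd: "pairing w2 (d - c) = 0"
        using ab cd w1(2) w2(2) by (auto simp: homog_def)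
      have "pairing w1 (d - c) = 0"
      proof -
        let ?v = "b - a" and ?e = "d - c"
        have "?v $ i * pairing w1 ?e = ?e $ i * pairing w1 ?v
            + (if i = 1 then w1 $ 2 else - w1 $ 1) * cross ?v ?e" for i
          using exhaust_2[of i] by (auto simp: cross_def pairing_def algebra_simps)
        hence "?v $ i * pairing w1 ?e = 0" for i using wab 0 by simp
        moreover have "?v $ 1 \<noteq> 0 \<or> ?v $ 2 \<noteq> 0" using ab(3) by (auto simp: lattice_eq_iff)
        ultimately show ?thesis by (metis mult_eq_0_iff)
      qed
      have "cross w1 w2 = 0"
      proof (rule ccontr)
        assume "cross w1 w2 \<noteq> 0"
        hence "d - c = 0" using \<open>pairing w1 (d - c) = 0\<close> wcd by (rule pairings_0)
        thus False using cd(3) by simp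
      qed
      have "homog w1 (pairing w1 c) y"
        unfolding homog_def
      proof
        fix e assume "e \<in> lsupp y"
        let ?e = "e - c"
        have "pairing w2 ?e = 0" using w2(2) \<open>e \<in> lsupp y\<close> cd(1) by (simp add: homog_def)
        moreover have "w2 $ i * pairing w1 ?e = w1 $ i * pairing w2 ?e
            + (if i = 1 then - ?e $ 2 else ?e $ 1) * cross w1 w2" for i
          using exhaust_2[of i] by (auto simp: cross_def pairing_def algebra_simps)
        ultimately have "w2 $ i * pairing w1 ?e = 0" for i using \<open>cross w1 w2 = 0\<close> by simp
        moreover have "w2 $ 1 \<noteq> 0 \<or> w2 $ 2 \<noteq> 0" using w2(1) by (auto simp: cross_def)
        ultimately have "pairing w1 ?e = 0" by (metis mult_eq_0_iff)
        thus "pairing w1 e = pairing w1 c" by simp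
      qed
      thus False using y(3) width_0_iff[OF xynz(2)] by blast
    qed
    obtain s where s: "Q = x\<^sup>2 * s" using Q(2)[OF x] by blast
    have "\<not> y dvd x\<^sup>2" using yx y(1) prime_elem_dvd_power by blast
    moreover have "y\<^sup>2 dvd x\<^sup>2 * s" using Q(2)[OF y(1,2)] s by simp
    ultimately have "y\<^sup>2 dvd s" using prime_power_coprime_dvd[OF y(1)] by blast
    then obtain t where "s = y\<^sup>2 * t" by (rule dvdE)
    hence t: "Q = x\<^sup>2 * y\<^sup>2 * t" using s by (simp add: mult.assoc)
    have tnz: "t \<noteq> 0" using t Qnz by auto
    \<comment> \<open>Two points of each factor replace the triple: they cannot all be minimal, as
      their difference vectors are independent.\<close>
    have sum0: "a + b + c + d + e = 0"
      if ab: "a \<in> lsupp x" "b \<in> lsupp x" "a \<noteq> b" and cd: "c \<in> lsupp y" "d \<in> lsupp y" "c \<noteq> d"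
        and e: "e \<in> lsupp t" for a b c d e
    proof (rule interior)
      fix w assume w: "edge_normal p w"
      have "2 * ordw w x + 2 * ordw w y + ordw w t = - 1"
        using ordQ[OF w] xynz tnz by (simp add: t ordw_mult ordw_power)
      moreover have "\<not> (pairing w a = ordw w x \<and> pairing w b = ordw w x \<and>
          pairing w c = ordw w y \<and> pairing w d = ordw w y)"
        using cross_pairing_0[OF indep[OF ab cd], of w] en_nz[OF w] by auto
      ultimately show "pairing w (a + b + c + d + e) > - 1"
        using ordw_le[OF ab(1), of w] ordw_le[OF ab(2), of w] ordw_le[OF cd(1), of w]
          ordw_le[OF cd(2), of w] ordw_le[OF e, of w] by simp linarith
    qed
    obtain a b where ab: "a \<in> lsupp x" "b \<in> lsupp x" "a \<noteq> b" using x(1) by (rule prime_two_supp)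
    obtain c d where cd: "c \<in> lsupp y" "d \<in> lsupp y" "c \<noteq> d" using y(1) by (rule prime_two_supp)
    obtain e where e: "e \<in> lsupp t" using tnz by (metis ex_in_conv lsupp_empty_iff)
    have "e' = - (a + b + c + d)" if "e' \<in> lsupp t" for e'
      using sum0[OF ab cd that] by (simp add: lattice_eq_iff)
    hence tu: "t dvd 1" by (rule lmonom_if_unique_supp[OF tnz])
    have suppx: "lsupp x = {a, b}"
    proof (intro equalityI subsetI)
      fix b' assume b': "b' \<in> lsupp x"
      have "b' = b" if "b' \<noteq> a"
        using sum0[OF ab(1) b' that[symmetric] cd e] sum0[OF ab cd e] by (simp add: lattice_eq_iff)
      thus "b' \<in> {a, b}" by blast
    qed (use ab in auto)
    have suppy: "lsupp y = {c, d}"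
    proof (intro equalityI subsetI)
      fix d' assume d': "d' \<in> lsupp y"
      have "d' = d" if "d' \<noteq> c"
        using sum0[OF ab cd(1) d' that[symmetric] e] sum0[OF ab cd e] by (simp add: lattice_eq_iff)
      thus "d' \<in> {c, d}" by blast
    qed (use cd in auto)
    obtain m q where m: "p = x ^ m * q" "\<not> x dvd q" using prime_multiplicity[OF nz x(1)] by blast
    have qnz: "q \<noteq> 0" using m nz by auto
    obtain n r where n: "q = y ^ n * r" "\<not> y dvd r" using prime_multiplicity[OF qnz y(1)] by blast
    have ru: "r dvd 1"
    proof (rule ccontr)
      assume "\<not> r dvd 1"
      moreover have "r \<noteq> 0" using n qnz by auto
      ultimately obtain v where v: "prime_elem v" "v dvd r" using prime_divisor by blast
      hence "v dvd x\<^sup>2 * y\<^sup>2 * t" using Q_dvd[of v] m(1) n(1) t by auto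
      hence "v dvd x \<or> v dvd y" using v(1) prime_not_dvd_unit[OF v(1) tu] prime_elem_dvd_multD
        prime_elem_dvd_power by blast
      hence "x dvd v \<or> y dvd v" using prime_dvd_prime_sym v(1) x(1) y(1) by blast
      hence "x dvd r \<or> y dvd r" using v(2) dvd_trans by blast
      thus False using n m(2) by auto
    qed
    have "m > 0" using m x(2) by (cases m) auto
    moreover have "n > 0"
    proof (rule ccontr)
      assume "\<not> n > 0"
      hence "p = x ^ m * r" using m(1) n(1) by simp
      hence "y dvd x ^ m * r" using y(2) by simp
      thus False using yx prime_not_dvd_unit[OF y(1) ru] prime_elem_dvd_multD[OF y(1)]
        prime_elem_dvd_power[OF y(1)] by blast
    qed
    moreover have "p = r * x ^ m * y ^ n" using m(1) n(1) by (simp add: mult_ac)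
    ultimately have "r dvd 1 \<and> p = r * x ^ m * y ^ n \<and> m > 0 \<and> n > 0 \<and>
        lsupp x = {a, b} \<and> lsupp y = {c, d} \<and> cross (b - a) (d - c) \<noteq> 0"
      using ru suppx suppy indep[OF ab cd] by simp
    thus ?thesis by (intro disjI2 exI)
  qed
qed

section \<open>Monomial changes of coordinates\<close>

lemma monomial_change_superset:
  assumes "finite S" "lsupp p \<subseteq> S"
  shows "monomial_change g p = (\<Sum>a\<in>S. lmonom (lcoeff p a) (g *v a))"
  unfolding monomial_change_def
  by (rule sum.mono_neutral_left) (use assms in \<open>auto simp: lsupp_iff\<close>)

lemma monomial_change_add: "monomial_change g (p + q) = monomial_change g p + monomial_change g q"
proof -
  let ?S = "lsupp p \<union> lsupp q"
  have "finite ?S" by (simp add: finite_lsupp)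
  thus ?thesis
    using lsupp_add[of p q]
    by (simp add: monomial_change_superset[of ?S] lcoeff_add sum.distrib flip: lmonom_add)
qed

lemma monomial_change_0 [simp]: "monomial_change g 0 = 0"
  by (simp add: monomial_change_def)

lemma monomial_change_sum: "monomial_change g (sum f A) = (\<Sum>x\<in>A. monomial_change g (f x))"
  by (induction A rule: infinite_finite_induct) (auto simp: monomial_change_add)

lemma monomial_change_lmonom: "monomial_change g (lmonom c a) = lmonom c (g *v a)"
proof (cases "c = 0")
  case False
  thus ?thesis by (simp add: monomial_change_def lsupp_lmonom lcoeff_lmonom)
qed simp

lemma monomial_change_mult: "monomial_change g (p * q) = monomial_change g p * monomial_change g q"
proof -
  let ?f = "\<lambda>p a. lmonom (lcoeff p a) a"
  have mon: "monomial_change g (?f p a * ?f q b) =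
      lmonom (lcoeff p a) (g *v a) * lmonom (lcoeff q b) (g *v b)" for a b
    by (simp add: lmonom_mult monomial_change_lmonom matrix_vector_right_distrib)
  have "monomial_change g (p * q) =
      monomial_change g ((\<Sum>a\<in>lsupp p. ?f p a) * (\<Sum>b\<in>lsupp q. ?f q b))"
    using laurent_expand[of p] laurent_expand[of q] by simp
  also have "\<dots> = (\<Sum>a\<in>lsupp p. \<Sum>b\<in>lsupp q. monomial_change g (?f p a * ?f q b))"
    by (simp only: sum_product monomial_change_sum)
  also have "\<dots> = monomial_change g p * monomial_change g q"
    unfolding mon by (simp add: monomial_change_def sum_product)
  finally show ?thesis .
qed

lemma monomial_change_1: "monomial_change g 1 = 1"
  using monomial_change_lmonom[of g 1 0] by (simp add: lmonom_1)

lemma monomial_change_power: "monomial_change g (p ^ n) = monomial_change g p ^ n"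
  by (induction n) (simp_all add: monomial_change_1 monomial_change_mult)

definition basis_matrix :: "lattice \<Rightarrow> lattice \<Rightarrow> int ^ 2 ^ 2" where
  "basis_matrix a b = (\<chi> i j. if j = 1 then a $ i else b $ i)"

lemma basis_matrix_mult [simp]:
  "basis_matrix a b *v axis 1 1 = a" "basis_matrix a b *v axis 2 1 = b"
  by (simp_all add: basis_matrix_def matrix_vector_mult_def lattice_eq_iff sum_2)

lemma basis_matrix_invertible:
  assumes "\<bar>cross a b\<bar> = 1"
  shows "invertible (basis_matrix a b)"
proof -
  define d where "d = cross a b"
  have d: "d * d = 1" using assms by (auto simp: d_def abs_if split: if_splits)
  \<comment> \<open>The adjugate divided by the determinant d, written as a product because d = 1 or
    d = -1 is its own inverse.\<close>
  define B :: "int ^ 2 ^ 2" where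
    "B = (\<chi> i j. d * (if i = 1 then (if j = 1 then b $ 2 else - b $ 1)
                      else (if j = 1 then - a $ 2 else a $ 1)))"
  have d': "a $ 1 * b $ 2 - a $ 2 * b $ 1 = d" by (simp add: d_def cross_def)
  have "basis_matrix a b ** B = mat 1" "B ** basis_matrix a b = mat 1"
    unfolding vec_eq_iff forall_2
    by (simp_all add: basis_matrix_def B_def matrix_matrix_mult_def mat_def sum_2)
      (use d d' in \<open>algebra+\<close>)
  thus ?thesis unfolding invertible_def by blast
qed

section \<open>The normal forms\<close>

text \<open>Arbitrary exponents a, b keep this family stable under monomial changes.\<close>

definition ltrinomial :: "complex \<Rightarrow> complex \<Rightarrow> complex \<Rightarrow> lattice \<Rightarrow> lattice \<Rightarrow> laurent" where
  "ltrinomial \<alpha>0 \<alpha>1 \<alpha>2 a b = lmonom \<alpha>0 0 + lmonom \<alpha>1 a + lmonom \<alpha>2 b"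

definition lbinomial :: "complex \<Rightarrow> complex \<Rightarrow> lattice \<Rightarrow> laurent" where
  "lbinomial \<alpha>0 \<alpha>1 a = lmonom \<alpha>0 0 + lmonom \<alpha>1 a"

lemma monomial_change_trinomial:
  "monomial_change g (ltrinomial \<alpha>0 \<alpha>1 \<alpha>2 a b) = ltrinomial \<alpha>0 \<alpha>1 \<alpha>2 (g *v a) (g *v b)"
  by (simp add: ltrinomial_def monomial_change_add monomial_change_lmonom)

lemma monomial_change_binomial:
  "monomial_change g (lbinomial \<alpha>0 \<alpha>1 a) = lbinomial \<alpha>0 \<alpha>1 (g *v a)"
  by (simp add: lbinomial_def monomial_change_add monomial_change_lmonom)

lemma simplex_form_alt: "simplex_form q \<longleftrightarrow> (\<exists>\<alpha>0 \<alpha>1 \<alpha>2 m. \<alpha>0 \<noteq> 0 \<and> \<alpha>1 \<noteq> 0 \<and> \<alpha>2 \<noteq> 0 \<and> m > 0 \<and>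
    q = ltrinomial \<alpha>0 \<alpha>1 \<alpha>2 (axis 1 1) (axis 2 1) ^ m)"
  by (simp add: simplex_form_def ltrinomial_def)

lemma product_form_alt: "product_form q \<longleftrightarrow> (\<exists>\<alpha>0 \<alpha>1 \<beta>0 \<beta>1 r s. \<alpha>0 \<noteq> 0 \<and> \<alpha>1 \<noteq> 0 \<and> \<beta>0 \<noteq> 0 \<and> \<beta>1 \<noteq> 0 \<and>
    r > 0 \<and> s > 0 \<and> q = lbinomial \<alpha>0 \<alpha>1 (axis 1 1) ^ r * lbinomial \<beta>0 \<beta>1 (axis 2 1) ^ s)"
  by (simp add: product_form_def lbinomial_def)

lemma three_term:
  assumes "lsupp x = {a, b, c}" "a \<noteq> b" "a \<noteq> c" "b \<noteq> c"
  obtains \<alpha>0 \<alpha>1 \<alpha>2 where "\<alpha>0 \<noteq> 0" "\<alpha>1 \<noteq> 0" "\<alpha>2 \<noteq> 0"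
    "x = lmonom 1 a * ltrinomial \<alpha>0 \<alpha>1 \<alpha>2 (b - a) (c - a)"
proof -
  have "x = (\<Sum>e\<in>{a, b, c}. lmonom (lcoeff x e) e)" using laurent_expand[of x] assms(1) by simp
  also have "\<dots> = lmonom 1 a * ltrinomial (lcoeff x a) (lcoeff x b) (lcoeff x c) (b - a) (c - a)"
    using assms(2-4) by (simp add: ltrinomial_def distrib_left lmonom_mult add.assoc)
  finally have "x = lmonom 1 a * ltrinomial (lcoeff x a) (lcoeff x b) (lcoeff x c) (b - a) (c - a)" .
  moreover have "lcoeff x a \<noteq> 0" "lcoeff x b \<noteq> 0" "lcoeff x c \<noteq> 0"
    using assms(1) unfolding lsupp_def by auto
  ultimately show ?thesis using that by blast
qed

lemma two_term:
  assumes "lsupp x = {a, b}" "a \<noteq> b"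
  obtains \<alpha>0 \<alpha>1 where "\<alpha>0 \<noteq> 0" "\<alpha>1 \<noteq> 0" "x = lmonom 1 a * lbinomial \<alpha>0 \<alpha>1 (b - a)"
proof -
  have "x = (\<Sum>e\<in>{a, b}. lmonom (lcoeff x e) e)" using laurent_expand[of x] assms(1) by simp
  also have "\<dots> = lmonom 1 a * lbinomial (lcoeff x a) (lcoeff x b) (b - a)"
    using assms(2) by (simp add: lbinomial_def distrib_left lmonom_mult)
  finally have "x = lmonom 1 a * lbinomial (lcoeff x a) (lcoeff x b) (b - a)" .
  moreover have "lcoeff x a \<noteq> 0" "lcoeff x b \<noteq> 0"
    using assms(1) unfolding lsupp_def by auto
  ultimately show ?thesis using that by blast
qed

text \<open>The support lies in one coset of the lattice generated by a and b. This passes to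
  products and powers, hence from the binomial or trinomial factors to p.\<close>

definition supp_coset :: "lattice \<Rightarrow> lattice \<Rightarrow> laurent \<Rightarrow> bool" where
  "supp_coset a b p \<longleftrightarrow> (\<exists>s. \<forall>c\<in>lsupp p. \<exists>m n. c = s + m *s a + n *s b)"

lemma supp_coset_mult:
  assumes "supp_coset a b p" "supp_coset a b q"
  shows "supp_coset a b (p * q)"
proof -
  obtain s t where s: "\<And>c. c \<in> lsupp p \<Longrightarrow> \<exists>m n. c = s + m *s a + n *s b"
    and t: "\<And>c. c \<in> lsupp q \<Longrightarrow> \<exists>m n. c = t + m *s a + n *s b"
    using assms unfolding supp_coset_def by blast
  have "\<exists>m n. c = (s + t) + m *s a + n *s b" if "c \<in> lsupp (p * q)" for c
  proof -
    obtain d e where de: "c = d + e" "d \<in> lsupp p" "e \<in> lsupp q" using lsupp_mult \<open>c \<in> _\<close> by blast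
    obtain m n m' n' where "d = s + m *s a + n *s b" "e = t + m' *s a + n' *s b"
      using s[OF de(2)] t[OF de(3)] by blast
    hence "c = (s + t) + (m + m') *s a + (n + n') *s b"
      by (simp add: de(1) lattice_eq_iff algebra_simps)
    thus ?thesis by blast
  qed
  thus ?thesis unfolding supp_coset_def by blast
qed

lemma supp_coset_lmonom: "supp_coset a b (lmonom c d)"
proof -
  have "e = d + 0 *s a + 0 *s b" if "e \<in> lsupp (lmonom c d)" for e
    using that by (simp add: lsupp_iff lcoeff_lmonom split: if_splits)
  thus ?thesis unfolding supp_coset_def by blast
qed

lemma supp_coset_power: "supp_coset a b p \<Longrightarrow> supp_coset a b (p ^ n)"
  using supp_coset_lmonom[of a b 1 0]
  by (induction n) (simp_all add: lmonom_1 supp_coset_mult)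

lemma supp_coset_trinomial: "supp_coset a b (ltrinomial \<alpha>0 \<alpha>1 \<alpha>2 a b)"
proof -
  have *: "0 = 0 + 0 *s a + 0 *s b" "a = 0 + 1 *s a + 0 *s b" "b = 0 + 0 *s a + 1 *s b"
    by (simp_all add: lattice_eq_iff)
  have "lsupp (ltrinomial \<alpha>0 \<alpha>1 \<alpha>2 a b) \<subseteq> {0, a, b}"
    by (auto simp: ltrinomial_def lsupp_iff lcoeff_add lcoeff_lmonom split: if_splits)
  moreover have "\<forall>c\<in>{0, a, b}. \<exists>m n. c = 0 + m *s a + n *s b" using * by blast
  ultimately show ?thesis unfolding supp_coset_def by blast
qed

lemma supp_coset_binomial:
  "supp_coset a b (lbinomial \<alpha>0 \<alpha>1 a)" "supp_coset a b (lbinomial \<alpha>0 \<alpha>1 b)"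
  using supp_coset_trinomial[of a b \<alpha>0 \<alpha>1 0] supp_coset_trinomial[of a b \<alpha>0 0 \<alpha>1]
  by (simp_all add: lbinomial_def ltrinomial_def)

lemma unimodular_coset:
  assumes "planar p" "unimodular_support p" "supp_coset a b p"
  shows "\<bar>cross a b\<bar> = 1"
proof (rule unimodular_det[OF assms(1,2)])
  fix c d assume cd: "c \<in> lsupp p" "d \<in> lsupp p"
  obtain s where s: "\<And>c. c \<in> lsupp p \<Longrightarrow> \<exists>m n. c = s + m *s a + n *s b"
    using assms(3) by (auto simp: supp_coset_def)
  obtain m n m' n' where "c = s + m *s a + n *s b" "d = s + m' *s a + n' *s b"
    using s[OF cd(1)] s[OF cd(2)] by blast
  hence "c - d = (m - m') *s a + (n - n') *s b" by (simp add: lattice_eq_iff algebra_simps)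
  thus "\<exists>m n. c - d = m *s a + n *s b" by blast
qed

lemma unit_lmonom_mult: "u dvd 1 \<Longrightarrow> laurent_unit (lmonom 1 a * u * lmonom 1 b)"
  unfolding laurent_unit_iff
  using mult_dvd_mono[OF mult_dvd_mono[OF lmonom_dvd_1[of 1 a]] lmonom_dvd_1[of 1 b], of u 1] by simp

lemma lmonom_1_power: "lmonom 1 a ^ n = lmonom 1 (int n *s a)"
  by (induction n) (auto simp: lmonom_1 lmonom_mult algebra_simps intro: arg_cong[of _ _ "lmonom 1"])

lemma edge_normal_translate: "edge_normal (lmonom 1 m * p) w \<longleftrightarrow> edge_normal p w"
  and ordw_translate: "p \<noteq> 0 \<Longrightarrow> ordw w (lmonom 1 m * p) = pairing w m + ordw w p"
proof -
  show o: "p \<noteq> 0 \<Longrightarrow> ordw w (lmonom 1 m * p) = pairing w m + ordw w p"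
    by (simp add: ordw_mult ordw_lmonom)
  show "edge_normal (lmonom 1 m * p) w \<longleftrightarrow> edge_normal p w"
    by (cases "p = 0") (auto simp: edge_normal_def lsupp_lmonom_mult o)
qed

lemma phat_planar: "planar (phat m p) \<longleftrightarrow> planar p"
  by (simp add: planar_def phat_def lsupp_lmonom_mult)

lemma phat_edge_regular:
  assumes "planar p" "unimodular_support p"
  shows "edge_regular (phat m p)"
  unfolding edge_regular_def
proof (intro allI impI)
  fix w assume "edge_normal (phat m p) w"
  hence "edge_normal p w" by (simp add: phat_def edge_normal_translate)
  then obtain c where c: "c \<in> lsupp p" "pairing w c = ordw w p + 1"
    using unimodular_next_level[OF assms] unfolding edge_normal_def by blast
  hence "p \<noteq> 0" by auto
  thus "\<exists>c\<in>lsupp (phat m p). pairing w c = ordw w (phat m p) + 1"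
    using c by (intro bexI[of _ "- m + c"]) (auto simp: phat_def ordw_translate lsupp_lmonom_mult)
qed

lemma unimodular_hessian_dvd_imp_normal_form:
  assumes "effective_rank p = 2" "unimodular_support p" "lmu m0 p dvd p ^ N"
  shows "\<exists>q. laurent_equiv p q \<and> (simplex_form q \<or> product_form q)"
proof -
  have pl: "planar p" by (rule effective_rank_2_planar) fact
  hence nz: "p \<noteq> 0" by (auto simp: planar_def)
  let ?p = "phat m0 p"
  have p_eq: "p = lmonom 1 m0 * ?p"
    by (simp add: phat_def lmonom_mult lmonom_1 flip: mult.assoc)
  have pl': "planar ?p" using pl by (simp add: phat_planar)
  have "hessian ?p dvd p ^ N" using assms(3) by (simp add: lmu_eq_lhess_det nz)
  also have "p ^ N dvd ?p ^ N"
    unfolding power_mult_distrib phat_def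
    using dvd_mult[of "p ^ N" "p ^ N" "lmonom 1 (- m0) ^ N"] by simp
  finally have "(\<exists>u x n a b c. u dvd 1 \<and> ?p = u * x ^ n \<and> n > 0 \<and> lsupp x = {a, b, c} \<and>
           cross (b - a) (c - a) \<noteq> 0) \<or>
    (\<exists>u x y m n a b c d. u dvd 1 \<and> ?p = u * x ^ m * y ^ n \<and> m > 0 \<and> n > 0 \<and>
       lsupp x = {a, b} \<and> lsupp y = {c, d} \<and> cross (b - a) (d - c) \<noteq> 0)"
    by (rule classification[OF pl' phat_edge_regular[OF pl assms(2)]])
  thus ?thesis
  proof (elim disjE exE conjE)
    fix u x n a b c
    assume u: "u dvd 1" and p: "?p = u * x ^ n" and n: "n > 0" and x: "lsupp x = {a, b, c}"
      and cr: "cross (b - a) (c - a) \<noteq> 0"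
    have ne: "a \<noteq> b" "a \<noteq> c" "b \<noteq> c" using cr by (auto simp: cross_def)
    obtain \<alpha>0 \<alpha>1 \<alpha>2 where \<alpha>: "\<alpha>0 \<noteq> 0" "\<alpha>1 \<noteq> 0" "\<alpha>2 \<noteq> 0"
      "x = lmonom 1 a * ltrinomial \<alpha>0 \<alpha>1 \<alpha>2 (b - a) (c - a)"
      using x ne by (rule three_term)
    define v where "v = lmonom 1 m0 * u * lmonom 1 (int n *s a)"
    have v: "laurent_unit v" unfolding v_def using u by (rule unit_lmonom_mult)
    have pv: "p = v * ltrinomial \<alpha>0 \<alpha>1 \<alpha>2 (b - a) (c - a) ^ n"
      by (subst p_eq) (simp add: p \<alpha>(4) power_mult_distrib lmonom_1_power v_def mult_ac)
    have "supp_coset (b - a) (c - a) p"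
      using v unfolding pv laurent_unit_def
      by (auto intro!: supp_coset_mult supp_coset_lmonom supp_coset_power supp_coset_trinomial)
    hence "invertible (basis_matrix (b - a) (c - a))"
      using unimodular_coset[OF pl assms(2)] basis_matrix_invertible by blast
    moreover have "p = v * monomial_change (basis_matrix (b - a) (c - a))
        (ltrinomial \<alpha>0 \<alpha>1 \<alpha>2 (axis 1 1) (axis 2 1) ^ n)"
      by (simp add: monomial_change_power monomial_change_trinomial pv)
    ultimately have "laurent_equiv p (ltrinomial \<alpha>0 \<alpha>1 \<alpha>2 (axis 1 1) (axis 2 1) ^ n)"
      using v unfolding laurent_equiv_def by blast
    moreover have "simplex_form (ltrinomial \<alpha>0 \<alpha>1 \<alpha>2 (axis 1 1) (axis 2 1) ^ n)"
      unfolding simplex_form_alt using \<alpha>(1-3) n by blast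
    ultimately show ?thesis by blast
  next
    fix u x y m n a b c d
    assume u: "u dvd 1" and p: "?p = u * x ^ m * y ^ n" and mn: "m > 0" "n > 0"
      and xy: "lsupp x = {a, b}" "lsupp y = {c, d}" and cr: "cross (b - a) (d - c) \<noteq> 0"
    have ne: "a \<noteq> b" "c \<noteq> d" using cr by (auto simp: cross_def)
    obtain \<alpha>0 \<alpha>1 where \<alpha>: "\<alpha>0 \<noteq> 0" "\<alpha>1 \<noteq> 0" "x = lmonom 1 a * lbinomial \<alpha>0 \<alpha>1 (b - a)"
      using xy(1) ne(1) by (rule two_term)
    obtain \<beta>0 \<beta>1 where \<beta>: "\<beta>0 \<noteq> 0" "\<beta>1 \<noteq> 0" "y = lmonom 1 c * lbinomial \<beta>0 \<beta>1 (d - c)"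
      using xy(2) ne(2) by (rule two_term)
    define v where "v = lmonom 1 m0 * u * lmonom 1 (int m *s a + int n *s c)"
    have v: "laurent_unit v" unfolding v_def using u by (rule unit_lmonom_mult)
    have "lmonom 1 (int m *s a + int n *s c) = lmonom 1 a ^ m * lmonom 1 c ^ n"
      by (simp add: lmonom_1_power lmonom_mult)
    hence pv: "p = v * (lbinomial \<alpha>0 \<alpha>1 (b - a) ^ m * lbinomial \<beta>0 \<beta>1 (d - c) ^ n)"
      by (subst p_eq) (simp add: p \<alpha>(3) \<beta>(3) power_mult_distrib v_def mult_ac)
    have "supp_coset (b - a) (d - c) p"
      using v unfolding pv laurent_unit_def
      by (auto intro!: supp_coset_mult supp_coset_lmonom supp_coset_power supp_coset_binomial)
    hence "invertible (basis_matrix (b - a) (d - c))"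
      using unimodular_coset[OF pl assms(2)] basis_matrix_invertible by blast
    moreover have "p = v * monomial_change (basis_matrix (b - a) (d - c))
        (lbinomial \<alpha>0 \<alpha>1 (axis 1 1) ^ m * lbinomial \<beta>0 \<beta>1 (axis 2 1) ^ n)"
      by (simp add: monomial_change_power monomial_change_mult monomial_change_binomial pv)
    ultimately have "laurent_equiv p (lbinomial \<alpha>0 \<alpha>1 (axis 1 1) ^ m * lbinomial \<beta>0 \<beta>1 (axis 2 1) ^ n)"
      using v unfolding laurent_equiv_def by blast
    moreover have "product_form (lbinomial \<alpha>0 \<alpha>1 (axis 1 1) ^ m * lbinomial \<beta>0 \<beta>1 (axis 2 1) ^ n)"
      unfolding product_form_alt using \<alpha>(1,2) \<beta>(1,2) mn by blast
    ultimately show ?thesis by blast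
  qed
qed

section \<open>The Hessian determinant of the normal forms\<close>

text \<open>In the dual basis w, z the Euler derivations are those of the coordinates with exponents
  a and b. The factor D, 1 or -1, stands for division by the determinant.\<close>

lemma dual_basis:
  assumes "\<bar>cross a b\<bar> = 1"
  obtains w z where "pairing w a = 1" "pairing w b = 0" "pairing z a = 0" "pairing z b = 1"
    "(cross w z)\<^sup>2 = 1"
proof -
  define D where "D = cross a b"
  have D: "D * D = 1" using assms by (auto simp: D_def abs_if split: if_splits)
  define w z :: lattice where "w = vector [D * b $ 2, - D * b $ 1]" and "z = vector [- D * a $ 2, D * a $ 1]"
  have "pairing w a = D * D" "pairing w b = 0" "pairing z a = 0" "pairing z b = D * D"
    "cross w z = D * D * D"
    by (simp_all add: w_def z_def pairing_def cross_def vector_2 D_def algebra_simps)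
  thus ?thesis using that[of w z] D by (simp add: power2_eq_square)
qed

lemma lhess_det_unimodular': "(cross w z)\<^sup>2 = 1 \<Longrightarrow> lhess_det w z p = hessian p"
  by (subst lhess_det_basis) simp

lemma of_nat_unit: "(of_nat (Suc n) :: laurent) dvd 1"
  unfolding of_nat_laurent by (rule lmonom_dvd_1) (simp del: of_nat_Suc)

text \<open>In the dual basis, with X and Y the last two terms of T, the determinant is (T - X - Y)
  X Y, the product of the three terms of T. It is a unit, so only the power T^(3n) remains.\<close>

lemma hessian_trinomial_power:
  assumes "\<bar>cross a b\<bar> = 1" "\<alpha>0 \<noteq> 0" "\<alpha>1 \<noteq> 0" "\<alpha>2 \<noteq> 0"
  shows "hessian (ltrinomial \<alpha>0 \<alpha>1 \<alpha>2 a b ^ Suc n) dvd (ltrinomial \<alpha>0 \<alpha>1 \<alpha>2 a b ^ Suc n) ^ 3"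
proof -
  obtain w z where wz: "pairing w a = 1" "pairing w b = 0" "pairing z a = 0" "pairing z b = 1"
    "(cross w z)\<^sup>2 = 1" using dual_basis[OF assms(1)] by blast
  let ?T = "ltrinomial \<alpha>0 \<alpha>1 \<alpha>2 a b"
  have E: "Eul w ?T = lmonom \<alpha>1 a" "Eul z ?T = lmonom \<alpha>2 b"
    by (simp_all add: ltrinomial_def Eul_add Eul_lmonom wz)
  have "lhess_det w z ?T = lmonom \<alpha>0 0 * (lmonom \<alpha>1 a * lmonom \<alpha>2 b)"
    unfolding lhess_det_def E Eul_lmonom wz
    by (simp add: ltrinomial_def power2_eq_square algebra_simps)
  hence D: "hessian ?T = lmonom (\<alpha>0 * (\<alpha>1 * \<alpha>2)) (a + b)"
    using lhess_det_unimodular'[OF wz(5)] by (simp add: lmonom_mult)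
  have T: "?T \<noteq> 0"
  proof
    assume "?T = 0"
    hence "hessian ?T = 0" by (simp add: lhess_det_def)
    thus False using assms(2-4) by (simp add: D)
  qed
  have one: "lhess w z 1 = 0" "hessian 1 = 0" for w z
    by (simp_all add: lhess_def lhess_det_def)
  have "hessian (?T ^ Suc n * 1) = ?T ^ (3 * n) * ((of_nat (Suc n))\<^sup>2 * hessian ?T)"
    using lhess_det_power_mult[OF T, of 1] by (simp add: lhess_mixed_def one)
  also have "\<dots> dvd ?T ^ (3 * Suc n) * 1"
  proof (intro mult_dvd_mono le_imp_power_dvd)
    have "(of_nat (Suc n))\<^sup>2 * hessian ?T dvd 1\<^sup>2 * 1"
      unfolding D using assms(2-4)
      by (intro mult_dvd_mono dvd_power_same of_nat_unit lmonom_dvd_1) simp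
    thus "(of_nat (Suc n))\<^sup>2 * hessian ?T dvd 1" by simp
  qed simp
  finally show ?thesis by (simp only: mult_1_right power_mult[symmetric] mult.commute[of 3])
qed

text \<open>In the dual basis f contributes only \<open>lhess w w\<close> and g only
  \<open>lhess z z\<close>, both monomials. The determinant is a unit times f^(3r+1)
  g^(3s+1).\<close>

lemma hessian_binomial_product:
  assumes "\<bar>cross a b\<bar> = 1" "\<alpha>0 \<noteq> 0" "\<alpha>1 \<noteq> 0" "\<beta>0 \<noteq> 0" "\<beta>1 \<noteq> 0"
  shows "hessian (lbinomial \<alpha>0 \<alpha>1 a ^ Suc r * lbinomial \<beta>0 \<beta>1 b ^ Suc s) dvd
    (lbinomial \<alpha>0 \<alpha>1 a ^ Suc r * lbinomial \<beta>0 \<beta>1 b ^ Suc s) ^ 3"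
proof -
  obtain w z where wz: "pairing w a = 1" "pairing w b = 0" "pairing z a = 0" "pairing z b = 1"
    "(cross w z)\<^sup>2 = 1" using dual_basis[OF assms(1)] by blast
  let ?f = "lbinomial \<alpha>0 \<alpha>1 a" and ?g = "lbinomial \<beta>0 \<beta>1 b"
  let ?G = "?g ^ Suc s"
  have E: "Eul w ?f = lmonom \<alpha>1 a" "Eul z ?f = 0" "Eul w ?g = 0" "Eul z ?g = lmonom \<beta>1 b"
    by (simp_all add: lbinomial_def Eul_add Eul_lmonom wz)
  have f: "lhess w w ?f = lmonom (\<alpha>0 * \<alpha>1) a" "lhess w z ?f = 0" "lhess z z ?f = 0"
    and g: "lhess w w ?g = 0" "lhess w z ?g = 0" "lhess z z ?g = lmonom (\<beta>0 * \<beta>1) b"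
    unfolding lhess_def E Eul_lmonom wz Eul_0
    by (simp_all add: lbinomial_def lmonom_mult algebra_simps)
  have nz: "?f \<noteq> 0" "?g \<noteq> 0" using f(1) g(3) assms(2-5) by (auto simp: lhess_def)
  hence Gnz: "?G \<noteq> 0" by simp
  have G: "lhess w w ?G = 0" "lhess w z ?G = 0"
    "lhess z z ?G = of_nat (Suc s) * ?g ^ (2 * s) * lmonom (\<beta>0 * \<beta>1) b"
    unfolding lhess_power g by simp_all
  have "?f * lhess_det w z ?f = 0" unfolding lhess_det_eq by (simp add: f)
  hence Df: "lhess_det w z ?f = 0" using nz by simp
  have "?G * lhess_det w z ?G = 0" unfolding lhess_det_eq G by simp
  hence DG: "lhess_det w z ?G = 0" using Gnz by simp
  have "hessian (?f ^ Suc r * ?G) = lhess_det w z (?f ^ Suc r * ?G)"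
    using lhess_det_unimodular'[OF wz(5)] by simp
  also have "\<dots> = ?f ^ (3 * r) * (of_nat (Suc r) * ?f * ?G *
      (lmonom (\<alpha>0 * \<alpha>1) a * (of_nat (Suc s) * ?g ^ (2 * s) * lmonom (\<beta>0 * \<beta>1) b)))"
    unfolding lhess_det_power_mult[OF nz(1) Gnz] lhess_mixed_def f Df DG G by simp
  also have "\<dots> = ?f ^ (3 * r + 1) * ?g ^ (Suc s + 2 * s) *
      ((of_nat (Suc r) * of_nat (Suc s)) * (lmonom (\<alpha>0 * \<alpha>1) a * lmonom (\<beta>0 * \<beta>1) b))"
    by (simp only: power_add power_one_right mult_ac)
  also have "\<dots> dvd ?f ^ (3 * Suc r) * ?g ^ (3 * Suc s) * ((1 * 1) * (1 * 1))"
    using assms(2-5) by (intro mult_dvd_mono le_imp_power_dvd of_nat_unit lmonom_dvd_1) auto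
  also have "\<dots> = (?f ^ Suc r * ?G) ^ 3"
    by (simp only: mult_1_right power_mult_distrib power_mult[symmetric] mult.commute[of 3])
  finally show ?thesis .
qed

lemma lmu_dvd_cube:
  assumes "hessian q dvd q ^ 3" "q \<noteq> 0" "c \<noteq> 0"
  shows "lmu m (lmonom c d * q) dvd (lmonom c d * q) ^ 3"
proof -
  have "lmu m (lmonom c d * q) = hessian (lmonom c (d - m) * q)"
    using assms by (simp add: lmu_eq_lhess_det phat_def lmonom_mult flip: mult.assoc)
  also have "\<dots> = lmonom 1 (- m) ^ 3 * (lmonom c d ^ 3 * hessian q)"
    unfolding lhess_det_lmonom_mult
    by (simp add: lmonom_mult flip: mult.assoc power_mult_distrib)
  also have "\<dots> dvd 1 ^ 3 * (lmonom c d ^ 3 * q ^ 3)"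
    using assms(1) by (intro mult_dvd_mono dvd_power_same lmonom_dvd_1) auto
  finally show ?thesis by (simp add: power_mult_distrib)
qed

lemma invertible_columns:
  fixes g :: "int ^ 2 ^ 2"
  assumes "invertible g"
  shows "\<bar>cross (g *v axis 1 1) (g *v axis 2 1)\<bar> = 1"
proof -
  obtain B where "g ** B = mat 1" using assms by (auto simp: invertible_def)
  hence "det g * det B = 1" by (metis det_I det_mul)
  hence "det g dvd 1" by (metis dvdI)
  moreover have "cross (g *v axis 1 1) (g *v axis 2 1) = det g"
    by (simp add: cross_def det_2 matrix_vector_mult_def sum_2)
  ultimately show ?thesis by simp
qed

lemma normal_form_imp_lmu_dvd_cube:
  assumes "laurent_equiv p q" "simplex_form q \<or> product_form q" "m0 \<in> lsupp p"
  shows "lmu m0 p dvd p ^ 3"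
proof -
  obtain c d g where g: "c \<noteq> 0" "invertible g" "p = lmonom c d * monomial_change g q"
    using assms(1) by (auto simp: laurent_equiv_def laurent_unit_def)
  define a b where "a = g *v axis 1 1" and "b = g *v axis 2 1"
  have ab: "\<bar>cross a b\<bar> = 1" unfolding a_def b_def by (rule invertible_columns) fact
  have "monomial_change g q \<noteq> 0" using assms(3) g(3) by auto
  moreover have "hessian (monomial_change g q) dvd monomial_change g q ^ 3"
    using assms(2)
  proof
    assume "simplex_form q"
    then obtain \<alpha>0 \<alpha>1 \<alpha>2 m where q: "\<alpha>0 \<noteq> 0" "\<alpha>1 \<noteq> 0" "\<alpha>2 \<noteq> 0" "m > 0"
      "q = ltrinomial \<alpha>0 \<alpha>1 \<alpha>2 (axis 1 1) (axis 2 1) ^ m"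
      unfolding simplex_form_alt by blast
    then obtain n where "m = Suc n" by (cases m) auto
    thus ?thesis using hessian_trinomial_power[OF ab q(1-3)]
      by (simp add: q(5) monomial_change_power monomial_change_trinomial a_def b_def del: power_Suc)
  next
    assume "product_form q"
    then obtain \<alpha>0 \<alpha>1 \<beta>0 \<beta>1 r s where q: "\<alpha>0 \<noteq> 0" "\<alpha>1 \<noteq> 0" "\<beta>0 \<noteq> 0" "\<beta>1 \<noteq> 0" "r > 0" "s > 0"
      "q = lbinomial \<alpha>0 \<alpha>1 (axis 1 1) ^ r * lbinomial \<beta>0 \<beta>1 (axis 2 1) ^ s"
      unfolding product_form_alt by blast
    then obtain r' s' where "r = Suc r'" "s = Suc s'" by (cases r; cases s) auto
    thus ?thesis using hessian_binomial_product[OF ab q(1-4)]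
      by (simp add: q(7) monomial_change_power monomial_change_mult monomial_change_binomial
          a_def b_def del: power_Suc)
  qed
  ultimately show ?thesis unfolding g(3) using g(1) by (intro lmu_dvd_cube)
qed

theorem theorem1:
  shows "(\<forall>p m0 N. effective_rank p = 2 \<and> unimodular_support p \<and> m0 \<in> lsupp p \<and> N > 0 \<and>
            lmu m0 p dvd p ^ N \<longrightarrow>
            (\<exists>q. laurent_equiv p q \<and> (simplex_form q \<or> product_form q)))
       \<and> (\<forall>p q m0. laurent_equiv p q \<and> (simplex_form q \<or> product_form q) \<and> m0 \<in> lsupp p \<longrightarrow>
            lmu m0 p dvd p ^ 3)"
  using unimodular_hessian_dvd_imp_normal_form normal_form_imp_lmu_dvd_cube by blast

end
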